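(* Let $G$ be an infinite connected quasi-transitive graph with distinguished vertex $0$, let $p_c=p_c(G\times\mathbb{Z})$ be the critical point of homogeneous Bernoulli bond percolation on $G\times\mathbb{Z}$, and consider the Overlap Model on $G\times\mathbb{Z}$ defined by i.i.d. random variables $\{X_n;\,n\in\mathbb{Z}\}$ supported on $\mathbb{N}=\{1,2,3,\dots\}$ with common distribution that of $X$. For $0<p<p_c<q<1$, we have $$\theta^{\Lambda}(p,q)=0 \ \text{ for } \nu\text{-almost every environment } \Lambda \quad\iff\quad E X<\infty .$$
   Context: Quasi-transitive: a graph $G=(V,E)$ (with finite vertex degrees) is quasi-transitive if there is a finite set $V_0\subset V$ such that for every $w\in V$ there exist $x\in V_0$ and an automorphism $\tau$ of $G$ with $\tau(w)=x$. Product graph: $G\times\mathbb{Z}$ is the Cartesian (box) product: its vertex set is $V\times\mathbb{Z}$, and $(v_1,v_2)$, $(w_1,w_2)$ are adjacent iff either $v_1=w_1$ and $|v_2-w_2|=1$, or $v_1\sim w_1$ in $G$ and $v_2=w_2$. A vertex of $G$ is distinguished and called $0$; the origin $(0,0)$ of $G\times\mathbb{Z}$ is also denoted $0$. Balls and boxes: $B_G(r)=\{v\in V: d_G(0,v)\le r\}$, where $d_G$ is graph distance, and for $a\in\mathbb{Z}$, $B(a,r)=B_G(r)\times([a-r,a+r]\cap\mathbb{Z})\subset G\times\mathbb{Z}$. Homogeneous percolation: each edge of $G\times\mathbb{Z}$ is open independently with probability $p$; $\theta(p)$ is the probability that there is an infinite open path starting from the origin, and $p_c(G\times\mathbb{Z})=\sup\{p\in[0,1]:\theta(p)=0\}$.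 Environment: $\{X_n;n\in\mathbb{Z}\}$ are i.i.d. with values in $\mathbb{N}$, defined on $(\Xi,\mathcal{G},\nu)$ with $\Xi=\mathbb{N}^{\mathbb{Z}}$ and $\mathcal{G}=\sigma(X_n,n\in\mathbb{Z})$; $E$ is expectation with respect to $\nu$. An element $\Lambda\in\Xi$ is called an environment. Overlap Model: given $\Lambda$, let $B_n=B(n,X_n)$ and $R=R(\Lambda)=\bigcup_{n\in\mathbb{Z}}B_n$. Given $\Lambda$, under the quenched measure $\mathbb{P}^{\Lambda}_{p,q}$ the edges of $G\times\mathbb{Z}$ are open independently, each edge in $R$ (i.e. with both endpoints in $R$) with probability $q$ and every other edge with probability $p$. $\theta^{\Lambda}(p,q)$ is the $\mathbb{P}^{\Lambda}_{p,q}$-probability that there is an infinite open path starting from the origin of $G\times\mathbb{Z}$. *)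

theory Defs
  imports "HOL-Probability.Probability" "HOL-Library.Ramsey"
begin

text \<open>
  A simple graph is given by a vertex set \<open>V\<close> and a set \<open>E\<close> of two-element subsets of \<open>V\<close>.
\<close>

definition simple_graph :: "'a set \<Rightarrow> 'a set set \<Rightarrow> bool" where
  "simple_graph V E \<longleftrightarrow> E \<subseteq> nsets V 2"

definition adj_rel :: "'a set set \<Rightarrow> ('a \<times> 'a) set" where
  "adj_rel E = {(u, v). {u, v} \<in> E}"

definition connected_graph :: "'a set \<Rightarrow> 'a set set \<Rightarrow> bool" where
  "connected_graph V E \<longleftrightarrow> (\<forall>u\<in>V. \<forall>v\<in>V. (u, v) \<in> (adj_rel E)\<^sup>*)"

definition locally_finite_graph :: "'a set \<Rightarrow> 'a set set \<Rightarrow> bool" where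
  "locally_finite_graph V E \<longleftrightarrow> (\<forall>v\<in>V. finite {w. {v, w} \<in> E})"

definition graph_automorphism :: "'a set \<Rightarrow> 'a set set \<Rightarrow> ('a \<Rightarrow> 'a) \<Rightarrow> bool" where
  "graph_automorphism V E \<tau> \<longleftrightarrow>
     bij_betw \<tau> V V \<and> (\<forall>u\<in>V. \<forall>v\<in>V. {\<tau> u, \<tau> v} \<in> E \<longleftrightarrow> {u, v} \<in> E)"

definition quasi_transitive :: "'a set \<Rightarrow> 'a set set \<Rightarrow> bool" where
  "quasi_transitive V E \<longleftrightarrow> locally_finite_graph V E \<and>
     (\<exists>V0\<subseteq>V. finite V0 \<and> (\<forall>w\<in>V. \<exists>x\<in>V0. \<exists>\<tau>. graph_automorphism V E \<tau> \<and> \<tau> w = x))"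

text \<open>
  The relational power \<open>adj_rel E ^^ n\<close> relates the endpoints of walks of length \<open>n\<close>. The distance
  is only meaningful between vertices in the same component.
\<close>

definition graph_dist :: "'a set set \<Rightarrow> 'a \<Rightarrow> 'a \<Rightarrow> nat" where
  "graph_dist E u v = (LEAST n. (u, v) \<in> adj_rel E ^^ n)"

definition graph_ball :: "'a set \<Rightarrow> 'a set set \<Rightarrow> 'a \<Rightarrow> nat \<Rightarrow> 'a set" where
  "graph_ball V E z r = {v \<in> V. graph_dist E z v \<le> r}"

definition prod_int_edges :: "'a set \<Rightarrow> 'a set set \<Rightarrow> ('a \<times> int) set set" where
  "prod_int_edges V E =
     {{(v1, v2), (w1, w2)} | v1 v2 w1 w2. v1 \<in> V \<and> w1 \<in> V \<and>
        (v1 = w1 \<and> \<bar>v2 - w2\<bar> = 1 \<or> {v1, w1} \<in> E \<and> v2 = w2)}"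

text \<open>
  Bernoulli bond percolation with edge-dependent parameters: under \<open>bond_measure E \<pi>\<close> the states of
  the edges are independent, and \<open>e\<close> is open (state \<open>True\<close>) with probability \<open>\<pi> e\<close>. Infinite paths
  are self-avoiding, since otherwise a single open edge would carry one.
\<close>

definition bond_measure :: "'b set set \<Rightarrow> ('b set \<Rightarrow> real) \<Rightarrow> ('b set \<Rightarrow> bool) measure" where
  "bond_measure E \<pi> = PiM E (\<lambda>e. measure_pmf (bernoulli_pmf (\<pi> e)))"

definition infinite_open_path :: "'b set set \<Rightarrow> ('b set \<Rightarrow> bool) \<Rightarrow> 'b \<Rightarrow> (nat \<Rightarrow> 'b) \<Rightarrow> bool" where
  "infinite_open_path E \<omega> z \<gamma> \<longleftrightarrow>
     \<gamma> 0 = z \<and> inj \<gamma> \<and> (\<forall>n. {\<gamma> n, \<gamma> (Suc n)} \<in> E \<and> \<omega> {\<gamma> n, \<gamma> (Suc n)})"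

definition perc_prob :: "'b set set \<Rightarrow> ('b set \<Rightarrow> real) \<Rightarrow> 'b \<Rightarrow> real" where
  "perc_prob E \<pi> z =
     measure (bond_measure E \<pi>) {\<omega> \<in> space (bond_measure E \<pi>). \<exists>\<gamma>. infinite_open_path E \<omega> z \<gamma>}"

definition theta_hom :: "'a set \<Rightarrow> 'a set set \<Rightarrow> 'a \<Rightarrow> real \<Rightarrow> real" where
  "theta_hom V E z p = perc_prob (prod_int_edges V E) (\<lambda>_. p) (z, 0)"

definition p_crit :: "'a set \<Rightarrow> 'a set set \<Rightarrow> 'a \<Rightarrow> real" where
  "p_crit V E z = Sup {p \<in> {0..1}. theta_hom V E z p = 0}"

text \<open>
  An environment assigns to each integer \<open>n\<close> the radius \<open>\<Lambda> n\<close> of the box centred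
  at height \<open>n\<close>; the radii are i.i.d. with law \<open>D\<close>.
\<close>

definition env_measure :: "nat pmf \<Rightarrow> (int \<Rightarrow> nat) measure" where
  "env_measure D = PiM UNIV (\<lambda>_. measure_pmf D)"

definition overlap_box :: "'a set \<Rightarrow> 'a set set \<Rightarrow> 'a \<Rightarrow> int \<Rightarrow> nat \<Rightarrow> ('a \<times> int) set" where
  "overlap_box V E z a r = graph_ball V E z r \<times> {a - int r..a + int r}"

definition overlap_region :: "'a set \<Rightarrow> 'a set set \<Rightarrow> 'a \<Rightarrow> (int \<Rightarrow> nat) \<Rightarrow> ('a \<times> int) set" where
  "overlap_region V E z \<Lambda> = (\<Union>n. overlap_box V E z n (\<Lambda> n))"

definition theta_overlap ::
    "'a set \<Rightarrow> 'a set set \<Rightarrow> 'a \<Rightarrow> (int \<Rightarrow> nat) \<Rightarrow> real \<Rightarrow> real \<Rightarrow> real" where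
  "theta_overlap V E z \<Lambda> p q =
     perc_prob (prod_int_edges V E) (\<lambda>e. if e \<subseteq> overlap_region V E z \<Lambda> then q else p) (z, 0)"

end

theory Submission
  imports Defs
begin

text \<open>
  If \<open>E X = \<infinity>\<close>, then by independence every vertex lies in infinitely many boxes almost surely, so that
  the model is homogeneous percolation with parameter \<open>q > p\<^sub>c\<close>.

  Let \<open>E X < \<infinity>\<close>. By the argument of Duminil-Copin and Tassion the connection probabilities
  decay exponentially for \<open>p < p\<^sub>c\<close>; on a quasi-transitive graph the finite sets with \<open>\<phi>\<^sub>p(S) < 1\<close> exist
  around every vertex, since otherwise a differential inequality makes \<open>\<theta>(p')\<close> positive for every \<open>p' > p\<close>.
  For small \<open>\<epsilon>\<close> and large \<open>M\<close> there are, almost surely, infinitely many heights \<open>c\<close> in both directions with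
  \<open>X\<^bsub>c+k\<^esub> \<le> M + \<epsilon> \<bar>k\<bar>\<close> for all \<open>k\<close>. Near such a height \<open>R\<close> is contained in a double cone of slope of order \<open>\<epsilon>\<close>.
  The number of vertices of the cone at vertical distance \<open>j\<close> from \<open>c\<close> is at most \<open>e\<^bsup>O(\<epsilon> j)\<^esup>\<close>, which the
  exponential decay beats for small \<open>\<epsilon>\<close>; hence with probability bounded below no open path that leaves \<open>R\<close>
  crosses from the lower to the upper half of \<open>R\<close>, and the finitely many edges near the apex are closed. Infinitely
  many such barriers in both directions exclude an infinite cluster, because clusters outside of \<open>R\<close> are finite.
  So an infinite cluster exists with probability less than 1, hence with probability 0.
\<close>

subsection \<open>Finite products of Bernoulli measures\<close>

text \<open>Nothing is known about \<open>q\<close>-percolation inside \<open>R \<Lambda>\<close>,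
  and a fixed environment is not translation invariant. Edges inside \<open>R \<Lambda>\<close> are
  therefore handled only by closing finitely many of them at a fixed cost. The rest is left to edges
  outside, where the parameter is exactly \<open>p\<close> and the decay of the homogeneous model
  applies to every finite set of edges. The infinitely many remaining sections of the cone cost a
  union bound, which is why the slope must be chosen after the decay rate.

  Barriers at different heights are dependent. But the cones around good heights are translates of
  each other, so the barrier probabilities are bounded below uniformly, and the limsup of the events
  keeps this bound. This gives the absence of infinite clusters with positive probability only;
  hence the zero-one law, for the existence of an infinite cluster anywhere.

  A finite mean enters as summability over k of P(X > M + \<epsilon> k), available for each slope
  \<epsilon>; for large M it makes a given height good with probability at least 1/2.\<close>

definition cprob :: "'e set \<Rightarrow> ('e \<Rightarrow> real) \<Rightarrow> ('e set \<Rightarrow> bool) \<Rightarrow> real" where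
  "cprob F \<pi> A = (\<Sum>\<omega>\<in>Pow F. of_bool (A \<omega>) * ((\<Prod>e\<in>\<omega>. \<pi> e) * (\<Prod>e\<in>F - \<omega>. 1 - \<pi> e)))"

lemma cprob_empty [simp]: "cprob {} \<pi> A = of_bool (A {})"
  by (simp add: cprob_def)

text \<open>Conditioning on the state of \<open>e\<close>. Configurations are sets of open edges, so
  opening \<open>e\<close> is \<open>insert e\<close>. This recursion drives the inductions over
  finite edge sets below, notably for the product formula and for the derivative in the
  parameter.\<close>

lemma cprob_insert:
  assumes "finite F" "e \<notin> F"
  shows "cprob (insert e F) \<pi> A = \<pi> e * cprob F \<pi> (\<lambda>\<omega>. A (insert e \<omega>)) + (1 - \<pi> e) * cprob F \<pi> A"
proof -
  have inj: "inj_on (insert e) (Pow F)"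
    using assms by (auto simp: inj_on_def)
  have disj: "Pow F \<inter> insert e ` Pow F = {}"
    using assms by auto
  have 1: "(\<Prod>x\<in>insert e \<omega>. \<pi> x) * (\<Prod>x\<in>insert e F - insert e \<omega>. 1 - \<pi> x) =
      \<pi> e * ((\<Prod>x\<in>\<omega>. \<pi> x) * (\<Prod>x\<in>F - \<omega>. 1 - \<pi> x))" if "\<omega> \<in> Pow F" for \<omega>
  proof -
    have "insert e F - insert e \<omega> = F - \<omega>" "finite \<omega>" "e \<notin> \<omega>"
      using that assms by (auto intro: finite_subset)
    then show ?thesis by simp
  qed
  have 2: "(\<Prod>x\<in>\<omega>. \<pi> x) * (\<Prod>x\<in>insert e F - \<omega>. 1 - \<pi> x) =
      (1 - \<pi> e) * ((\<Prod>x\<in>\<omega>. \<pi> x) * (\<Prod>x\<in>F - \<omega>. 1 - \<pi> x))" if "\<omega> \<in> Pow F" for \<omega>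
  proof -
    have "insert e F - \<omega> = insert e (F - \<omega>)" "e \<notin> F - \<omega>"
      using that assms by auto
    then show ?thesis using assms by simp
  qed
  let ?w = "\<lambda>F \<omega>. (\<Prod>e\<in>\<omega>. \<pi> e) * (\<Prod>e\<in>F - \<omega>. 1 - \<pi> e)"
  have "cprob (insert e F) \<pi> A = (\<Sum>\<omega>\<in>Pow F. of_bool (A \<omega>) * ?w (insert e F) \<omega>) +
      (\<Sum>\<omega>\<in>insert e ` Pow F. of_bool (A \<omega>) * ?w (insert e F) \<omega>)"
    unfolding cprob_def Pow_insert using assms disj by (intro sum.union_disjoint) auto
  also have "(\<Sum>\<omega>\<in>insert e ` Pow F. of_bool (A \<omega>) * ?w (insert e F) \<omega>) =
      (\<Sum>\<omega>\<in>Pow F. of_bool (A (insert e \<omega>)) * ?w (insert e F) (insert e \<omega>))"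
    by (subst sum.reindex[OF inj]) simp
  also have "\<dots> = (\<Sum>\<omega>\<in>Pow F. of_bool (A (insert e \<omega>)) * (\<pi> e * ?w F \<omega>))"
    by (intro sum.cong refl arg_cong2[where f = "(*)"] 1)
  also have "\<dots> = \<pi> e * cprob F \<pi> (\<lambda>\<omega>. A (insert e \<omega>))"
    unfolding cprob_def sum_distrib_left by (intro sum.cong refl) (simp only: mult_ac)
  also have "(\<Sum>\<omega>\<in>Pow F. of_bool (A \<omega>) * ?w (insert e F) \<omega>) =
      (\<Sum>\<omega>\<in>Pow F. of_bool (A \<omega>) * ((1 - \<pi> e) * ?w F \<omega>))"
    by (intro sum.cong refl arg_cong2[where f = "(*)"] 2)
  also have "\<dots> = (1 - \<pi> e) * cprob F \<pi> A"
    unfolding cprob_def sum_distrib_left by (intro sum.cong refl) (simp only: mult_ac)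
  finally show ?thesis by simp
qed

lemma cprob_cong:
  assumes "\<And>\<omega>. \<omega> \<subseteq> F \<Longrightarrow> A \<omega> = B \<omega>" "\<And>e. e \<in> F \<Longrightarrow> \<pi> e = \<pi>' e"
  shows "cprob F \<pi> A = cprob F \<pi>' B"
  unfolding cprob_def
proof (rule sum.cong[OF refl])
  fix \<omega> assume "\<omega> \<in> Pow F"
  then have \<omega>: "\<omega> \<subseteq> F" by simp
  have "(\<Prod>e\<in>\<omega>. \<pi> e) = (\<Prod>e\<in>\<omega>. \<pi>' e)" "(\<Prod>e\<in>F - \<omega>. 1 - \<pi> e) = (\<Prod>e\<in>F - \<omega>. 1 - \<pi>' e)"
    using assms(2) \<omega> by (auto intro!: prod.cong)
  then show "of_bool (A \<omega>) * ((\<Prod>e\<in>\<omega>. \<pi> e) * (\<Prod>e\<in>F - \<omega>. 1 - \<pi> e)) =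
      of_bool (B \<omega>) * ((\<Prod>e\<in>\<omega>. \<pi>' e) * (\<Prod>e\<in>F - \<omega>. 1 - \<pi>' e))"
    using assms(1)[OF \<omega>] by (simp only:)
qed

lemma cprob_True [simp]: "finite F \<Longrightarrow> cprob F \<pi> (\<lambda>_. True) = 1"
  by (induction F rule: finite_induct) (simp_all add: cprob_insert)

lemma cprob_not:
  assumes "finite F"
  shows "cprob F \<pi> (\<lambda>\<omega>. \<not> A \<omega>) = 1 - cprob F \<pi> A"
proof -
  have "cprob F \<pi> (\<lambda>\<omega>. \<not> A \<omega>) + cprob F \<pi> A = cprob F \<pi> (\<lambda>_. True)"
    unfolding cprob_def sum.distrib[symmetric] by (intro sum.cong) (auto simp: of_bool_def)
  then show ?thesis using assms by simp
qed

definition increasing :: "('e set \<Rightarrow> bool) \<Rightarrow> bool" where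
  "increasing A \<longleftrightarrow> (\<forall>\<omega> \<omega>'. \<omega> \<subseteq> \<omega>' \<longrightarrow> A \<omega> \<longrightarrow> A \<omega>')"

definition weights :: "'e set \<Rightarrow> ('e \<Rightarrow> real) \<Rightarrow> bool" where
  "weights F \<pi> \<longleftrightarrow> (\<forall>e\<in>F. 0 \<le> \<pi> e \<and> \<pi> e \<le> 1)"

lemma weights_subset: "weights F \<pi> \<Longrightarrow> F' \<subseteq> F \<Longrightarrow> weights F' \<pi>"
  by (auto simp: weights_def)

lemma weight_nonneg:
  assumes "weights F \<pi>" "\<omega> \<subseteq> F"
  shows "0 \<le> (\<Prod>e\<in>\<omega>. \<pi> e) * (\<Prod>e\<in>F - \<omega>. 1 - \<pi> e)"
  using assms by (intro mult_nonneg_nonneg prod_nonneg) (auto simp: weights_def)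

lemma cprob_nonneg: "weights F \<pi> \<Longrightarrow> 0 \<le> cprob F \<pi> A"
  unfolding cprob_def by (rule sum_nonneg, rule mult_nonneg_nonneg[OF _ weight_nonneg]) simp_all

lemma cprob_mono:
  assumes "weights F \<pi>" "\<And>\<omega>. \<omega> \<subseteq> F \<Longrightarrow> A \<omega> \<Longrightarrow> B \<omega>"
  shows "cprob F \<pi> A \<le> cprob F \<pi> B"
  unfolding cprob_def
proof (rule sum_mono)
  fix \<omega> assume "\<omega> \<in> Pow F"
  then have "\<omega> \<subseteq> F" by simp
  then show "of_bool (A \<omega>) * ((\<Prod>e\<in>\<omega>. \<pi> e) * (\<Prod>e\<in>F - \<omega>. 1 - \<pi> e))
      \<le> of_bool (B \<omega>) * ((\<Prod>e\<in>\<omega>. \<pi> e) * (\<Prod>e\<in>F - \<omega>. 1 - \<pi> e))"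
    using weight_nonneg[OF assms(1)] assms(2) by (intro mult_right_mono) (auto simp: of_bool_def)
qed

lemma cprob_le_1: "finite F \<Longrightarrow> weights F \<pi> \<Longrightarrow> cprob F \<pi> A \<le> 1"
  using cprob_mono[of F \<pi> A "\<lambda>_. True"] by simp

lemma cprob_le_sum:
  assumes "weights F \<pi>" "finite I" "\<And>\<omega>. \<omega> \<subseteq> F \<Longrightarrow> A \<omega> \<Longrightarrow> \<exists>i\<in>I. B i \<omega>"
  shows "cprob F \<pi> A \<le> (\<Sum>i\<in>I. cprob F \<pi> (B i))"
proof -
  have "of_bool (A \<omega>) \<le> (\<Sum>i\<in>I. of_bool (B i \<omega>) :: real)" if \<omega>: "\<omega> \<subseteq> F" for \<omega>
  proof (cases "A \<omega>")
    case True
    then obtain i where "i \<in> I" "B i \<omega>" using assms(3)[OF \<omega>] by blast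
    then show ?thesis
      using member_le_sum[of i I "\<lambda>i. of_bool (B i \<omega>) :: real"] assms(2) by simp
  qed (simp add: sum_nonneg)
  then have "cprob F \<pi> A \<le> (\<Sum>\<omega>\<in>Pow F. (\<Sum>i\<in>I. of_bool (B i \<omega>)) * ((\<Prod>e\<in>\<omega>. \<pi> e) * (\<Prod>e\<in>F - \<omega>. 1 - \<pi> e)))"
    unfolding cprob_def
    by (intro sum_mono, rule mult_right_mono[OF _ weight_nonneg[OF assms(1)]]) simp_all
  also have "\<dots> = (\<Sum>i\<in>I. cprob F \<pi> (B i))"
    unfolding cprob_def sum_distrib_right by (rule sum.swap)
  finally show ?thesis .
qed

text \<open>The counterpart of the union bound for mutually exclusive events. It turns sums over
  explored clusters, or over pivotal boundary edges, back into a single probability.\<close>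

lemma sum_cprob_le:
  assumes "weights F \<pi>" "finite I" "\<And>i \<omega>. i \<in> I \<Longrightarrow> \<omega> \<subseteq> F \<Longrightarrow> B i \<omega> \<Longrightarrow> A \<omega>"
    "\<And>i j \<omega>. i \<in> I \<Longrightarrow> j \<in> I \<Longrightarrow> \<omega> \<subseteq> F \<Longrightarrow> B i \<omega> \<Longrightarrow> B j \<omega> \<Longrightarrow> i = j"
  shows "(\<Sum>i\<in>I. cprob F \<pi> (B i)) \<le> cprob F \<pi> A"
proof -
  have *: "(\<Sum>i\<in>I. of_bool (B i \<omega>)) \<le> (of_bool (A \<omega>) :: real)" if "\<omega> \<subseteq> F" for \<omega>
  proof (cases "\<exists>i\<in>I. B i \<omega>")
    case True
    then obtain i where i: "i \<in> I" "B i \<omega>" by blast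
    have "(\<Sum>j\<in>I. of_bool (B j \<omega>)) = (\<Sum>j\<in>I. if j = i then 1 else 0 :: real)"
      using i assms(4) that by (intro sum.cong) (auto simp: of_bool_def)
    then show ?thesis using i assms that by (simp add: assms(3))
  qed (auto simp: sum_nonneg)
  have "(\<Sum>i\<in>I. cprob F \<pi> (B i)) =
      (\<Sum>\<omega>\<in>Pow F. (\<Sum>i\<in>I. of_bool (B i \<omega>)) * ((\<Prod>e\<in>\<omega>. \<pi> e) * (\<Prod>e\<in>F - \<omega>. 1 - \<pi> e)))"
    unfolding cprob_def sum_distrib_right by (rule sum.swap)
  also have "\<dots> \<le> cprob F \<pi> A"
    unfolding cprob_def
    by (intro sum_mono, rule mult_right_mono[OF * weight_nonneg[OF assms(1)]]) simp_all
  finally show ?thesis .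
qed

lemma cprob_Un:
  assumes "finite F1" "finite F2" "F1 \<inter> F2 = {}"
  shows "cprob (F1 \<union> F2) \<pi> (\<lambda>\<omega>. A (\<omega> \<inter> F1) \<and> B (\<omega> \<inter> F2)) = cprob F1 \<pi> A * cprob F2 \<pi> B"
  using assms(1,3)
proof (induction F1 arbitrary: A rule: finite_induct)
  case empty
  show ?case
  proof (cases "A {}")
    case True
    then show ?thesis by (auto intro!: cprob_cong simp: inf_absorb1)
  next
    case False
    then show ?thesis by (simp add: cprob_def)
  qed
next
  case (insert e F1)
  have e: "e \<notin> F1 \<union> F2" "finite (F1 \<union> F2)" "e \<notin> F2"
    using insert assms by auto
  have 1: "cprob (F1 \<union> F2) \<pi> (\<lambda>\<omega>. A (insert e \<omega> \<inter> insert e F1) \<and> B (insert e \<omega> \<inter> F2))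
      = cprob F1 \<pi> (\<lambda>\<omega>. A (insert e \<omega>)) * cprob F2 \<pi> B"
    using insert.IH[of "\<lambda>\<omega>. A (insert e \<omega>)"] insert.prems e(3) by simp
  have 2: "cprob (F1 \<union> F2) \<pi> (\<lambda>\<omega>. A (\<omega> \<inter> insert e F1) \<and> B (\<omega> \<inter> F2)) = cprob F1 \<pi> A * cprob F2 \<pi> B"
  proof -
    have "\<omega> \<inter> insert e F1 = \<omega> \<inter> F1" if "\<omega> \<subseteq> F1 \<union> F2" for \<omega>
      using that e by auto
    then have "cprob (F1 \<union> F2) \<pi> (\<lambda>\<omega>. A (\<omega> \<inter> insert e F1) \<and> B (\<omega> \<inter> F2)) =
        cprob (F1 \<union> F2) \<pi> (\<lambda>\<omega>. A (\<omega> \<inter> F1) \<and> B (\<omega> \<inter> F2))"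
      by (intro cprob_cong) auto
    then show ?thesis
      using insert.IH[of A] insert.prems by simp
  qed
  show ?case
    unfolding Un_insert_left cprob_insert[OF e(2,1)] cprob_insert[OF insert.hyps] 1 2
    by (simp add: algebra_simps)
qed

lemma cprob_indep:
  assumes "finite F" "F1 \<subseteq> F" "F2 \<subseteq> F" "F1 \<inter> F2 = {}"
  shows "cprob F \<pi> (\<lambda>\<omega>. A (\<omega> \<inter> F1) \<and> B (\<omega> \<inter> F2)) = cprob F1 \<pi> A * cprob F2 \<pi> B"
proof -
  have fin: "finite F1" "finite F2" "finite (F - F1)"
    using assms by (auto intro: finite_subset)
  have B: "cprob (F - F1) \<pi> (\<lambda>\<omega>. B (\<omega> \<inter> F2)) = cprob F2 \<pi> B"
  proof -
    have F: "F - F1 = F2 \<union> (F - F1 - F2)" using assms by auto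
    have "cprob (F - F1) \<pi> (\<lambda>\<omega>. B (\<omega> \<inter> F2)) = cprob (F2 \<union> (F - F1 - F2)) \<pi> (\<lambda>\<omega>. B (\<omega> \<inter> F2) \<and> True)"
      using F by simp
    also have "\<dots> = cprob F2 \<pi> B"
      using fin by (subst cprob_Un[where B = "\<lambda>_. True"]) auto
    finally show ?thesis .
  qed
  have "cprob F \<pi> (\<lambda>\<omega>. A (\<omega> \<inter> F1) \<and> B (\<omega> \<inter> F2)) =
      cprob (F1 \<union> (F - F1)) \<pi> (\<lambda>\<omega>. A (\<omega> \<inter> F1) \<and> B ((\<omega> \<inter> (F - F1)) \<inter> F2))"
  proof -
    have "\<omega> \<inter> (F - F1) \<inter> F2 = \<omega> \<inter> F2" for \<omega> using assms by auto
    then show ?thesis using assms(2) by (simp add: Un_absorb1)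
  qed
  also have "\<dots> = cprob F1 \<pi> A * cprob (F - F1) \<pi> (\<lambda>\<omega>. B (\<omega> \<inter> F2))"
    using fin by (subst cprob_Un[where B = "\<lambda>\<omega>. B (\<omega> \<inter> F2)"]) auto
  finally show ?thesis using B by simp
qed

lemma cprob_restrict:
  assumes "finite F" "F1 \<subseteq> F"
  shows "cprob F \<pi> (\<lambda>\<omega>. A (\<omega> \<inter> F1)) = cprob F1 \<pi> A"
  using cprob_indep[OF assms, of "{}" \<pi> A "\<lambda>_. True"] by simp

lemma cprob_all_open: "finite F \<Longrightarrow> cprob F \<pi> (\<lambda>\<omega>. \<omega> = F) = (\<Prod>e\<in>F. \<pi> e)"
  unfolding cprob_def by (subst sum.remove[of _ F]) (auto intro!: sum.neutral)

lemma cprob_all_closed: "finite F \<Longrightarrow> cprob F \<pi> (\<lambda>\<omega>. \<omega> = {}) = (\<Prod>e\<in>F. 1 - \<pi> e)"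
  unfolding cprob_def by (subst sum.remove[of _ "{}"]) (auto intro!: sum.neutral)

lemma cprob_image:
  assumes "inj_on h F"
  shows "cprob (h ` F) (\<lambda>_. p) A = cprob F (\<lambda>_. p) (\<lambda>\<omega>. A (h ` \<omega>))"
proof -
  have inj: "inj_on ((`) h) (Pow F)"
    using assms by (rule inj_on_image_Pow)
  have 1: "card (h ` \<omega>) = card \<omega>" if "\<omega> \<subseteq> F" for \<omega>
    using inj_on_subset[OF assms that] by (rule card_image)
  have 2: "card (h ` F - h ` \<omega>) = card (F - \<omega>)" if "\<omega> \<subseteq> F" for \<omega>
    using inj_on_image_set_diff[OF assms _ that, of F] 1[of "F - \<omega>"] by simp
  have "cprob (h ` F) (\<lambda>_. p) A = (\<Sum>\<omega>\<in>(`) h ` Pow F.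
      of_bool (A \<omega>) * ((\<Prod>e\<in>\<omega>. p) * (\<Prod>e\<in>h ` F - \<omega>. 1 - p)))"
    unfolding cprob_def by (simp only: image_Pow_surj[OF refl])
  also have "\<dots> = (\<Sum>\<omega>\<in>Pow F. of_bool (A (h ` \<omega>)) * (p ^ card (h ` \<omega>) * (1 - p) ^ card (h ` F - h ` \<omega>)))"
    by (subst sum.reindex[OF inj]) (simp only: o_def prod_constant)
  also have "\<dots> = cprob F (\<lambda>_. p) (\<lambda>\<omega>. A (h ` \<omega>))"
    unfolding cprob_def by (intro sum.cong refl) (simp only: 1 2 prod_constant Pow_iff)
  finally show ?thesis .
qed

text \<open>Russo's formula; only closed pivotal edges are counted.\<close>

lemma cprob_deriv:
  fixes A :: "'e set \<Rightarrow> bool"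
  assumes "finite F" "p < 1" "increasing A"
  shows "((\<lambda>p. cprob F (\<lambda>_. p) A) has_real_derivative
     (\<Sum>e\<in>F. cprob F (\<lambda>_. p) (\<lambda>\<omega>. e \<notin> \<omega> \<and> \<not> A \<omega> \<and> A (insert e \<omega>))) / (1 - p)) (at p)"
  using assms(1,3)
proof (induction F arbitrary: A rule: finite_induct)
  case empty
  then show ?case by simp
next
  case (insert e F)
  let ?P = "\<lambda>F A. cprob F (\<lambda>_. p) A"
  let ?Ae = "\<lambda>\<omega>. A (insert e \<omega>)"
  let ?piv = "\<lambda>A e \<omega>. e \<notin> \<omega> \<and> \<not> A \<omega> \<and> A (insert e \<omega>)"
  have mono: "increasing ?Ae"
    unfolding increasing_def
  proof (intro allI impI)
    fix \<omega> \<omega>' assume "\<omega> \<subseteq> \<omega>'" "A (insert e \<omega>)"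
    then have "insert e \<omega> \<subseteq> insert e \<omega>'" "A (insert e \<omega>)" by auto
    then show "A (insert e \<omega>')"
      using insert.prems unfolding increasing_def by blast
  qed
  have A_Ae: "A \<omega> \<Longrightarrow> ?Ae \<omega>" for \<omega>
    using insert.prems unfolding increasing_def by blast
  note IH = insert.IH[OF mono] insert.IH[OF insert.prems]
  \<comment> \<open>This is the product rule applied to the recursion of
    \<open>cprob_insert\<close>. The difference of the two conditional probabilities is the
    contribution of \<open>e\<close> itself: \<open>e\<close> is closed and pivotal with probability
    \<open>1 - p\<close> times this difference, whence the division by \<open>1 - p\<close> in the
    claim.\<close>
  let ?D = "(?P F ?Ae - ?P F A) + p * ((\<Sum>e\<in>F. ?P F (?piv ?Ae e)) / (1 - p))
     + (1 - p) * ((\<Sum>e\<in>F. ?P F (?piv A e)) / (1 - p))"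
  have der: "((\<lambda>p. p * cprob F (\<lambda>_. p) ?Ae + (1 - p) * cprob F (\<lambda>_. p) A) has_real_derivative ?D) (at p)"
    by (rule derivative_eq_intros IH refl | simp add: algebra_simps)+
  have e: "?P (insert e F) (?piv A e) = (1 - p) * (?P F ?Ae - ?P F A)"
  proof -
    have "?P F (\<lambda>\<omega>. e \<notin> \<omega> \<and> \<not> A \<omega> \<and> ?Ae \<omega>) = ?P F ?Ae - ?P F A"
      unfolding cprob_def sum_subtractf[symmetric] left_diff_distrib[symmetric]
      using insert.hyps A_Ae by (intro sum.cong refl arg_cong2[where f = "(*)"]) (auto simp: of_bool_def)
    moreover have "?P F (\<lambda>\<omega>. False) = 0" by (simp add: cprob_def)
    ultimately show ?thesis
      using insert.hyps by (simp add: cprob_insert)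
  qed
  have e': "?P (insert e F) (?piv A e') = p * ?P F (?piv ?Ae e') + (1 - p) * ?P F (?piv A e')" if "e' \<in> F" for e'
  proof -
    have "e' \<noteq> e" using that insert.hyps by auto
    then have "(\<lambda>\<omega>. ?piv A e' (insert e \<omega>)) = ?piv ?Ae e'"
      by (auto simp: insert_commute)
    then show ?thesis
      using insert.hyps by (simp add: cprob_insert)
  qed
  have sum_piv: "(\<Sum>e'\<in>insert e F. ?P (insert e F) (?piv A e')) / (1 - p) = ?D"
  proof -
    define S1 S2 X Y where S: "S1 = (\<Sum>e\<in>F. ?P F (?piv ?Ae e))" "S2 = (\<Sum>e\<in>F. ?P F (?piv A e))"
      "X = ?P F ?Ae" "Y = ?P F A"
    have "(\<Sum>e'\<in>insert e F. ?P (insert e F) (?piv A e')) = (1 - p) * (?P F ?Ae - ?P F A) +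
        (\<Sum>e'\<in>F. p * ?P F (?piv ?Ae e') + (1 - p) * ?P F (?piv A e'))"
      unfolding sum.insert[OF insert.hyps] e by (intro arg_cong2[where f = "(+)"] refl sum.cong e')
    also have "\<dots> = (1 - p) * (X - Y) + (p * S1 + (1 - p) * S2)"
      unfolding S sum.distrib sum_distrib_left[symmetric] ..
    finally show ?thesis
      unfolding S(1,2)[symmetric] unfolding S(3,4)[symmetric]
      using assms(2) by (simp add: add_divide_distrib)
  qed
  have rec: "(\<lambda>p. cprob (insert e F) (\<lambda>_. p) A) =
      (\<lambda>p. p * cprob F (\<lambda>_. p) ?Ae + (1 - p) * cprob F (\<lambda>_. p) A)"
    by (rule ext) (rule cprob_insert[OF insert.hyps])
  have "((\<lambda>p. cprob (insert e F) (\<lambda>_. p) A) has_real_derivative ?D) (at p)"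
    by (rule subst[where P = "\<lambda>f. (f has_real_derivative ?D) (at p)", OF rec[symmetric] der])
  then show ?case
    by (rule DERIV_cong) (rule sum_piv[symmetric])
qed

lemma cprob_p_mono:
  fixes A :: "'e set \<Rightarrow> bool"
  assumes "finite F" "increasing A" "0 < p" "p \<le> p'" "p' < 1"
  shows "cprob F (\<lambda>_. p) A \<le> cprob F (\<lambda>_. p') A"
  using assms(4)
proof (rule DERIV_nonneg_imp_nondecreasing)
  fix x assume x: "p \<le> x" "x \<le> p'"
  show "\<exists>y. ((\<lambda>p. cprob F (\<lambda>_. p) A) has_real_derivative y) (at x) \<and> 0 \<le> y"
  proof (rule exI, rule conjI)
    show "((\<lambda>p. cprob F (\<lambda>_. p) A) has_real_derivative
     (\<Sum>e\<in>F. cprob F (\<lambda>_. x) (\<lambda>\<omega>. e \<notin> \<omega> \<and> \<not> A \<omega> \<and> A (insert e \<omega>))) / (1 - x)) (at x)"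
      using x assms by (intro cprob_deriv) auto
    have "weights F (\<lambda>_. x)" using x assms by (simp add: weights_def)
    then show "0 \<le> (\<Sum>e\<in>F. cprob F (\<lambda>_. x) (\<lambda>\<omega>. e \<notin> \<omega> \<and> \<not> A \<omega> \<and> A (insert e \<omega>))) / (1 - x)"
      using x assms by (intro divide_nonneg_nonneg sum_nonneg cprob_nonneg) auto
  qed
qed

lemma continuous_cprob: "finite F \<Longrightarrow> continuous_on S (\<lambda>p. cprob F (\<lambda>_. p) A)"
  unfolding cprob_def prod_constant
  by (intro continuous_on_sum continuous_on_mult continuous_on_power continuous_on_diff
      continuous_on_const continuous_on_id)

subsection \<open>Connectivity in locally finite graphs\<close>

definition reach :: "'b set set \<Rightarrow> 'b \<Rightarrow> 'b \<Rightarrow> bool" where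
  "reach \<omega> x y \<longleftrightarrow> (x, y) \<in> (adj_rel \<omega>)\<^sup>*"

lemma reach_refl [simp]: "reach \<omega> x x"
  by (simp add: reach_def)

lemma reach_edge: "{x, y} \<in> \<omega> \<Longrightarrow> reach \<omega> x y"
  by (auto simp: reach_def adj_rel_def)

lemma reach_trans: "reach \<omega> x y \<Longrightarrow> reach \<omega> y z \<Longrightarrow> reach \<omega> x z"
  unfolding reach_def by (rule rtrancl_trans)

lemma sym_adj_rel: "sym (adj_rel \<omega>)"
  by (auto simp: adj_rel_def sym_def insert_commute)

lemma reach_sym: "reach \<omega> x y \<Longrightarrow> reach \<omega> y x"
  unfolding reach_def by (meson sym_adj_rel sym_rtrancl symD)

lemma reach_mono: "\<omega> \<subseteq> \<omega>' \<Longrightarrow> reach \<omega> x y \<Longrightarrow> reach \<omega>' x y"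
  unfolding reach_def using rtrancl_mono[of "adj_rel \<omega>" "adj_rel \<omega>'"]
  by (auto simp: adj_rel_def)

lemma reach_image:
  assumes "inj T"
  shows "reach ((`) T ` \<omega>) (T x) (T y) \<longleftrightarrow> reach \<omega> x y"
proof
  have nbr: "{T a, b} \<in> (`) T ` \<omega> \<Longrightarrow> \<exists>c. b = T c \<and> {a, c} \<in> \<omega>" for a b
  proof -
    assume "{T a, b} \<in> (`) T ` \<omega>"
    then obtain e where e: "e \<in> \<omega>" "{T a, b} = T ` e" by auto
    then obtain c where c: "b = T c" "c \<in> e" by blast
    then have "T ` e = T ` {a, c}" using e by simp
    then have "e = {a, c}" using assms by (simp add: inj_image_eq_iff del: image_insert)
    then show ?thesis using c e by auto
  qed
  have "reach ((`) T ` \<omega>) (T x) z \<Longrightarrow> \<exists>c. z = T c \<and> reach \<omega> x c" for z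
    unfolding reach_def
  proof (induction rule: rtrancl_induct)
    case (step y z)
    then obtain c where c: "y = T c" "(x, c) \<in> (adj_rel \<omega>)\<^sup>*" by auto
    then have "{T c, z} \<in> (`) T ` \<omega>" using step by (simp add: adj_rel_def)
    from nbr[OF this] obtain c' where "z = T c'" "{c, c'} \<in> \<omega>" by auto
    with c show ?case by (auto simp: adj_rel_def intro: rtrancl_into_rtrancl)
  qed auto
  then show "reach ((`) T ` \<omega>) (T x) (T y) \<Longrightarrow> reach \<omega> x y"
    using assms by (metis injD)
  show "reach ((`) T ` \<omega>) (T x) (T y)" if "reach \<omega> x y"
    using that unfolding reach_def
  proof (induction rule: rtrancl_induct)
    case (step y z)
    then have "T ` {y, z} \<in> (`) T ` \<omega>" by (intro imageI) (simp add: adj_rel_def)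
    then have "{T y, T z} \<in> (`) T ` \<omega>" by simp
    with step show ?case by (auto simp: adj_rel_def intro: rtrancl_into_rtrancl)
  qed auto
qed

lemma reach_first_exit:
  assumes "reach \<omega> x y" "x \<in> B" "y \<notin> B"
  obtains u w where "u \<in> B" "w \<notin> B" "{u, w} \<in> \<omega>" "reach {e \<in> \<omega>. e \<subseteq> B} x u"
proof -
  have "y \<in> B \<and> reach {e \<in> \<omega>. e \<subseteq> B} x y \<or>
      (\<exists>u w. u \<in> B \<and> w \<notin> B \<and> {u, w} \<in> \<omega> \<and> reach {e \<in> \<omega>. e \<subseteq> B} x u)"
    using assms(1) unfolding reach_def[of \<omega>]
  proof (induction rule: rtrancl_induct)
    case base
    then show ?case using assms by simp
  next
    case (step y z)
    then have yz: "{y, z} \<in> \<omega>" by (simp add: adj_rel_def)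
    show ?case
    proof (cases "y \<in> B \<and> reach {e \<in> \<omega>. e \<subseteq> B} x y")
      case True
      show ?thesis
      proof (cases "z \<in> B")
        case zB: True
        then have "reach {e \<in> \<omega>. e \<subseteq> B} y z" using True yz by (intro reach_edge) auto
        then have "reach {e \<in> \<omega>. e \<subseteq> B} x z" using True reach_trans by fast
        then show ?thesis using zB by simp
      next
        case False
        then show ?thesis using True yz by auto
      qed
    qed (use step in blast)
  qed
  then show ?thesis using assms that by blast
qed

text \<open>The last exit from \<open>C\<close> is the first exit from the complement along the
  reversed path.\<close>

lemma reach_last_exit:
  assumes "reach \<omega> x y" "x \<in> C" "y \<notin> C"
  obtains u w where "u \<in> C" "w \<notin> C" "{u, w} \<in> \<omega>" "reach {e \<in> \<omega>. e \<inter> C = {}} w y"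
proof -
  obtain u w where "u \<in> - C" "w \<notin> - C" "{u, w} \<in> \<omega>" "reach {e \<in> \<omega>. e \<subseteq> - C} y u"
    using reach_first_exit[of \<omega> y x "- C"] assms(2,3) reach_sym[OF assms(1)] by auto
  moreover have "{e \<in> \<omega>. e \<subseteq> - C} = {e \<in> \<omega>. e \<inter> C = {}}" by auto
  ultimately show ?thesis
    using that[of w u] reach_sym[of _ y u] by (simp add: insert_commute)
qed

lemma reach_first_exit_touching:
  assumes "reach \<omega> x y" "x \<in> B" "y \<notin> B"
  obtains w where "w \<notin> B" "reach {e \<in> \<omega>. e \<inter> B \<noteq> {}} x w"
proof -
  obtain u w where uw: "u \<in> B" "w \<notin> B" "{u, w} \<in> \<omega>" "reach {e \<in> \<omega>. e \<subseteq> B} x u"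
    using reach_first_exit[OF assms] by blast
  show thesis
  proof (rule that[OF uw(2)])
    \<comment> \<open>The empty set is contained in \<open>B\<close> without meeting it. Here
      \<open>\<omega>\<close> is an arbitrary set of sets, so this case is split off;
      \<open>adj_rel\<close> does not see it.\<close>
    have "reach {e \<in> \<omega>. e \<inter> B \<noteq> {} \<or> e = {}} x u"
      using uw(4) by (rule reach_mono[rotated]) auto
    moreover have "reach (\<omega> - {{}}) x u \<longleftrightarrow> reach \<omega> x u" for \<omega> :: "'a set set"
    proof -
      have "adj_rel (\<omega> - {{}}) = adj_rel \<omega>" by (auto simp: adj_rel_def)
      then show ?thesis by (simp add: reach_def)
    qed
    ultimately have "reach ({e \<in> \<omega>. e \<inter> B \<noteq> {} \<or> e = {}} - {{}}) x u" by blast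
    then have "reach {e \<in> \<omega>. e \<inter> B \<noteq> {}} x u"
      by (rule reach_mono[rotated]) auto
    moreover have "reach {e \<in> \<omega>. e \<inter> B \<noteq> {}} u w"
      using uw by (intro reach_edge) auto
    ultimately show "reach {e \<in> \<omega>. e \<inter> B \<noteq> {}} x w" by (rule reach_trans)
  qed
qed

text \<open>Koenig's lemma along geodesics from \<open>x\<close>. \<open>D n v\<close> collects the
  vertices to which a geodesic can continue from a vertex \<open>v\<close> at distance
  \<open>n\<close>, and the ray always moves to a neighbour for which this set is infinite. Its
  \<open>n\<close>-th vertex has distance \<open>n\<close> from \<open>x\<close>, so the ray is
  injective.\<close>

lemma infinite_cluster_imp_ray:
  assumes fin: "\<And>v. finite {w. {v, w} \<in> \<omega>}" and inf: "infinite {y. reach \<omega> x y}"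
  shows "\<exists>\<gamma>. \<gamma> 0 = x \<and> inj \<gamma> \<and> (\<forall>n. {\<gamma> n, \<gamma> (Suc n)} \<in> \<omega>)"
proof -
  let ?r = "adj_rel \<omega>"
  define d where "d y = (LEAST n. (x, y) \<in> ?r ^^ n)" for y
  have d_le: "(x, y) \<in> ?r ^^ n \<Longrightarrow> d y \<le> n" for y n
    unfolding d_def by (rule Least_le)
  have d: "(x, y) \<in> ?r ^^ d y" if "reach \<omega> x y" for y
    using rtrancl_imp_relpow[of "(x, y)" ?r] that unfolding d_def reach_def by (metis LeastI)
  define D where "D n v = {y. \<exists>m. (v, y) \<in> ?r ^^ m \<and> d y = n + m}" for n v
  define P where "P n v \<longleftrightarrow> (x, v) \<in> ?r ^^ n \<and> d v = n \<and> infinite (D n v)" for n v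
  have "\<exists>\<gamma>. \<forall>n. P n (\<gamma> n) \<and> {\<gamma> n, \<gamma> (Suc n)} \<in> \<omega>"
  proof (rule dependent_nat_choice)
    have "{y. reach \<omega> x y} \<subseteq> D 0 x"
      using d by (auto simp: D_def)
    then have "infinite (D 0 x)" using inf infinite_super by blast
    moreover have "d x = 0" using d_le[of x 0] by simp
    ultimately have "P 0 x" by (simp add: P_def)
    then show "\<exists>x. P 0 x" ..
  next
    fix v n assume P: "P n v"
    have "D n v \<subseteq> insert v (\<Union>w\<in>{w. {v, w} \<in> \<omega>}. D (Suc n) w)"
    proof
      fix y assume "y \<in> D n v"
      then obtain m where m: "(v, y) \<in> ?r ^^ m" "d y = n + m" by (auto simp: D_def)
      show "y \<in> insert v (\<Union>w\<in>{w. {v, w} \<in> \<omega>}. D (Suc n) w)"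
      proof (cases m)
        case 0
        then show ?thesis using m by simp
      next
        case (Suc m')
        then obtain w where w: "(v, w) \<in> ?r" "(w, y) \<in> ?r ^^ m'"
          using m relpow_Suc_E2 by metis
        then have "y \<in> D (Suc n) w" using m Suc by (auto simp: D_def)
        then show ?thesis using w by (auto simp: adj_rel_def)
      qed
    qed
    moreover have "infinite (D n v)" using P by (simp add: P_def)
    ultimately have "infinite (\<Union>w\<in>{w. {v, w} \<in> \<omega>}. D (Suc n) w)"
      using infinite_super by fastforce
    then obtain w where w: "{v, w} \<in> \<omega>" "infinite (D (Suc n) w)"
      using fin by blast
    have xw: "(x, w) \<in> ?r ^^ Suc n"
      using P w by (auto simp: P_def adj_rel_def)
    \<comment> \<open>Any descendant \<open>y\<close> of \<open>w\<close> shows that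
      \<open>w\<close> has distance exactly \<open>Suc n\<close> from \<open>x\<close>: a shorter
      way to \<open>w\<close> would shorten the way to \<open>y\<close>.\<close>
    have "D (Suc n) w \<noteq> {}" using w(2) by (rule infinite_imp_nonempty)
    then obtain y m where y: "(w, y) \<in> ?r ^^ m" "d y = Suc n + m"
      unfolding D_def by blast
    have "reach \<omega> x w"
      unfolding reach_def using xw by (rule relpow_imp_rtrancl)
    then have "(x, y) \<in> ?r ^^ (d w + m)"
      using d y(1) unfolding relpow_add by blast
    then have "d y \<le> d w + m" by (rule d_le)
    then have "d w = Suc n" using y d_le[OF xw] by simp
    then show "\<exists>w. P (Suc n) w \<and> {v, w} \<in> \<omega>"
      using w xw by (auto simp: P_def)
  qed
  then obtain \<gamma> where \<gamma>: "\<And>n. P n (\<gamma> n)" "\<And>n. {\<gamma> n, \<gamma> (Suc n)} \<in> \<omega>" by blast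
  have "inj \<gamma>"
    using \<gamma>(1) by (metis P_def injI)
  moreover have "\<gamma> 0 = x" using \<gamma>(1)[of 0] by (simp add: P_def)
  ultimately show ?thesis using \<gamma>(2) by blast
qed

lemma reach_ray: "(\<And>n. {\<gamma> n, \<gamma> (Suc n)} \<in> \<omega>) \<Longrightarrow> reach \<omega> (\<gamma> m) (\<gamma> (m + n))"
proof (induction n)
  case (Suc n)
  then have "reach \<omega> (\<gamma> m) (\<gamma> (m + n))" "reach \<omega> (\<gamma> (m + n)) (\<gamma> (m + Suc n))"
    by (auto intro: reach_edge)
  then show ?case by (rule reach_trans)
qed simp

lemma ray_imp_infinite_cluster:
  assumes "inj \<gamma>" "\<And>n. {\<gamma> n, \<gamma> (Suc n)} \<in> \<omega>"
  shows "infinite {y. reach \<omega> (\<gamma> 0) y}"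
proof -
  have "range \<gamma> \<subseteq> {y. reach \<omega> (\<gamma> 0) y}"
    using reach_ray[of \<gamma> \<omega> 0] assms by auto
  moreover have "infinite (range \<gamma>)" using assms by (simp add: finite_image_iff)
  ultimately show ?thesis using infinite_super by blast
qed

section \<open>Distances and balls in connected, locally finite graphs\<close>

locale lfgraph =
  fixes V :: "'b set" and E :: "'b set set"
  assumes edges: "e \<in> E \<Longrightarrow> \<exists>x y. e = {x, y} \<and> x \<noteq> y \<and> x \<in> V \<and> y \<in> V"
    and connected: "x \<in> V \<Longrightarrow> y \<in> V \<Longrightarrow> reach E x y"
    and finite_nbrs: "finite {w. {v, w} \<in> E}"
begin

abbreviation d where "d \<equiv> graph_dist E"

lemma edge_V: "{x, y} \<in> E \<Longrightarrow> x \<in> V \<and> y \<in> V \<and> x \<noteq> y"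
  using edges[of "{x, y}"] by (auto simp: doubleton_eq_iff)

lemma finite_touching:
  assumes "finite B"
  shows "finite {e \<in> E. e \<inter> B \<noteq> {}}"
proof (rule finite_subset)
  show "{e \<in> E. e \<inter> B \<noteq> {}} \<subseteq> (\<Union>v\<in>B. (\<lambda>w. {v, w}) ` {w. {v, w} \<in> E})"
  proof
    fix e assume "e \<in> {e \<in> E. e \<inter> B \<noteq> {}}"
    then obtain v where e: "e \<in> E" "v \<in> e" "v \<in> B" by blast
    then obtain w where "e = {v, w}" using edges[OF e(1)] by auto
    then show "e \<in> (\<Union>v\<in>B. (\<lambda>w. {v, w}) ` {w. {v, w} \<in> E})" using e by blast
  qed
  show "finite (\<Union>v\<in>B. (\<lambda>w. {v, w}) ` {w. {v, w} \<in> E})"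
    using assms finite_nbrs by blast
qed

lemma relpow_d: "x \<in> V \<Longrightarrow> y \<in> V \<Longrightarrow> (x, y) \<in> adj_rel E ^^ d x y"
  using rtrancl_imp_relpow[of "(x, y)" "adj_rel E"] connected[of x y]
  unfolding graph_dist_def reach_def by (metis LeastI)

lemma d_le: "(x, y) \<in> adj_rel E ^^ n \<Longrightarrow> d x y \<le> n"
  unfolding graph_dist_def by (rule Least_le)

lemma d_self [simp]: "d x x = 0"
  using d_le[of x x 0] by simp

lemma d_0: "x \<in> V \<Longrightarrow> y \<in> V \<Longrightarrow> d x y = 0 \<Longrightarrow> x = y"
  using relpow_d[of x y] by simp

lemma d_triangle: "x \<in> V \<Longrightarrow> y \<in> V \<Longrightarrow> z \<in> V \<Longrightarrow> d x z \<le> d x y + d y z"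
  using relpow_d[of x y] relpow_d[of y z] by (intro d_le) (auto simp: relpow_add)

lemma d_edge: "{x, y} \<in> E \<Longrightarrow> d x y \<le> 1"
  by (intro d_le) (simp add: adj_rel_def)

lemma reach_V: "reach \<omega> x y \<Longrightarrow> \<omega> \<subseteq> E \<Longrightarrow> x \<in> V \<Longrightarrow> y \<in> V"
  unfolding reach_def by (induction rule: rtrancl_induct) (auto simp: adj_rel_def dest: edge_V)

lemma ball_Suc_subset:
  "graph_ball V E x (Suc r) \<subseteq> graph_ball V E x r \<union> (\<Union>v\<in>graph_ball V E x r. {w. {v, w} \<in> E})" if "x \<in> V"
proof
  fix y assume "y \<in> graph_ball V E x (Suc r)"
  then have y: "y \<in> V" "d x y \<le> Suc r" by (auto simp: graph_ball_def)
  show "y \<in> graph_ball V E x r \<union> (\<Union>v\<in>graph_ball V E x r. {w. {v, w} \<in> E})"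
  proof (cases "d x y \<le> r")
    case True
    then show ?thesis using y by (simp add: graph_ball_def)
  next
    case False
    then have "(x, y) \<in> adj_rel E ^^ Suc r" using relpow_d[OF that y(1)] y by (metis le_SucE)
    then obtain v where v: "(x, v) \<in> adj_rel E ^^ r" "{v, y} \<in> E" by (auto simp: adj_rel_def)
    then have "v \<in> graph_ball V E x r" using d_le[OF v(1)] edge_V by (auto simp: graph_ball_def)
    then show ?thesis using v by blast
  qed
qed

lemma ball_0: "x \<in> V \<Longrightarrow> graph_ball V E x 0 = {x}"
  using d_0 by (auto simp: graph_ball_def)

lemma finite_ball: "x \<in> V \<Longrightarrow> finite (graph_ball V E x r)"
proof (induction r)
  case (Suc r)
  then have "finite (graph_ball V E x r \<union> (\<Union>v\<in>graph_ball V E x r. {w. {v, w} \<in> E}))"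
    using finite_nbrs by auto
  then show ?case using ball_Suc_subset[OF Suc.prems] finite_subset by blast
qed (simp add: ball_0)

lemma card_ball:
  assumes "x \<in> V" "\<And>v. v \<in> V \<Longrightarrow> card {w. {v, w} \<in> E} \<le> D"
  shows "card (graph_ball V E x r) \<le> Suc D ^ r"
proof (induction r)
  case (Suc r)
  let ?B = "graph_ball V E x r"
  have "card (graph_ball V E x (Suc r)) \<le> card (?B \<union> (\<Union>v\<in>?B. {w. {v, w} \<in> E}))"
    using finite_ball[OF assms(1)] finite_nbrs
    by (intro card_mono ball_Suc_subset[OF assms(1)]) auto
  also have "\<dots> \<le> card ?B + card (\<Union>v\<in>?B. {w. {v, w} \<in> E})" by (rule card_Un_le)
  also have "card (\<Union>v\<in>?B. {w. {v, w} \<in> E}) \<le> (\<Sum>v\<in>?B. card {w. {v, w} \<in> E})"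
    by (rule card_UN_le) (rule finite_ball[OF assms(1)])
  also have "\<dots> \<le> (\<Sum>v\<in>?B. D)"
    by (rule sum_mono) (use assms in \<open>auto simp: graph_ball_def\<close>)
  finally have "card (graph_ball V E x (Suc r)) \<le> Suc D * card ?B" by (simp add: mult.commute)
  also have "\<dots> \<le> Suc D * Suc D ^ r" using Suc by (rule mult_le_mono2)
  finally show ?case by simp
qed (simp add: ball_0[OF assms(1)])

lemma finite_cluster_exit:
  assumes "\<omega> \<subseteq> E" "x \<in> V" "infinite {y. reach \<omega> x y}"
  shows "\<exists>y. reach \<omega> x y \<and> k \<le> d x y"
proof (rule ccontr)
  assume "\<not> ?thesis"
  then have "{y. reach \<omega> x y} \<subseteq> graph_ball V E x k"
    using reach_V[OF _ assms(1,2)] by (auto simp: graph_ball_def not_le intro: less_imp_le)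
  then show False using assms finite_ball finite_subset by blast
qed

end

subsection \<open>Sharpness of the phase transition: finite volume\<close>

text \<open>Every vertex on a walk to \<open>y\<close> is itself connected to \<open>y\<close>, so
  the walk cannot visit \<open>S\<close>.\<close>

lemma reach_avoiding:
  assumes "reach \<omega> v y" "\<And>s. s \<in> S \<Longrightarrow> \<not> reach \<omega> s y"
  shows "reach {e \<in> \<omega>. e \<inter> S = {}} v y"
  using assms(1) unfolding reach_def[of \<omega> v]
proof (induction rule: converse_rtrancl_induct)
  case (step v w)
  then have vw: "{v, w} \<in> \<omega>" by (simp add: adj_rel_def)
  have "reach \<omega> w y" using step by (simp add: reach_def)
  moreover from this have "reach \<omega> v y" using reach_trans[OF reach_edge[OF vw]] by blast
  ultimately have "v \<notin> S" "w \<notin> S" using assms(2) by auto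
  then have "reach {e \<in> \<omega>. e \<inter> S = {}} v w" using vw by (intro reach_edge) auto
  then show ?case using step.IH reach_trans by fast
qed simp

text \<open>Together with \<open>cluster_touching\<close>: whether \<open>C\<close> is the cluster
  of \<open>x\<close> is decided by the edges that meet \<open>C\<close>. The edges disjoint from
  \<open>C\<close> remain free, which is the source of independence in
  \<open>far_connection_decay\<close>.\<close>

lemma cluster_restrict:
  assumes "{v. reach {e \<in> \<omega>. e \<inter> C \<noteq> {}} x v} = C"
  shows "{v. reach \<omega> x v} = C"
proof
  show "C \<subseteq> {v. reach \<omega> x v}"
    using assms reach_mono[of "{e \<in> \<omega>. e \<inter> C \<noteq> {}}" \<omega>] by auto
  have "v \<in> C" if "reach \<omega> x v" for v
    using that unfolding reach_def
  proof (induction rule: rtrancl_induct)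
    case base
    show ?case using equalityD1[OF assms] by auto
  next
    case (step y z)
    then have "{y, z} \<in> {e \<in> \<omega>. e \<inter> C \<noteq> {}}" by (auto simp: adj_rel_def)
    then have "reach {e \<in> \<omega>. e \<inter> C \<noteq> {}} y z" by (rule reach_edge)
    moreover have "reach {e \<in> \<omega>. e \<inter> C \<noteq> {}} x y" using step assms by auto
    ultimately show ?case using assms reach_trans by fast
  qed
  then show "{v. reach \<omega> x v} \<subseteq> C" by auto
qed

lemma cluster_touching:
  assumes "C = {v. reach \<omega> x v}"
  shows "{v. reach {e \<in> \<omega>. e \<inter> C \<noteq> {}} x v} = C"
proof
  show "{v. reach {e \<in> \<omega>. e \<inter> C \<noteq> {}} x v} \<subseteq> C"
    using assms reach_mono[of "{e \<in> \<omega>. e \<inter> C \<noteq> {}}" \<omega>] by auto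
  have "reach {e \<in> \<omega>. e \<inter> C \<noteq> {}} x v" if "reach \<omega> x v" for v
    using that unfolding reach_def[of \<omega>]
  proof (induction rule: rtrancl_induct)
    case (step y z)
    then have "y \<in> C" "{y, z} \<in> \<omega>" using assms by (auto simp: reach_def adj_rel_def)
    then have "reach {e \<in> \<omega>. e \<inter> C \<noteq> {}} y z" by (intro reach_edge) auto
    then show ?case using step reach_trans by fast
  qed simp
  then show "C \<subseteq> {v. reach {e \<in> \<omega>. e \<inter> C \<noteq> {}} x v}" using assms by auto
qed

lemma reach_inside: "reach \<omega> x v \<Longrightarrow> x \<in> S \<Longrightarrow> (\<And>e. e \<in> \<omega> \<Longrightarrow> e \<subseteq> S) \<Longrightarrow> v \<in> S"
  unfolding reach_def by (induction rule: rtrancl_induct) (auto simp: adj_rel_def)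

context lfgraph
begin

text \<open>The pairs are oriented, inner endpoint first. For a fixed \<open>S\<close> an edge
  determines its pair, which matters when pivotal edges are counted.\<close>

definition bdry :: "'b set \<Rightarrow> ('b \<times> 'b) set" where
  "bdry S = {(u, w). u \<in> S \<and> w \<notin> S \<and> {u, w} \<in> E}"

definition inside :: "'b set \<Rightarrow> 'b set set" where
  "inside S = {e \<in> E. e \<subseteq> S}"

definition touching :: "'b set \<Rightarrow> 'b set set" where
  "touching B = {e \<in> E. e \<inter> B \<noteq> {}}"

text \<open>The functional \<open>\<phi>\<^sub>p(S)\<close> of Duminil-Copin and Tassion.\<close>

definition phi :: "real \<Rightarrow> 'b \<Rightarrow> 'b set \<Rightarrow> real" where
  "phi p x S = (\<Sum>(u, w)\<in>bdry S. p * cprob (inside S) (\<lambda>_. p) (\<lambda>\<omega>. reach \<omega> x u))"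

lemma finite_bdry: "finite S \<Longrightarrow> finite (bdry S)"
proof (rule finite_subset)
  show "bdry S \<subseteq> Sigma S (\<lambda>u. {w. {u, w} \<in> E})" by (auto simp: bdry_def)
qed (use finite_nbrs in auto)

lemma edge_nonempty: "e \<in> E \<Longrightarrow> e \<noteq> {}"
  using edges by blast

lemma inside_subset_touching: "S \<subseteq> B \<Longrightarrow> inside S \<subseteq> touching B"
proof
  fix e assume "S \<subseteq> B" "e \<in> inside S"
  then have "e \<in> E" "e \<inter> B = e" by (auto simp: inside_def)
  then show "e \<in> touching B" using edge_nonempty[of e] by (simp add: touching_def)
qed

lemma finite_inside: "finite S \<Longrightarrow> finite (inside S)"
  using inside_subset_touching[of S S] finite_touching[of S] finite_subset
  unfolding touching_def by blast

lemma increasing_reach: "increasing (\<lambda>\<omega>. reach \<omega> x y)"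
  using reach_mono by (auto simp: increasing_def)

lemma phi_mono:
  assumes "finite S" "0 < p" "p \<le> p'" "p' < 1"
  shows "phi p x S \<le> phi p' x S"
  unfolding phi_def
  using assms by (intro sum_mono)
    (auto intro!: mult_mono cprob_p_mono increasing_reach finite_inside cprob_nonneg simp: weights_def)

text \<open>Let \<open>C\<close> be the cluster of \<open>x\<close> formed by open edges inside
  \<open>S\<close>, and let \<open>{u, w}\<close> be the step by which a path to a far vertex leaves
  \<open>C\<close> for the last time. The rest of the path uses edges disjoint from
  \<open>C\<close>. Thus three events on disjoint edge sets occur: the cluster is \<open>C\<close>,
  the edge is open, and \<open>w\<close> is connected far away. Summing over \<open>C\<close> and
  the boundary edges produces the factor \<open>phi p x S\<close>. Since \<open>w\<close> has
  distance at most \<open>Suc L\<close> from \<open>x\<close>, the distance still to be covered from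
  \<open>w\<close> is at least \<open>k * Suc L\<close>. The induction hypothesis is applied to the
  edge set \<open>F2 C\<close>, so all finite \<open>F\<close> are treated at once.\<close>

lemma far_connection_decay:
  assumes "0 \<le> p" "p \<le> 1" "0 \<le> \<phi>"
    and S: "\<And>x. x \<in> V \<Longrightarrow> \<exists>S. finite S \<and> x \<in> S \<and> S \<subseteq> graph_ball V E x L \<and> phi p x S \<le> \<phi>"
    and "x \<in> V" "finite F" "F \<subseteq> E"
  shows "cprob F (\<lambda>_. p) (\<lambda>\<omega>. \<exists>y. reach \<omega> x y \<and> k * Suc L \<le> d x y) \<le> \<phi> ^ k"
  using assms(5-7)
proof (induction k arbitrary: x F)
  case 0
  then show ?case using assms by (auto intro!: cprob_le_1 simp: weights_def)
next
  case (Suc k)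
  let ?P = "\<lambda>F. cprob F (\<lambda>_. p)"
  let ?far = "\<lambda>k x \<omega>. \<exists>y. reach \<omega> x y \<and> k * Suc L \<le> d x y"
  have w: "weights F (\<lambda>_. p)" for F :: "'b set set" using assms by (simp add: weights_def)
  obtain S where S: "finite S" "x \<in> S" "S \<subseteq> graph_ball V E x L" "phi p x S \<le> \<phi>"
    using S[OF Suc.prems(1)] by blast
  define F1 where "F1 = {e \<in> F. e \<subseteq> S}"
  define F1C where "F1C C = {e \<in> F1. e \<inter> C \<noteq> {}}" for C
  define F2 where "F2 C = {e \<in> F. e \<inter> C = {}}" for C
  define cl where "cl C \<omega> \<longleftrightarrow> {v. reach \<omega> x v} = C" for C and \<omega> :: "'b set set"
  have fin: "finite F1" "finite (F1C C)" "finite (F2 C)" for C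
    using Suc.prems by (auto simp: F1_def F1C_def F2_def)
  have cl: "{v. reach (\<omega> \<inter> F1) x v} = C" if "cl C (\<omega> \<inter> F1C C)" for C \<omega>
  proof -
    have "\<omega> \<inter> F1C C = {e \<in> \<omega> \<inter> F1. e \<inter> C \<noteq> {}}" by (auto simp: F1C_def)
    then show ?thesis using that cluster_restrict[of "\<omega> \<inter> F1" C x] by (simp add: cl_def)
  qed
  define Q where "Q i \<omega> = (case i of ((u, w), C) \<Rightarrow>
      cl C (\<omega> \<inter> F1C C) \<and> {u, w} \<in> \<omega> \<and> ?far k w (\<omega> \<inter> F2 C))" for i and \<omega> :: "'b set set"
  define I where "I = Sigma (bdry S) (\<lambda>(u, w). {C \<in> Pow S. u \<in> C})"
  have finI: "finite I" unfolding I_def using S(1) finite_bdry by (intro finite_SigmaI) auto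
  have "?P F (?far (Suc k) x) \<le> (\<Sum>i\<in>I. ?P F (Q i))"
  proof (rule cprob_le_sum[OF w finI])
    fix \<omega> assume \<omega>: "\<omega> \<subseteq> F" and "?far (Suc k) x \<omega>"
    then obtain y where y: "reach \<omega> x y" "Suc k * Suc L \<le> d x y" by blast
    have yV: "y \<in> V" using reach_V[OF y(1)] \<omega> Suc.prems by blast
    define C where "C = {v. reach (\<omega> \<inter> F1) x v}"
    have "\<omega> \<inter> F1C C = {e \<in> \<omega> \<inter> F1. e \<inter> C \<noteq> {}}" by (auto simp: F1C_def)
    then have "cl C (\<omega> \<inter> F1C C)"
      using cluster_touching[OF C_def] by (simp add: cl_def)
    have CS: "C \<subseteq> S"
    proof
      fix v assume "v \<in> C"
      then have "reach (\<omega> \<inter> F1) x v" by (simp add: C_def)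
      then show "v \<in> S" by (rule reach_inside[OF _ S(2)]) (simp add: F1_def)
    qed
    have "y \<notin> S" using y(2) S(3) by (auto simp: graph_ball_def)
    then have "y \<notin> C" "x \<in> C" using CS by (auto simp: C_def)
    then obtain u w where uw: "u \<in> C" "w \<notin> C" "{u, w} \<in> \<omega>" "reach {e \<in> \<omega>. e \<inter> C = {}} w y"
      using reach_last_exit[OF y(1)] by blast
    have E: "{u, w} \<in> E" using uw \<omega> Suc.prems by blast
    \<comment> \<open>Otherwise the open edge \<open>{u, w}\<close> would lie inside
      \<open>S\<close> and put \<open>w\<close> into \<open>C\<close>. Hence the pair belongs to
      \<open>bdry S\<close>.\<close>
    have "w \<notin> S"
    proof
      assume "w \<in> S"
      then have "{u, w} \<in> \<omega> \<inter> F1" using uw CS \<omega> by (auto simp: F1_def)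
      then have "reach (\<omega> \<inter> F1) u w" by (rule reach_edge)
      moreover have "reach (\<omega> \<inter> F1) x u" using uw(1) by (simp add: C_def)
      ultimately have "reach (\<omega> \<inter> F1) x w" by (rule reach_trans[rotated])
      then show False using uw(2) by (simp add: C_def)
    qed
    have V: "u \<in> V" "w \<in> V" using edge_V[OF E] by auto
    have "d x y \<le> d x w + d w y" using d_triangle Suc.prems(1) V yV by blast
    also have "d x w \<le> d x u + d u w" using d_triangle Suc.prems(1) V by blast
    also have "d u w \<le> 1" using d_edge[OF E] .
    also have "d x u \<le> L" using uw(1) CS S(3) by (auto simp: graph_ball_def)
    finally have "k * Suc L \<le> d w y" using y(2) by simp
    moreover have "\<omega> \<inter> F2 C = {e \<in> \<omega>. e \<inter> C = {}}" using \<omega> by (auto simp: F2_def)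
    then have "reach (\<omega> \<inter> F2 C) w y" using uw(4) by simp
    ultimately have "?far k w (\<omega> \<inter> F2 C)" by blast
    then have "Q ((u, w), C) \<omega>" using \<open>cl C (\<omega> \<inter> F1C C)\<close> uw(3) by (simp add: Q_def)
    moreover have "((u, w), C) \<in> I"
      using uw(1) CS \<open>w \<notin> S\<close> E by (auto simp: I_def bdry_def)
    ultimately show "\<exists>i\<in>I. Q i \<omega>" by blast
  qed
  also have "\<dots> \<le> (\<Sum>((u, w), C)\<in>I. ?P F (\<lambda>\<omega>. cl C (\<omega> \<inter> F1C C)) * (p * \<phi> ^ k))"
  proof (rule sum_mono)
    fix i assume "i \<in> I"
    then obtain u w C where i: "i = ((u, w), C)" "u \<in> S" "w \<notin> S" "{u, w} \<in> E" "C \<subseteq> S" "u \<in> C"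
      by (auto simp: I_def bdry_def)
    have "?P F (Q i) \<le> ?P F (\<lambda>\<omega>. cl C (\<omega> \<inter> F1C C)) * (p * \<phi> ^ k)"
    proof (cases "{u, w} \<in> F")
      case False
      then have "?P F (Q i) = 0" unfolding cprob_def by (intro sum.neutral) (auto simp: Q_def i)
      then show ?thesis using w assms by (auto intro!: mult_nonneg_nonneg cprob_nonneg)
    next
      case True
      let ?e = "{u, w}"
      have disj: "?e \<notin> F2 C" "?e \<notin> F1C C" "F1C C \<inter> F2 C = {}" "F1C C \<subseteq> F" "F2 C \<subseteq> F"
        using i by (auto simp: F2_def F1C_def F1_def)
      have "?P F (Q i) = ?P F (\<lambda>\<omega>. cl C (\<omega> \<inter> F1C C) \<and>
          (\<lambda>\<omega>. ?e \<in> \<omega> \<inter> {?e} \<and> ?far k w (\<omega> \<inter> F2 C)) (\<omega> \<inter> ({?e} \<union> F2 C)))"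
      proof (rule cprob_cong[OF _ refl])
        fix \<omega>
        have "\<omega> \<inter> ({?e} \<union> F2 C) \<inter> F2 C = \<omega> \<inter> F2 C" by auto
        then show "Q i \<omega> \<longleftrightarrow> cl C (\<omega> \<inter> F1C C) \<and>
          (\<lambda>\<omega>. ?e \<in> \<omega> \<inter> {?e} \<and> ?far k w (\<omega> \<inter> F2 C)) (\<omega> \<inter> ({?e} \<union> F2 C))"
          unfolding Q_def i(1) by auto
      qed
      also have "\<dots> = ?P (F1C C) (cl C) *
          ?P ({?e} \<union> F2 C) (\<lambda>\<omega>. ?e \<in> \<omega> \<inter> {?e} \<and> ?far k w (\<omega> \<inter> F2 C))"
        using Suc.prems disj True
        by (intro cprob_indep) auto
      also have "?P ({?e} \<union> F2 C) (\<lambda>\<omega>. ?e \<in> \<omega> \<inter> {?e} \<and> ?far k w (\<omega> \<inter> F2 C)) =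
          ?P {?e} (\<lambda>\<omega>. ?e \<in> \<omega>) * ?P (F2 C) (?far k w)"
        using disj fin by (intro cprob_Un) auto
      also have "?P {?e} (\<lambda>\<omega>. ?e \<in> \<omega>) = p"
        by (simp add: cprob_insert)
      also have "?P (F1C C) (cl C) * (p * ?P (F2 C) (?far k w)) \<le> ?P (F1C C) (cl C) * (p * \<phi> ^ k)"
      proof (intro mult_left_mono cprob_nonneg w assms(1))
        show "?P (F2 C) (?far k w) \<le> \<phi> ^ k"
          using edge_V[OF i(4)] fin disj Suc.prems by (intro Suc.IH) auto
      qed
      also have "?P (F1C C) (cl C) = ?P F (\<lambda>\<omega>. cl C (\<omega> \<inter> F1C C))"
        using cprob_restrict[of F "F1C C"] Suc.prems disj by simp
      finally show ?thesis .
    qed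
    then show "?P F (Q i) \<le> (\<lambda>((u, w), C). ?P F (\<lambda>\<omega>. cl C (\<omega> \<inter> F1C C)) * (p * \<phi> ^ k)) i"
      by (simp add: i)
  qed
  also have "\<dots> = (\<Sum>(u, w)\<in>bdry S. (\<Sum>C\<in>{C \<in> Pow S. u \<in> C}. ?P F (\<lambda>\<omega>. cl C (\<omega> \<inter> F1C C))) * (p * \<phi> ^ k))"
  proof -
    have "(\<Sum>((u, w), C)\<in>I. ?P F (\<lambda>\<omega>. cl C (\<omega> \<inter> F1C C)) * (p * \<phi> ^ k)) =
       (\<Sum>uw\<in>bdry S. \<Sum>C\<in>(case uw of (u, w) \<Rightarrow> {C \<in> Pow S. u \<in> C}). ?P F (\<lambda>\<omega>. cl C (\<omega> \<inter> F1C C)) * (p * \<phi> ^ k))"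
      unfolding I_def using S(1) finite_bdry
      by (subst sum.Sigma) (auto intro!: sum.cong)
    then show ?thesis by (auto simp: sum_distrib_right intro!: sum.cong)
  qed
  \<comment> \<open>Summing out \<open>C\<close>: the cluster events for different \<open>C\<close>
    exclude each other, and those with \<open>u\<close> in \<open>C\<close> force a connection from
    \<open>x\<close> to \<open>u\<close> inside \<open>S\<close>. Passing from \<open>F1\<close> to
    \<open>inside S\<close> only adds edges.\<close>
  also have "\<dots> \<le> (\<Sum>(u, w)\<in>bdry S. ?P (inside S) (\<lambda>\<omega>. reach \<omega> x u) * (p * \<phi> ^ k))"
  proof -
    have "(\<Sum>C\<in>{C \<in> Pow S. u \<in> C}. ?P F (\<lambda>\<omega>. cl C (\<omega> \<inter> F1C C))) \<le> ?P (inside S) (\<lambda>\<omega>. reach \<omega> x u)" for u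
    proof -
      have "(\<Sum>C\<in>{C \<in> Pow S. u \<in> C}. ?P F (\<lambda>\<omega>. cl C (\<omega> \<inter> F1C C))) \<le> ?P F (\<lambda>\<omega>. reach (\<omega> \<inter> F1) x u)"
      proof (rule sum_cprob_le[OF w])
        show "reach (\<omega> \<inter> F1) x u" if "C \<in> {C \<in> Pow S. u \<in> C}" "cl C (\<omega> \<inter> F1C C)" for C \<omega>
          using cl[OF that(2)] that(1) by blast
        fix C C' \<omega>
        assume "cl C (\<omega> \<inter> F1C C)" "cl C' (\<omega> \<inter> F1C C')"
        then show "C = C'" using cl by metis
      qed (use S(1) in auto)
      also have "\<dots> = ?P F1 (\<lambda>\<omega>. reach \<omega> x u)"
        using Suc.prems by (intro cprob_restrict) (auto simp: F1_def)
      also have "\<dots> = ?P (inside S) (\<lambda>\<omega>. reach (\<omega> \<inter> F1) x u)"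
        using finite_inside[OF S(1)] Suc.prems
        by (intro cprob_restrict[symmetric]) (auto simp: F1_def inside_def)
      also have "\<dots> \<le> ?P (inside S) (\<lambda>\<omega>. reach \<omega> x u)"
        by (rule cprob_mono[OF w]) (auto intro: reach_mono[rotated])
      finally show ?thesis .
    qed
    then show ?thesis
      using assms by (auto intro!: sum_mono mult_right_mono)
  qed
  also have "\<dots> = phi p x S * \<phi> ^ k"
    unfolding phi_def sum_distrib_right by (intro sum.cong) auto
  also have "\<dots> \<le> \<phi> * \<phi> ^ k" using S(4) assms(3) by (intro mult_right_mono) auto
  finally show ?case by simp
qed


text \<open>The assumptions speak only of edges that are not inside \<open>S\<close>, and yet they
  determine \<open>S\<close>: it consists of the vertices of \<open>B\<close> without a connection
  to the outside of \<open>B\<close>. This makes the decomposition in the next lemma disjoint and at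
  the same time independent of the configuration inside \<open>S\<close>.\<close>

lemma no_exit_eq:
  assumes "\<omega> \<subseteq> E" "S \<subseteq> B" "\<And>u w. (u, w) \<in> bdry S \<Longrightarrow> {u, w} \<notin> \<omega>"
    "\<And>v. v \<in> B - S \<Longrightarrow> \<exists>y. y \<notin> B \<and> reach {e \<in> \<omega>. e \<inter> S = {}} v y"
  shows "S = {v \<in> B. \<nexists>y. y \<notin> B \<and> reach \<omega> v y}"
proof (intro equalityI subsetI)
  fix v assume v: "v \<in> S"
  have "y \<in> B" if y: "reach \<omega> v y" for y
  proof (rule ccontr)
    assume "y \<notin> B"
    then have "y \<notin> S" using assms(2) by auto
    then obtain u w where "u \<in> S" "w \<notin> S" "{u, w} \<in> \<omega>"
      using reach_first_exit[OF y v] by metis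
    moreover from this have "(u, w) \<in> bdry S" using assms(1) by (auto simp: bdry_def)
    ultimately show False using assms(3) by blast
  qed
  then show "v \<in> {v \<in> B. \<nexists>y. y \<notin> B \<and> reach \<omega> v y}" using v assms(2) by blast
next
  fix v assume v: "v \<in> {v \<in> B. \<nexists>y. y \<notin> B \<and> reach \<omega> v y}"
  show "v \<in> S"
  proof (rule ccontr)
    assume "v \<notin> S"
    then obtain y where "y \<notin> B" "reach {e \<in> \<omega>. e \<inter> S = {}} v y" using assms(4) v by blast
    moreover from this have "reach \<omega> v y" by (elim reach_mono[rotated]) auto
    ultimately show False using v by blast
  qed
qed

text \<open>Decompose the event that \<open>x\<close> does not exit according to the set
  \<open>S\<close> of all vertices of \<open>B\<close> that are not connected to the outside. The
  event \<open>Ev S\<close> is independent of the edges inside \<open>S\<close>, so the factor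
  \<open>phi p x S\<close>, which is at least 1, can be inserted. It expands into events on which
  \<open>x\<close> is connected inside \<open>S\<close> to an endpoint \<open>u\<close> of a
  boundary edge \<open>{u, w}\<close>; then this edge is closed and pivotal, because
  \<open>w\<close> is connected to the outside. The right-hand side is the derivative in Russo's
  formula.\<close>

lemma exit_differential_inequality:
  fixes x B
  defines "out \<equiv> \<lambda>\<omega>. \<exists>y. y \<notin> B \<and> reach \<omega> x y"
  assumes "finite B" "x \<in> B" "0 < p" "p < 1"
    and phi: "\<And>S. finite S \<Longrightarrow> x \<in> S \<Longrightarrow> 1 \<le> phi p x S"
  shows "1 - cprob (touching B) (\<lambda>_. p) out \<le>
     (\<Sum>e\<in>touching B. cprob (touching B) (\<lambda>_. p) (\<lambda>\<omega>. e \<notin> \<omega> \<and> \<not> out \<omega> \<and> out (insert e \<omega>))) / (1 - p)"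
proof -
  let ?P = "\<lambda>F. cprob F (\<lambda>_. p)"
  let ?F = "touching B"
  have w: "weights F (\<lambda>_. p)" for F :: "'b set set" using assms by (simp add: weights_def)
  have finF: "finite ?F" using finite_touching[OF assms(2)] by (simp add: touching_def)
  have FE: "?F \<subseteq> E" by (auto simp: touching_def)
  define piv where "piv e \<omega> \<longleftrightarrow> e \<notin> \<omega> \<and> \<not> out \<omega> \<and> out (insert e \<omega>)" for e \<omega>
  define Ev where "Ev S \<omega> \<longleftrightarrow> (\<forall>(u, w)\<in>bdry S. {u, w} \<notin> \<omega>) \<and>
      (\<forall>v\<in>B - S. \<exists>y. y \<notin> B \<and> reach {e \<in> \<omega>. e \<inter> S = {}} v y)" for S and \<omega> :: "'b set set"
  define \<S> where "\<S> = {S \<in> Pow B. x \<in> S}"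
  have fin\<S>: "finite \<S>" using assms(2) by (simp add: \<S>_def)
  have Ev_eq: "S = {v \<in> B. \<nexists>y. y \<notin> B \<and> reach \<omega> v y}" if "S \<in> \<S>" "\<omega> \<subseteq> ?F" "Ev S \<omega>" for S \<omega>
    using that FE by (intro no_exit_eq) (auto simp: \<S>_def Ev_def)
  have "1 - ?P ?F out = ?P ?F (\<lambda>\<omega>. \<not> out \<omega>)" using cprob_not[OF finF] by simp
  also have "\<dots> \<le> (\<Sum>S\<in>\<S>. ?P ?F (Ev S))"
  proof (rule cprob_le_sum[OF w fin\<S>])
    fix \<omega> assume \<omega>: "\<omega> \<subseteq> ?F" "\<not> out \<omega>"
    define S where "S = {v \<in> B. \<nexists>y. y \<notin> B \<and> reach \<omega> v y}"
    have "S \<in> \<S>" using \<omega>(2) assms(3) by (auto simp: S_def \<S>_def out_def)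
    moreover have "Ev S \<omega>"
      unfolding Ev_def
    proof (intro conjI ballI)
      fix uw assume "uw \<in> bdry S"
      then obtain u w where uw: "uw = (u, w)" "u \<in> S" "w \<notin> S" by (auto simp: bdry_def)
      have "{u, w} \<notin> \<omega>"
      proof
        assume "{u, w} \<in> \<omega>"
        then have uw': "reach \<omega> u w" by (rule reach_edge)
        obtain y where "y \<notin> B" "reach \<omega> w y"
          using uw(3) reach_refl by (cases "w \<in> B") (auto simp: S_def)
        then show False using uw(2) reach_trans[OF uw'] by (auto simp: S_def)
      qed
      then show "case uw of (u, w) \<Rightarrow> {u, w} \<notin> \<omega>" by (simp add: uw)
    next
      fix v assume v: "v \<in> B - S"
      then obtain y where y: "y \<notin> B" "reach \<omega> v y" by (auto simp: S_def)
      have "reach {e \<in> \<omega>. e \<inter> S = {}} v y"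
        using y by (intro reach_avoiding) (auto simp: S_def)
      then show "\<exists>y. y \<notin> B \<and> reach {e \<in> \<omega>. e \<inter> S = {}} v y" using y by blast
    qed
    ultimately show "\<exists>S\<in>\<S>. Ev S \<omega>" by blast
  qed
  also have "\<dots> \<le> (\<Sum>S\<in>\<S>. ?P ?F (Ev S) * phi p x S)"
  proof (rule sum_mono)
    fix S assume "S \<in> \<S>"
    then have "1 \<le> phi p x S" using assms(2) by (intro phi) (auto simp: \<S>_def intro: finite_subset)
    then show "?P ?F (Ev S) \<le> ?P ?F (Ev S) * phi p x S"
      using mult_left_mono[of 1 "phi p x S" "?P ?F (Ev S)"] cprob_nonneg[OF w] by simp
  qed
  also have "\<dots> = (\<Sum>S\<in>\<S>. \<Sum>(u, w)\<in>bdry S. p * ?P ?F (\<lambda>\<omega>. Ev S \<omega> \<and> reach (\<omega> \<inter> inside S) x u))"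
  proof (rule sum.cong[OF refl])
    fix S assume S: "S \<in> \<S>"
    then have SB: "S \<subseteq> B" by (simp add: \<S>_def)
    have Ev_restrict: "Ev S \<omega> \<longleftrightarrow> Ev S (\<omega> \<inter> (?F - inside S))" if "\<omega> \<subseteq> ?F" for \<omega>
    proof -
      have 1: "{e \<in> \<omega> \<inter> (?F - inside S). e \<inter> S = {}} = {e \<in> \<omega>. e \<inter> S = {}}"
      proof (intro equalityI subsetI)
        fix e assume e: "e \<in> {e \<in> \<omega>. e \<inter> S = {}}"
        then have "e \<noteq> {}" using that FE edge_nonempty by blast
        then show "e \<in> {e \<in> \<omega> \<inter> (?F - inside S). e \<inter> S = {}}"
          using e that by (auto simp: inside_def)
      qed auto
      have 2: "{u, w} \<in> \<omega> \<inter> (?F - inside S) \<longleftrightarrow> {u, w} \<in> \<omega>" if "(u, w) \<in> bdry S" for u w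
        using that \<open>\<omega> \<subseteq> ?F\<close> by (auto simp: bdry_def inside_def)
      show ?thesis
        unfolding Ev_def 1 using 2 by blast
    qed
    have *: "?P ?F (\<lambda>\<omega>. Ev S \<omega> \<and> reach (\<omega> \<inter> inside S) x u) =
        ?P ?F (Ev S) * ?P (inside S) (\<lambda>\<omega>. reach \<omega> x u)" for u
    proof -
      have "?P ?F (\<lambda>\<omega>. Ev S \<omega> \<and> reach (\<omega> \<inter> inside S) x u) =
          ?P ?F (\<lambda>\<omega>. Ev S (\<omega> \<inter> (?F - inside S)) \<and> reach (\<omega> \<inter> inside S) x u)"
        using Ev_restrict by (intro cprob_cong) auto
      also have "\<dots> = ?P (?F - inside S) (Ev S) * ?P (inside S) (\<lambda>\<omega>. reach \<omega> x u)"
        using finF inside_subset_touching[OF SB] by (intro cprob_indep) auto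
      also have "?P (?F - inside S) (Ev S) = ?P ?F (\<lambda>\<omega>. Ev S (\<omega> \<inter> (?F - inside S)))"
        using finF by (intro cprob_restrict[symmetric]) auto
      also have "\<dots> = ?P ?F (Ev S)"
        using Ev_restrict by (intro cprob_cong) auto
      finally show ?thesis .
    qed
    show "?P ?F (Ev S) * phi p x S =
        (\<Sum>(u, w)\<in>bdry S. p * ?P ?F (\<lambda>\<omega>. Ev S \<omega> \<and> reach (\<omega> \<inter> inside S) x u))"
      unfolding phi_def * sum_distrib_left by (intro sum.cong) auto
  qed
  also have "\<dots> = p * (\<Sum>S\<in>\<S>. \<Sum>(u, w)\<in>bdry S. ?P ?F (\<lambda>\<omega>. Ev S \<omega> \<and> reach (\<omega> \<inter> inside S) x u))"
    unfolding sum_distrib_left by (intro sum.cong) auto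
  also have "(\<Sum>S\<in>\<S>. \<Sum>(u, w)\<in>bdry S. ?P ?F (\<lambda>\<omega>. Ev S \<omega> \<and> reach (\<omega> \<inter> inside S) x u)) \<le>
      (\<Sum>e\<in>?F. ?P ?F (piv e))"
  proof -
    define I where "I = Sigma \<S> bdry"
    define Q where "Q i \<omega> = (case i of (S, (u, w :: 'b)) \<Rightarrow> Ev S \<omega> \<and> reach (\<omega> \<inter> inside S) x u)" for i and \<omega> :: "'b set set"
    define h where "h i = (case i of (S :: 'b set, (u, w)) \<Rightarrow> {u, w :: 'b})" for i
    have SB: "S \<subseteq> B" "finite S" if "S \<in> \<S>" for S
      using that assms(2) by (auto simp: \<S>_def intro: finite_subset)
    have finI: "finite I" unfolding I_def using fin\<S> finite_bdry SB by (intro finite_SigmaI) auto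
    have "(\<Sum>S\<in>\<S>. \<Sum>(u, w)\<in>bdry S. ?P ?F (\<lambda>\<omega>. Ev S \<omega> \<and> reach (\<omega> \<inter> inside S) x u)) =
        (\<Sum>S\<in>\<S>. \<Sum>uw\<in>bdry S. ?P ?F (Q (S, uw)))"
      unfolding Q_def by (intro sum.cong) auto
    also have "\<dots> = (\<Sum>i\<in>I. ?P ?F (Q i))"
      unfolding I_def using fin\<S> finite_bdry SB by (subst sum.Sigma) auto
    also have "\<dots> = (\<Sum>e\<in>?F. \<Sum>i\<in>{i \<in> I. h i = e}. ?P ?F (Q i))"
    proof (rule sum.group[symmetric, OF finI finF])
      show "h ` I \<subseteq> ?F" using SB by (fastforce simp: h_def I_def bdry_def touching_def)
    qed
    also have "\<dots> \<le> (\<Sum>e\<in>?F. ?P ?F (piv e))"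
    proof (intro sum_mono sum_cprob_le w)
      fix e i \<omega> assume i: "i \<in> {i \<in> I. h i = e}" and \<omega>: "\<omega> \<subseteq> ?F" and Q: "Q i \<omega>"
      obtain S u w where iS: "i = (S, (u, w))" by (cases i) auto
      have S: "S \<in> \<S>" "(u, w) \<in> bdry S" "e = {u, w}" using i by (auto simp: iS I_def h_def)
      have Ev: "Ev S \<omega>" "reach (\<omega> \<inter> inside S) x u" using Q by (auto simp: Q_def iS)
      have Seq: "S = {v \<in> B. \<nexists>y. y \<notin> B \<and> reach \<omega> v y}" using Ev_eq[OF S(1) \<omega> Ev(1)] .
      have "e \<notin> \<omega>" using Ev(1) S by (auto simp: Ev_def)
      moreover have "\<not> out \<omega>"
      proof -
        have "x \<in> S" using S(1) by (simp add: \<S>_def)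
        then show ?thesis unfolding out_def using Seq by auto
      qed
      moreover have "out (insert e \<omega>)"
      proof -
        have "w \<notin> S" using S(2) by (simp add: bdry_def)
        then obtain y where y: "y \<notin> B" "reach \<omega> w y"
          using Seq reach_refl by (cases "w \<in> B") auto
        have "reach (insert e \<omega>) x u" using Ev(2) by (elim reach_mono[rotated]) auto
        moreover have "reach (insert e \<omega>) u w" by (rule reach_edge) (simp add: S)
        moreover have "reach (insert e \<omega>) w y" using y(2) by (elim reach_mono[rotated]) auto
        ultimately have "reach (insert e \<omega>) x y" by (metis reach_trans)
        then show ?thesis using y(1) by (auto simp: out_def)
      qed
      ultimately show "piv e \<omega>" by (simp add: piv_def)
    next
      \<comment> \<open>No double counting: \<open>\<omega>\<close> determines \<open>S\<close>, and
        \<open>S\<close> with \<open>e\<close> determines the oriented pair.\<close>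
      fix e i j \<omega> assume i: "i \<in> {i \<in> I. h i = e}" "j \<in> {i \<in> I. h i = e}"
        and \<omega>: "\<omega> \<subseteq> ?F" and Q: "Q i \<omega>" "Q j \<omega>"
      obtain S u w where iS: "i = (S, (u, w))" by (cases i) auto
      obtain S' u' w' where jS: "j = (S', (u', w'))" by (cases j) auto
      have S: "S \<in> \<S>" "S' \<in> \<S>" "(u, w) \<in> bdry S" "(u', w') \<in> bdry S'" "{u, w} = {u', w'}"
        using i by (auto simp: iS jS I_def h_def)
      have "Ev S \<omega>" "Ev S' \<omega>" using Q by (auto simp: Q_def iS jS)
      then have "S = S'" using Ev_eq[OF S(1) \<omega>] Ev_eq[OF S(2) \<omega>] by simp
      moreover have "u = u' \<and> w = w'"
        using S(3-5) \<open>S = S'\<close> by (auto simp: bdry_def doubleton_eq_iff)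
      ultimately show "i = j" by (simp add: iS jS)
    qed (use finI in auto)
    finally show ?thesis .
  qed
  also have "p * (\<Sum>e\<in>?F. ?P ?F (piv e)) \<le> (\<Sum>e\<in>?F. ?P ?F (piv e)) / (1 - p)"
  proof -
    have s: "0 \<le> (\<Sum>e\<in>?F. ?P ?F (piv e))" by (intro sum_nonneg cprob_nonneg w)
    have "p * (1 - p) \<le> 1 * 1" using assms by (intro mult_mono) auto
    then have "p \<le> 1 / (1 - p)" using assms by (simp add: pos_le_divide_eq)
    then show ?thesis using mult_right_mono[OF _ s] by fastforce
  qed
  finally show ?thesis using assms(4) unfolding piv_def by simp
qed

text \<open>With \<open>f\<close> the exit probability as a function of the parameter, the previous
  lemma reads f' \<ge> 1 - f, so \<open>exp t * (1 - f t)\<close> does not increase on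
  \<open>{p..p2}\<close>. Monotonicity of \<open>phi\<close> carries the hypothesis from
  \<open>p\<close> to larger parameters, and continuity covers an endpoint \<open>p2 = 1\<close>.
  The bound is the same for every \<open>B\<close>, which makes the limit of growing balls
  possible.\<close>

lemma exit_prob_lower_bound:
  assumes "finite B" "x \<in> B" "0 < p" "p < p2" "p2 \<le> 1"
    and phi: "\<And>S. finite S \<Longrightarrow> x \<in> S \<Longrightarrow> 1 \<le> phi p x S"
  shows "1 - exp (p - p2) \<le> cprob (touching B) (\<lambda>_. p2) (\<lambda>\<omega>. \<exists>y. y \<notin> B \<and> reach \<omega> x y)"
proof -
  define out where "out \<omega> \<longleftrightarrow> (\<exists>y. y \<notin> B \<and> reach \<omega> x y)" for \<omega> :: "'b set set"
  let ?f = "\<lambda>t. cprob (touching B) (\<lambda>_. t) out"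
  have finF: "finite (touching B)" using finite_touching[OF assms(1)] by (simp add: touching_def)
  have inc: "increasing out"
    unfolding increasing_def out_def using reach_mono by metis
  have "exp p2 * (1 - ?f p2) \<le> exp p * (1 - ?f p)"
  proof (rule DERIV_nonpos_imp_decreasing_open[of p p2 "\<lambda>t. exp t * (1 - ?f t)"])
    fix t assume t: "p < t" "t < p2"
    let ?D = "(\<Sum>e\<in>touching B. cprob (touching B) (\<lambda>_. t) (\<lambda>\<omega>. e \<notin> \<omega> \<and> \<not> out \<omega> \<and> out (insert e \<omega>))) / (1 - t)"
    have "(?f has_real_derivative ?D) (at t)"
      using t assms by (intro cprob_deriv finF inc) auto
    from DERIV_mult[OF DERIV_exp DERIV_diff[OF DERIV_const this]]
    have "((\<lambda>t. exp t * (1 - ?f t)) has_real_derivative exp t * (1 - ?f t - ?D)) (at t)"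
      by (rule DERIV_cong) (simp add: right_diff_distrib)
    moreover have "1 - ?f t \<le> ?D"
      unfolding out_def
    proof (rule exit_differential_inequality)
      show "1 \<le> phi t x S" if "finite S" "x \<in> S" for S
        using phi[OF that] phi_mono[OF that(1), of p t x] assms t by simp
    qed (use t assms in auto)
    then have "exp t * (1 - ?f t - ?D) \<le> 0" by (simp add: mult_nonneg_nonpos)
    ultimately show "\<exists>y. ((\<lambda>t. exp t * (1 - ?f t)) has_real_derivative y) (at t) \<and> y \<le> 0" by blast
  next
    show "continuous_on {p..p2} (\<lambda>t. exp t * (1 - ?f t))"
      by (intro continuous_on_mult continuous_on_exp continuous_on_diff continuous_on_const
          continuous_on_id continuous_cprob finF)
  qed (use assms in simp)
  also have "\<dots> \<le> exp p * 1"
  proof -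
    have "weights (touching B) (\<lambda>_. p)" using assms by (simp add: weights_def)
    then show ?thesis using cprob_nonneg[of _ _ out] by (intro mult_left_mono) auto
  qed
  finally have "1 - ?f p2 \<le> exp p / exp p2" by (simp add: pos_le_divide_eq mult.commute)
  moreover have "out = (\<lambda>\<omega>. \<exists>y. y \<notin> B \<and> reach \<omega> x y)" by (simp add: fun_eq_iff out_def)
  ultimately show ?thesis by (simp add: exp_diff)
qed

end

subsection \<open>Infinite product measures\<close>

context product_prob_space
begin

text \<open>As functions of \<open>Y\<close> both sides are finite measures on the product over
  \<open>I - J\<close>, and they agree on cylinders.\<close>

lemma emeasure_emb_Int_tail:
  assumes J: "finite J" "J \<subseteq> I" and A: "\<And>i. i \<in> J \<Longrightarrow> A i \<in> sets (M i)"
    and Y: "Y \<in> sets (PiM (I - J) M)"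
  shows "emeasure (PiM I M) (prod_emb I M J (Pi\<^sub>E J A) \<inter> {\<omega> \<in> space (PiM I M). restrict \<omega> (I - J) \<in> Y}) =
    emeasure (PiM I M) (prod_emb I M J (Pi\<^sub>E J A)) * emeasure (PiM (I - J) M) Y"
proof -
  let ?P = "PiM I M" and ?N = "PiM (I - J) M" and ?r = "\<lambda>\<omega>. restrict \<omega> (I - J)"
  let ?C = "prod_emb I M J (Pi\<^sub>E J A)"
  have C: "?C \<in> sets ?P" using J A by (intro sets_PiM_I) auto
  have r: "?r \<in> measurable ?P ?N" by (rule measurable_restrict_subset) auto
  have r': "?r \<in> measurable (density ?P (indicator ?C)) ?N" using r by simp
  have *: "emeasure (distr (density ?P (indicator ?C)) ?N ?r) Z =
      emeasure ?P (?C \<inter> {\<omega> \<in> space ?P. ?r \<omega> \<in> Z})" if "Z \<in> sets ?N" for Z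
  proof -
    have "?r -` Z \<inter> space ?P \<in> sets ?P" using measurable_sets[OF r that] .
    then have "emeasure (distr (density ?P (indicator ?C)) ?N ?r) Z = emeasure ?P (?C \<inter> (?r -` Z \<inter> space ?P))"
      using C that by (subst emeasure_distr[OF r' that]) (simp add: emeasure_restricted)
    also have "?r -` Z \<inter> space ?P = {\<omega> \<in> space ?P. ?r \<omega> \<in> Z}" by auto
    finally show ?thesis .
  qed
  have "distr (density ?P (indicator ?C)) ?N ?r = scale_measure (emeasure ?P ?C) ?N"
  proof (rule measure_eqI_PiM_infinite)
    fix A' J' assume J': "finite J'" "J' \<subseteq> I - J" and A': "\<And>i. i \<in> J' \<Longrightarrow> A' i \<in> sets (M i)"
    let ?Z = "prod_emb (I - J) M J' (Pi\<^sub>E J' A')"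
    let ?B = "\<lambda>i. if i \<in> J then A i else A' i"
    have Z: "?Z \<in> sets ?N" using J' A' by (intro sets_PiM_I) auto
    have sp: "\<And>i. i \<in> J \<Longrightarrow> A i \<subseteq> space (M i)" "\<And>i. i \<in> J' \<Longrightarrow> A' i \<subseteq> space (M i)"
      using sets.sets_into_space[OF A] sets.sets_into_space[OF A'] by auto
    have eq: "?C \<inter> {\<omega> \<in> space ?P. ?r \<omega> \<in> ?Z} = prod_emb I M (J \<union> J') (Pi\<^sub>E (J \<union> J') ?B)"
      using J' J by (auto simp: prod_emb_def space_PiM PiE_iff extensional_def subset_iff split: if_splits)
    have "emeasure ?P (?C \<inter> {\<omega> \<in> space ?P. ?r \<omega> \<in> ?Z}) = (\<Prod>i\<in>J \<union> J'. emeasure (M i) (?B i))"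
      unfolding eq using J J' A A' by (intro emeasure_PiM_emb) auto
    also have "\<dots> = (\<Prod>i\<in>J. emeasure (M i) (?B i)) * (\<Prod>i\<in>J'. emeasure (M i) (?B i))"
      using J J' by (intro prod.union_disjoint) auto
    also have "(\<Prod>i\<in>J. emeasure (M i) (?B i)) = emeasure ?P ?C"
      using J A by (subst emeasure_PiM_emb) auto
    also have "(\<Prod>i\<in>J'. emeasure (M i) (?B i)) = (\<Prod>i\<in>J'. emeasure (M i) (A' i))"
      using J' by (intro prod.cong) auto
    also have "\<dots> = emeasure ?N ?Z"
      using J' A' by (intro Infinite_Product_Measure.emeasure_PiM_emb[symmetric] M.prob_space_axioms) auto
    finally show "emeasure (distr (density ?P (indicator ?C)) ?N ?r) ?Z =
        emeasure (scale_measure (emeasure ?P ?C) ?N) ?Z"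
      unfolding *[OF Z] emeasure_scale_measure .
  next
    have "emeasure (distr (density ?P (indicator ?C)) ?N ?r) (space ?N) \<noteq> \<infinity>"
      by (subst *) auto
    then show "finite_measure (distr (density ?P (indicator ?C)) ?N ?r)"
      by (intro finite_measureI) simp
  qed simp_all
  then show ?thesis using *[OF Y] by simp
qed

text \<open>Kolmogorov's law for events that can be read off the coordinates outside any finite set.
  \<open>X\<close> is independent of all cylinders, so the restriction of the measure to
  \<open>X\<close> equals the measure scaled by the probability of \<open>X\<close>. Evaluating both
  at \<open>X\<close> shows that this probability equals its own square.\<close>

lemma tail_zero_one:
  assumes X: "X \<in> sets (PiM I M)"
    and tail: "\<And>J. finite J \<Longrightarrow> J \<subseteq> I \<Longrightarrow>
      \<exists>Y\<in>sets (PiM (I - J) M). X = {\<omega> \<in> space (PiM I M). restrict \<omega> (I - J) \<in> Y}"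
  shows "prob X = 0 \<or> prob X = 1"
proof -
  let ?P = "PiM I M"
  have *: "emeasure ?P (prod_emb I M J (Pi\<^sub>E J A) \<inter> X) = emeasure ?P (prod_emb I M J (Pi\<^sub>E J A)) * emeasure ?P X"
    if J: "finite J" "J \<subseteq> I" and A: "\<And>i. i \<in> J \<Longrightarrow> A i \<in> sets (M i)" for J A
  proof -
    obtain Y where Y: "Y \<in> sets (PiM (I - J) M)" "X = {\<omega> \<in> space ?P. restrict \<omega> (I - J) \<in> Y}"
      using tail[OF J] by blast
    have sp: "prod_emb I M J (Pi\<^sub>E J (\<lambda>i. space (M i))) = space ?P"
      using J(2) by (auto simp: prod_emb_def space_PiM PiE_iff extensional_def subset_iff)
    have "space ?P \<inter> X = X" using Y(2) by auto
    moreover have "emeasure ?P (space ?P \<inter> X) = emeasure ?P (space ?P) * emeasure (PiM (I - J) M) Y"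
      using emeasure_emb_Int_tail[OF J _ Y(1), of "\<lambda>i. space (M i)"] unfolding sp Y(2)[symmetric] by simp
    ultimately have "emeasure ?P X = emeasure (PiM (I - J) M) Y"
      by (simp add: emeasure_space_1)
    then show ?thesis using emeasure_emb_Int_tail[OF J A Y(1)] unfolding Y(2)[symmetric] by simp
  qed
  have "density ?P (indicator X) = scale_measure (emeasure ?P X) ?P"
  proof (rule measure_eqI_PiM_infinite)
    fix A J assume J: "finite J" "J \<subseteq> I" and A: "\<And>i. i \<in> J \<Longrightarrow> A i \<in> sets (M i)"
    have "prod_emb I M J (Pi\<^sub>E J A) \<in> sets ?P" using J A by (intro sets_PiM_I) auto
    then show "emeasure (density ?P (indicator X)) (prod_emb I M J (Pi\<^sub>E J A)) =
        emeasure (scale_measure (emeasure ?P X) ?P) (prod_emb I M J (Pi\<^sub>E J A))"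
      using *[OF J A] X by (simp add: emeasure_restricted Int_commute mult.commute)
  next
    have "emeasure (density ?P (indicator X)) (space ?P) \<noteq> \<infinity>"
      using X by (simp add: emeasure_restricted)
    then show "finite_measure (density ?P (indicator X))" by (intro finite_measureI) simp
  qed simp_all
  then have "emeasure (density ?P (indicator X)) X = emeasure (scale_measure (emeasure ?P X) ?P) X" by simp
  then have "emeasure ?P X = emeasure ?P X * emeasure ?P X"
    using X by (simp add: emeasure_restricted)
  then have "prob X = prob X * prob X"
    unfolding emeasure_eq_measure by (simp add: ennreal_mult[symmetric])
  then show ?thesis by auto
qed

end

lemma product_prob_space_bond: "product_prob_space (\<lambda>e. measure_pmf (bernoulli_pmf (\<pi> e)))"
  by (intro product_prob_spaceI measure_pmf.prob_space_axioms)

lemma prob_space_bond_measure: "prob_space (bond_measure E \<pi>)"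
  unfolding bond_measure_def by (intro prob_space_PiM measure_pmf.prob_space_axioms)

lemma space_bond_measure: "space (bond_measure E \<pi>) = Pi\<^sub>E E (\<lambda>_. UNIV)"
  by (simp add: bond_measure_def space_PiM)

definition open_edges :: "'e set \<Rightarrow> ('e \<Rightarrow> bool) \<Rightarrow> 'e set" where
  "open_edges F \<omega> = {e \<in> F. \<omega> e}"

lemma open_edges_eq_iff: "\<eta> \<subseteq> F \<Longrightarrow> open_edges F \<omega> = \<eta> \<longleftrightarrow> (\<forall>e\<in>F. \<omega> e \<in> {e \<in> \<eta>})"
  by (auto simp: open_edges_def)

text \<open>The bridge from \<open>cprob\<close> to the infinite product: an event on finitely many
  edges is a finite disjoint union of cylinders, one for each set \<open>\<eta>\<close> of open
  edges.\<close>

lemma cylinder: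
  assumes "finite F" "F \<subseteq> E" "weights F \<pi>"
  shows sets_cylinder: "{\<omega> \<in> space (bond_measure E \<pi>). A (open_edges F \<omega>)} \<in> sets (bond_measure E \<pi>)"
    and measure_cylinder: "measure (bond_measure E \<pi>) {\<omega> \<in> space (bond_measure E \<pi>). A (open_edges F \<omega>)} = cprob F \<pi> A"
proof -
  let ?M = "bond_measure E \<pi>"
  interpret product_prob_space "\<lambda>e. measure_pmf (bernoulli_pmf (\<pi> e))" E
    by (rule product_prob_space_bond)
  let ?X = "\<lambda>\<eta>. {\<omega> \<in> space ?M. \<forall>e\<in>F. \<omega> e \<in> {e \<in> \<eta>}}"
  have eq: "{\<omega> \<in> space ?M. A (open_edges F \<omega>)} = (\<Union>\<eta>\<in>{\<eta> \<in> Pow F. A \<eta>}. ?X \<eta>)"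
  proof (intro equalityI subsetI)
    fix \<omega> assume "\<omega> \<in> {\<omega> \<in> space ?M. A (open_edges F \<omega>)}"
    moreover have "\<omega> \<in> ?X (open_edges F \<omega>)" if "\<omega> \<in> space ?M" using that by (auto simp: open_edges_def)
    moreover have "open_edges F \<omega> \<subseteq> F" by (auto simp: open_edges_def)
    ultimately show "\<omega> \<in> (\<Union>\<eta>\<in>{\<eta> \<in> Pow F. A \<eta>}. ?X \<eta>)" by blast
  next
    fix \<omega> assume "\<omega> \<in> (\<Union>\<eta>\<in>{\<eta> \<in> Pow F. A \<eta>}. ?X \<eta>)"
    then obtain \<eta> where \<eta>: "\<eta> \<subseteq> F" "A \<eta>" "\<omega> \<in> ?X \<eta>" by blast
    then have "open_edges F \<omega> = \<eta>" using open_edges_eq_iff[of \<eta> F \<omega>] by simp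
    then show "\<omega> \<in> {\<omega> \<in> space ?M. A (open_edges F \<omega>)}" using \<eta> by simp
  qed
  have meas: "?X \<eta> \<in> sets ?M" for \<eta>
    unfolding bond_measure_def using assms
    by (intro sets.sets_Collect_finite_All sets_Collect_single') auto
  have fin: "finite {\<eta> \<in> Pow F. A \<eta>}" using assms by simp
  show "{\<omega> \<in> space ?M. A (open_edges F \<omega>)} \<in> sets ?M"
    unfolding eq using meas by (intro sets.finite_UN fin) auto
  have prob: "measure ?M (?X \<eta>) = (\<Prod>e\<in>\<eta>. \<pi> e) * (\<Prod>e\<in>F - \<eta>. 1 - \<pi> e)" if \<eta>: "\<eta> \<subseteq> F" for \<eta>
  proof -
    have "emeasure ?M (?X \<eta>) = (\<Prod>e\<in>F. emeasure (measure_pmf (bernoulli_pmf (\<pi> e))) {e \<in> \<eta>})"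
      unfolding bond_measure_def using assms by (intro emeasure_PiM_Collect) auto
    also have "\<dots> = ennreal (\<Prod>e\<in>F. pmf (bernoulli_pmf (\<pi> e)) (e \<in> \<eta>))"
      by (simp add: emeasure_pmf_single prod_ennreal)
    also have "(\<Prod>e\<in>F. pmf (bernoulli_pmf (\<pi> e)) (e \<in> \<eta>)) = (\<Prod>e\<in>F. if e \<in> \<eta> then \<pi> e else 1 - \<pi> e)"
      using assms(3) by (intro prod.cong) (auto simp: weights_def)
    also have "\<dots> = (\<Prod>e\<in>F \<inter> \<eta>. \<pi> e) * (\<Prod>e\<in>F \<inter> - \<eta>. 1 - \<pi> e)"
      using assms(1) by (simp add: prod.If_cases)
    also have "\<dots> = (\<Prod>e\<in>\<eta>. \<pi> e) * (\<Prod>e\<in>F - \<eta>. 1 - \<pi> e)"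
      using \<eta> by (simp add: Int_absorb1 Diff_eq)
    finally show ?thesis
      using weight_nonneg[OF assms(3) \<eta>] by (simp add: measure_def)
  qed
  have disj: "disjoint_family_on ?X {\<eta> \<in> Pow F. A \<eta>}"
    unfolding disjoint_family_on_def
  proof (intro ballI impI)
    fix \<eta> \<eta>' assume "\<eta> \<in> {\<eta> \<in> Pow F. A \<eta>}" "\<eta>' \<in> {\<eta> \<in> Pow F. A \<eta>}" "\<eta> \<noteq> \<eta>'"
    then have "\<eta> \<subseteq> F" "\<eta>' \<subseteq> F" "\<eta> \<noteq> \<eta>'" by auto
    then show "?X \<eta> \<inter> ?X \<eta>' = {}"
      unfolding open_edges_eq_iff[symmetric, OF \<open>\<eta> \<subseteq> F\<close>] open_edges_eq_iff[symmetric, OF \<open>\<eta>' \<subseteq> F\<close>] by blast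
  qed
  have "measure ?M {\<omega> \<in> space ?M. A (open_edges F \<omega>)} = (\<Sum>\<eta>\<in>{\<eta> \<in> Pow F. A \<eta>}. measure ?M (?X \<eta>))"
    unfolding eq
  proof (rule finite_measure.finite_measure_finite_Union)
    show "finite_measure ?M" using prob_space_bond_measure[of E \<pi>] by (simp add: prob_space.finite_measure)
  qed (use fin meas disj in auto)
  also have "\<dots> = (\<Sum>\<eta>\<in>{\<eta> \<in> Pow F. A \<eta>}. (\<Prod>e\<in>\<eta>. \<pi> e) * (\<Prod>e\<in>F - \<eta>. 1 - \<pi> e))"
    by (intro sum.cong[OF refl] prob) blast
  also have "\<dots> = cprob F \<pi> A"
    unfolding cprob_def sum.inter_filter[OF finite_Pow_iff[THEN iffD2, OF assms(1)]]
    by (intro sum.cong) auto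
  finally show "measure ?M {\<omega> \<in> space ?M. A (open_edges F \<omega>)} = cprob F \<pi> A" .
qed

subsection \<open>Sharpness of the phase transition: infinite volume\<close>

lemma reach_finite_edges: "reach \<omega> x y \<Longrightarrow> \<exists>K. finite K \<and> K \<subseteq> \<omega> \<and> reach K x y"
  unfolding reach_def[of \<omega>]
proof (induction rule: rtrancl_induct)
  case base
  have "finite {} \<and> {} \<subseteq> \<omega> \<and> reach {} x x" by simp
  then show ?case by blast
next
  case (step y z)
  then obtain K where K: "finite K" "K \<subseteq> \<omega>" "reach K x y" by blast
  have "reach (insert {y, z} K) x y" by (rule reach_mono[OF _ K(3)]) auto
  moreover have "reach (insert {y, z} K) y z" by (rule reach_edge) simp
  ultimately have "reach (insert {y, z} K) x z" by (rule reach_trans)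
  moreover have "finite (insert {y, z} K)" "insert {y, z} K \<subseteq> \<omega>" using K step by (auto simp: adj_rel_def)
  ultimately show ?case by blast
qed

lemma open_edges_Int: "F \<subseteq> E \<Longrightarrow> open_edges E \<omega> \<inter> F = open_edges F \<omega>"
  by (auto simp: open_edges_def)

lemma open_edges_subset: "open_edges F \<omega> \<subseteq> F"
  by (auto simp: open_edges_def)

context lfgraph
begin

lemma touching_subset: "touching B \<subseteq> E"
  by (auto simp: touching_def)

lemma finite_touching': "finite B \<Longrightarrow> finite (touching B)"
  using finite_touching by (simp add: touching_def)

lemma reach_exit_touching:
  assumes "\<omega> \<subseteq> E" "reach \<omega> x y" "x \<in> B" "y \<notin> B"
  obtains w where "w \<notin> B" "reach (\<omega> \<inter> touching B) x w"
proof -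
  have "\<omega> \<inter> touching B = {e \<in> \<omega>. e \<inter> B \<noteq> {}}" using assms(1) by (auto simp: touching_def)
  then show ?thesis using reach_first_exit_touching[OF assms(2-4)] that by metis
qed

lemma infinite_open_path_iff:
  "(\<exists>\<gamma>. infinite_open_path E \<omega> x \<gamma>) \<longleftrightarrow> infinite {y. reach (open_edges E \<omega>) x y}"
proof
  assume "\<exists>\<gamma>. infinite_open_path E \<omega> x \<gamma>"
  then obtain \<gamma> where \<gamma>: "\<gamma> 0 = x" "inj \<gamma>" "\<And>n. {\<gamma> n, \<gamma> (Suc n)} \<in> open_edges E \<omega>"
    by (auto simp: infinite_open_path_def open_edges_def)
  then show "infinite {y. reach (open_edges E \<omega>) x y}"
    using ray_imp_infinite_cluster[OF \<gamma>(2,3)] by simp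
next
  assume inf: "infinite {y. reach (open_edges E \<omega>) x y}"
  have "finite {w. {v, w} \<in> open_edges E \<omega>}" for v
    by (rule finite_subset[OF _ finite_nbrs[of v]]) (auto simp: open_edges_def)
  from infinite_cluster_imp_ray[OF this inf] show "\<exists>\<gamma>. infinite_open_path E \<omega> x \<gamma>"
    by (auto simp: infinite_open_path_def open_edges_def)
qed

definition exits :: "'b \<Rightarrow> 'b set \<Rightarrow> 'b set set \<Rightarrow> bool" where
  "exits x B \<omega> \<longleftrightarrow> (\<exists>y. y \<notin> B \<and> reach \<omega> x y)"

lemma exits_mono: "\<omega> \<subseteq> \<omega>' \<Longrightarrow> exits x B \<omega> \<Longrightarrow> exits x B \<omega>'"
  unfolding exits_def by (metis reach_mono)

lemma exits_touching: "\<omega> \<subseteq> E \<Longrightarrow> x \<in> B \<Longrightarrow> exits x B (\<omega> \<inter> touching B) \<longleftrightarrow> exits x B \<omega>"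
  using reach_exit_touching[of \<omega> x _ B] exits_mono[of "\<omega> \<inter> touching B" \<omega>]
  unfolding exits_def by (metis Int_lower1)

lemma mem_ball: "x \<in> V \<Longrightarrow> x \<in> graph_ball V E x n"
  by (simp add: graph_ball_def)

lemma infinite_cluster_iff:
  assumes "\<omega> \<subseteq> E" "x \<in> V"
  shows "infinite {y. reach \<omega> x y} \<longleftrightarrow> (\<forall>n. exits x (graph_ball V E x n) \<omega>)"
proof
  assume inf: "infinite {y. reach \<omega> x y}"
  show "\<forall>n. exits x (graph_ball V E x n) \<omega>"
  proof
    fix n
    obtain y where "reach \<omega> x y" "Suc n \<le> d x y"
      using finite_cluster_exit[OF assms inf] by blast
    moreover from this have "y \<notin> graph_ball V E x n" by (simp add: graph_ball_def)
    ultimately show "exits x (graph_ball V E x n) \<omega>" unfolding exits_def by blast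
  qed
next
  assume ex: "\<forall>n. exits x (graph_ball V E x n) \<omega>"
  show "infinite {y. reach \<omega> x y}"
  proof
    assume fin: "finite {y. reach \<omega> x y}"
    define n where "n = Max (d x ` {y. reach \<omega> x y})"
    have "y \<in> graph_ball V E x n" if "reach \<omega> x y" for y
      using fin that reach_V[OF that assms] by (auto simp: graph_ball_def n_def)
    then show False using ex by (auto simp: exits_def)
  qed
qed

text \<open>An existential over uncountably many paths becomes a countable, decreasing intersection
  of events that depend on finitely many edges each.\<close>

lemma perc_event_eq:
  assumes "x \<in> V"
  shows "{\<omega> \<in> space (bond_measure E \<pi>). \<exists>\<gamma>. infinite_open_path E \<omega> x \<gamma>} =
    (\<Inter>n. {\<omega> \<in> space (bond_measure E \<pi>). exits x (graph_ball V E x n) (open_edges (touching (graph_ball V E x n)) \<omega>)})"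
proof -
  have "exits x (graph_ball V E x n) (open_edges E \<omega>) \<longleftrightarrow>
      exits x (graph_ball V E x n) (open_edges (touching (graph_ball V E x n)) \<omega>)" for n \<omega>
    unfolding open_edges_Int[OF touching_subset, symmetric]
    using exits_touching[OF open_edges_subset mem_ball[OF assms]] by simp
  then show ?thesis
    unfolding infinite_open_path_iff infinite_cluster_iff[OF open_edges_subset assms] by auto
qed

lemma perc_prob_ge:
  assumes "x \<in> V" "weights E \<pi>"
    and "\<And>n. n0 \<le> n \<Longrightarrow> c \<le> cprob (touching (graph_ball V E x n)) \<pi> (exits x (graph_ball V E x n))"
  shows "c \<le> perc_prob E \<pi> x"
proof -
  let ?M = "bond_measure E \<pi>"
  let ?B = "graph_ball V E x"
  interpret prob_space ?M by (rule prob_space_bond_measure)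
  let ?X = "\<lambda>n. {\<omega> \<in> space ?M. exits x (?B n) (open_edges (touching (?B n)) \<omega>)}"
  have w: "weights (touching B) \<pi>" for B using weights_subset[OF assms(2) touching_subset] .
  have X: "?X n = {\<omega> \<in> space ?M. exits x (?B n) (open_edges E \<omega>)}" for n
    unfolding open_edges_Int[OF touching_subset, symmetric]
    using exits_touching[OF open_edges_subset mem_ball[OF assms(1)]] by simp
  have sets: "?X n \<in> sets ?M" for n
    using finite_ball[OF assms(1)] by (intro sets_cylinder finite_touching' touching_subset w)
  have "decseq ?X"
    unfolding X unfolding decseq_def exits_def graph_ball_def by (auto intro: order_trans)
  then have "(\<lambda>n. prob (?X n)) \<longlonglongrightarrow> prob (\<Inter>n. ?X n)"
    using sets by (intro finite_Lim_measure_decseq) auto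
  moreover have "c \<le> prob (?X n)" if "n0 \<le> n" for n
    using assms(3)[OF that] finite_ball[OF assms(1)]
    by (subst measure_cylinder) (auto intro!: finite_touching' touching_subset w)
  ultimately have "c \<le> prob (\<Inter>n. ?X n)"
    by (intro LIMSEQ_le_const) auto
  then show ?thesis unfolding perc_prob_def perc_event_eq[OF assms(1)] .
qed

text \<open>Exiting from \<open>x\<close> is an increasing event, so opening all of \<open>K\<close>
  only helps it. After this modification it is independent of the edges of \<open>K\<close>, and
  these are all open with probability \<open>p ^ card K\<close>; then \<open>z\<close> is connected
  to \<open>x\<close> and exits as well.\<close>

lemma cprob_exits_transfer:
  assumes K: "finite K" "K \<subseteq> E" "reach K z x" and B: "finite B" "z \<in> B" "x \<in> B" and p: "0 \<le> p" "p \<le> 1"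
  shows "p ^ card K * cprob (touching B) (\<lambda>_. p) (exits x B) \<le> cprob (touching B) (\<lambda>_. p) (exits z B)"
proof -
  let ?P = "\<lambda>F. cprob F (\<lambda>_. p)"
  let ?F = "touching B \<union> K"
  have w: "weights F (\<lambda>_. p)" for F :: "'b set set" using p by (simp add: weights_def)
  have fin: "finite ?F" using K B finite_touching' by simp
  have FE: "?F \<subseteq> E" using K touching_subset by auto
  have restr: "?P (touching B) (exits v B) = ?P ?F (exits v B)" if "v \<in> B" for v
  proof -
    have "?P (touching B) (exits v B) = ?P ?F (\<lambda>\<omega>. exits v B (\<omega> \<inter> touching B))"
      using fin by (intro cprob_restrict[symmetric]) auto
    also have "\<dots> = ?P ?F (exits v B)"
    proof (rule cprob_cong[OF _ refl])
      fix \<omega> assume "\<omega> \<subseteq> ?F"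
      then have "\<omega> \<subseteq> E" using FE by (rule subset_trans)
      then show "exits v B (\<omega> \<inter> touching B) = exits v B \<omega>" by (rule exits_touching[OF _ that])
    qed
    finally show ?thesis .
  qed
  have "?P ?F (exits x B) \<le> ?P ?F (\<lambda>\<omega>. exits x B (\<omega> \<inter> (?F - K) \<union> K))"
    by (rule cprob_mono[OF w]) (auto elim!: exits_mono[rotated])
  also have "\<dots> = ?P (?F - K) (\<lambda>\<omega>. exits x B (\<omega> \<union> K))"
    using fin by (intro cprob_restrict[where A = "\<lambda>\<omega>. exits x B (\<omega> \<union> K)"]) auto
  finally have "p ^ card K * ?P ?F (exits x B) \<le> p ^ card K * ?P (?F - K) (\<lambda>\<omega>. exits x B (\<omega> \<union> K))"
    using p by (intro mult_left_mono) auto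
  also have "p ^ card K = ?P K (\<lambda>\<omega>. \<omega> = K)" using cprob_all_open[OF K(1), of "\<lambda>_. p"] by simp
  also have "?P K (\<lambda>\<omega>. \<omega> = K) * ?P (?F - K) (\<lambda>\<omega>. exits x B (\<omega> \<union> K)) =
      ?P ?F (\<lambda>\<omega>. \<omega> \<inter> K = K \<and> exits x B (\<omega> \<inter> (?F - K) \<union> K))"
    using fin by (intro cprob_indep[symmetric, where A = "\<lambda>\<omega>. \<omega> = K" and B = "\<lambda>\<omega>. exits x B (\<omega> \<union> K)"]) auto
  also have "\<dots> \<le> ?P ?F (exits z B)"
  proof (rule cprob_mono[OF w])
    fix \<omega> assume *: "\<omega> \<inter> K = K \<and> exits x B (\<omega> \<inter> (?F - K) \<union> K)"
    then have "exits x B \<omega>" by (auto elim!: exits_mono[rotated])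
    then obtain y where "y \<notin> B" "reach \<omega> x y" by (auto simp: exits_def)
    moreover have "reach \<omega> z x" by (rule reach_mono[OF _ K(3)]) (use * in auto)
    ultimately show "exits z B \<omega>" using reach_trans[of \<omega> z x y] by (auto simp: exits_def)
  qed
  finally show ?thesis using restr[OF B(2)] restr[OF B(3)] p by (simp add: cprob_all_open[OF K(1)])
qed

text \<open>The vanishing percolation probability is known at the single vertex \<open>z\<close>
  only. If every finite \<open>S\<close> around \<open>x\<close> had
  \<open>phi p x S \<ge> 1\<close>, then \<open>x\<close> would exit all large balls around
  \<open>z\<close> with probability bounded below at the parameter \<open>p2\<close>, and a fixed
  path from \<open>z\<close> to \<open>x\<close> would transfer this to \<open>z\<close>.\<close>

lemma subcritical_imp_phi_less_1:
  assumes "0 < p" "p < p2" "p2 \<le> 1" "z \<in> V" "x \<in> V" and zero: "perc_prob E (\<lambda>_. p2) z = 0"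
  shows "\<exists>S. finite S \<and> x \<in> S \<and> S \<subseteq> V \<and> phi p x S < 1"
proof (rule ccontr)
  assume *: "\<not> ?thesis"
  \<comment> \<open>The exit bound asks for all finite sets of the type, not only for subsets of
    \<open>V\<close>; \<open>phi\<close> sees only \<open>S \<inter> V\<close>.\<close>
  have phi: "1 \<le> phi p x S" if S: "finite S" "x \<in> S" for S
  proof -
    have "bdry (S \<inter> V) = bdry S" "inside (S \<inter> V) = inside S"
      using edge_V edges by (fastforce simp: bdry_def inside_def)+
    then have "phi p x (S \<inter> V) = phi p x S" by (simp add: phi_def)
    moreover have "\<not> phi p x (S \<inter> V) < 1" using * S assms(5) by blast
    ultimately show ?thesis by simp
  qed
  obtain K where K: "finite K" "K \<subseteq> E" "reach K z x"
    using reach_finite_edges[OF connected[OF assms(4,5)]] by blast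
  let ?c = "p2 ^ card K * (1 - exp (p - p2))"
  have "?c \<le> perc_prob E (\<lambda>_. p2) z"
  proof (rule perc_prob_ge[OF assms(4)])
    show "weights E (\<lambda>_. p2)" using assms by (simp add: weights_def)
    fix n assume n: "d z x \<le> n"
    let ?B = "graph_ball V E z n"
    have B: "finite ?B" "z \<in> ?B" "x \<in> ?B"
      using finite_ball assms n by (auto simp: graph_ball_def)
    have "1 - exp (p - p2) \<le> cprob (touching ?B) (\<lambda>_. p2) (exits x ?B)"
      unfolding exits_def[abs_def] using B assms phi by (intro exit_prob_lower_bound) auto
    then have "?c \<le> p2 ^ card K * cprob (touching ?B) (\<lambda>_. p2) (exits x ?B)"
      using assms by (intro mult_left_mono) auto
    also have "\<dots> \<le> cprob (touching ?B) (\<lambda>_. p2) (exits z ?B)"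
      using K B assms by (intro cprob_exits_transfer) auto
    finally show "?c \<le> cprob (touching ?B) (\<lambda>_. p2) (exits z ?B)" .
  qed
  moreover have "0 < ?c" using assms by auto
  ultimately show False using zero by simp
qed

text \<open>A bijection of the whole type that preserves \<open>V\<close>, so that inverses and
  images of arbitrary sets and edges can be formed without side conditions.\<close>

definition automorphism :: "('b \<Rightarrow> 'b) \<Rightarrow> bool" where
  "automorphism T \<longleftrightarrow> bij T \<and> T ` V = V \<and> (\<forall>u w. {T u, T w} \<in> E \<longleftrightarrow> {u, w} \<in> E)"

text \<open>The maps lead from the representative to the vertex, opposite to
  \<open>quasi_transitive\<close>: below, a set chosen at a representative is carried to an
  arbitrary vertex.\<close>

definition orbit_representatives :: "'b set \<Rightarrow> bool" where
  "orbit_representatives V0 \<longleftrightarrow> finite V0 \<and> V0 \<subseteq> V \<and>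
     (\<forall>w\<in>V. \<exists>x\<in>V0. \<exists>T. automorphism T \<and> T x = w)"

lemma automorphism_d:
  assumes "automorphism T"
  shows "d (T x) (T y) = d x y"
proof -
  have bij: "bij T" using assms by (simp add: automorphism_def)
  have r: "(T u, T w) \<in> adj_rel E \<longleftrightarrow> (u, w) \<in> adj_rel E" for u w
    using assms by (auto simp: automorphism_def adj_rel_def)
  have "(T x, T y) \<in> adj_rel E ^^ n \<longleftrightarrow> (x, y) \<in> adj_rel E ^^ n" for n y
  proof (induction n arbitrary: y)
    case 0
    show ?case using bij by (auto simp: bij_def inj_eq)
  next
    case (Suc n)
    have "(T x, T y) \<in> adj_rel E ^^ Suc n \<longleftrightarrow> (\<exists>v. (T x, v) \<in> adj_rel E ^^ n \<and> (v, T y) \<in> adj_rel E)"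
      by auto
    also have "\<dots> \<longleftrightarrow> (\<exists>v. (T x, T v) \<in> adj_rel E ^^ n \<and> (T v, T y) \<in> adj_rel E)"
      using bij by (metis bij_pointE)
    also have "\<dots> \<longleftrightarrow> (x, y) \<in> adj_rel E ^^ Suc n" using Suc r by auto
    finally show ?case .
  qed
  then show ?thesis by (simp add: graph_dist_def)
qed

lemma automorphism_phi:
  assumes "automorphism T"
  shows "phi p (T x) (T ` S) = phi p x S"
proof -
  have bij: "bij T" and inj: "inj T" using assms by (auto simp: automorphism_def bij_def)
  have E: "{T u, T w} \<in> E \<longleftrightarrow> {u, w} \<in> E" for u w using assms by (simp add: automorphism_def)
  have bdry: "bdry (T ` S) = map_prod T T ` bdry S"
  proof (intro equalityI subsetI)
    fix a assume "a \<in> bdry (T ` S)"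
    then obtain u w where a: "a = (T u, w)" "u \<in> S" "w \<notin> T ` S" "{T u, w} \<in> E" by (auto simp: bdry_def)
    obtain w' where "w = T w'" using bij by (metis bij_pointE)
    then have "(u, w') \<in> bdry S" "a = map_prod T T (u, w')" using a E by (auto simp: bdry_def)
    then show "a \<in> map_prod T T ` bdry S" by blast
  next
    fix a assume "a \<in> map_prod T T ` bdry S"
    then show "a \<in> bdry (T ` S)" using E inj by (auto simp: bdry_def inj_def)
  qed
  have inside: "inside (T ` S) = (`) T ` inside S"
  proof (intro equalityI subsetI)
    fix e assume e: "e \<in> inside (T ` S)"
    then have "e \<in> E" by (simp add: inside_def)
    then obtain u w where "e = {u, w}" using edges by blast
    then obtain u' w' where e': "e = {T u', T w'}" "u' \<in> S" "w' \<in> S" using e by (auto simp: inside_def)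
    then have "{u', w'} \<in> inside S" using e E by (auto simp: inside_def)
    moreover have "e = T ` {u', w'}" using e' by simp
    ultimately show "e \<in> (`) T ` inside S" by blast
  next
    fix e assume "e \<in> (`) T ` inside S"
    then obtain e' where e': "e = T ` e'" "e' \<in> E" "e' \<subseteq> S" by (auto simp: inside_def)
    then obtain u w where "e' = {u, w}" using edges by blast
    then show "e \<in> inside (T ` S)" using e' E by (auto simp: inside_def)
  qed
  have "inj_on ((`) T) (inside S)" using inj by (meson inj_on_image inj_on_subset subset_UNIV inj_image_eq_iff inj_onI)
  then have P: "cprob (inside (T ` S)) (\<lambda>_. p) (\<lambda>\<omega>. reach \<omega> (T x) (T u)) = cprob (inside S) (\<lambda>_. p) (\<lambda>\<omega>. reach \<omega> x u)" for u
    unfolding inside by (subst cprob_image) (simp_all add: reach_image[OF inj])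
  have "inj_on (map_prod T T) (bdry S)" using inj by (auto simp: inj_on_def)
  then show ?thesis
    unfolding phi_def bdry by (subst sum.reindex) (auto simp: P case_prod_unfold)
qed

text \<open>Sets with \<open>phi < 1\<close> are chosen at the finitely many representatives and
  transported by automorphisms. This makes both the bound on \<open>phi\<close> and the radius
  \<open>L\<close> uniform over all vertices.\<close>

lemma subcritical_exponential_decay:
  assumes "0 < p" "p < p2" "p2 \<le> 1" "z \<in> V" and zero: "perc_prob E (\<lambda>_. p2) z = 0"
    and "orbit_representatives V0"
  shows "\<exists>\<beta> C. 0 < \<beta> \<and> \<beta> < 1 \<and> 0 \<le> C \<and> (\<forall>x\<in>V. \<forall>F k. finite F \<longrightarrow> F \<subseteq> E \<longrightarrow>
      cprob F (\<lambda>_. p) (\<lambda>\<omega>. \<exists>y. reach \<omega> x y \<and> k \<le> d x y) \<le> C * \<beta> ^ k)"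
proof -
  have V0: "finite V0" "V0 \<subseteq> V" "\<And>w. w \<in> V \<Longrightarrow> \<exists>x\<in>V0. \<exists>T. automorphism T \<and> T x = w"
    using assms(6) by (auto simp: orbit_representatives_def)
  have "\<forall>x\<in>V. \<exists>S. finite S \<and> x \<in> S \<and> S \<subseteq> V \<and> phi p x S < 1"
    using subcritical_imp_phi_less_1[OF assms(1-4) _ zero] by blast
  then obtain S where S: "\<And>x. x \<in> V \<Longrightarrow> finite (S x) \<and> x \<in> S x \<and> S x \<subseteq> V \<and> phi p x (S x) < 1" by metis
  \<comment> \<open>Inserting 1/2 keeps \<open>\<phi>\<close> away from 0, so that its root
    \<open>\<beta>\<close> is positive and \<open>1 / \<phi>\<close> is meaningful.\<close>
  define \<phi> where "\<phi> = Max (insert (1/2) ((\<lambda>x. phi p x (S x)) ` V0))"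
  have finV0: "finite (insert (1/2) ((\<lambda>x. phi p x (S x)) ` V0))" using V0(1) by simp
  have "1/2 \<le> \<phi>" unfolding \<phi>_def by (rule Max_ge[OF finV0]) simp
  moreover have "\<phi> < 1" "\<And>x. x \<in> V0 \<Longrightarrow> phi p x (S x) \<le> \<phi>"
    unfolding \<phi>_def using finV0 V0(2) S by (auto intro!: Max_ge)
  ultimately have \<phi>: "1/2 \<le> \<phi>" "\<phi> < 1" "\<And>x. x \<in> V0 \<Longrightarrow> phi p x (S x) \<le> \<phi>"
    by blast+
  define L where "L = Max (insert 0 (\<Union>x\<in>V0. d x ` S x))"
  have "finite (\<Union>x\<in>V0. d x ` S x)" using V0 S by blast
  then have L: "S x \<subseteq> graph_ball V E x L" if "x \<in> V0" for x
  proof -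
    have "S x \<subseteq> V" using S[of x] V0(2) that by blast
    moreover have "d x y \<le> L" if "y \<in> S x" for y
      unfolding L_def using that \<open>x \<in> V0\<close> \<open>finite (\<Union>x\<in>V0. d x ` S x)\<close> by (intro Max_ge) auto
    ultimately show ?thesis by (auto simp: graph_ball_def)
  qed
  have "\<exists>S. finite S \<and> x \<in> S \<and> S \<subseteq> graph_ball V E x L \<and> phi p x S \<le> \<phi>" if xV: "x \<in> V" for x
  proof -
    obtain x0 T where T: "x0 \<in> V0" "automorphism T" "T x0 = x" using V0(3)[OF xV] by blast
    have "T ` S x0 \<subseteq> graph_ball V E x L"
    proof
      fix y assume "y \<in> T ` S x0"
      then obtain y' where y': "y = T y'" "y' \<in> S x0" by blast
      then have "d x y \<le> L" "y' \<in> V"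
        using L[OF T(1)] automorphism_d[OF T(2), of x0 y'] T(3) by (auto simp: graph_ball_def)
      moreover have "T y' \<in> V" using T(2) \<open>y' \<in> V\<close> by (auto simp: automorphism_def)
      ultimately show "y \<in> graph_ball V E x L" by (simp add: graph_ball_def y')
    qed
    moreover have "phi p x (T ` S x0) \<le> \<phi>" using automorphism_phi[OF T(2), of p x0 "S x0"] T \<phi>(3) by simp
    moreover have "finite (T ` S x0)" "x \<in> T ` S x0" using S[of x0] T V0(2) by auto
    ultimately show ?thesis by blast
  qed
  note decay = far_connection_decay[OF _ _ _ this]
  define \<beta> where "\<beta> = root (Suc L) \<phi>"
  have \<beta>: "0 < \<beta>" "\<beta> < 1" "\<beta> ^ Suc L = \<phi>"
    using \<phi> by (auto simp: \<beta>_def real_root_pow_pos2 simp del: power_Suc)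
  \<comment> \<open>The prefactor \<open>1 / \<phi>\<close> pays for rounding \<open>k\<close> down
    to a multiple of \<open>Suc L\<close>.\<close>
  have "cprob F (\<lambda>_. p) (\<lambda>\<omega>. \<exists>y. reach \<omega> x y \<and> k \<le> d x y) \<le> (1 / \<phi>) * \<beta> ^ k"
    if F: "x \<in> V" "finite F" "F \<subseteq> E" for x F k
  proof -
    let ?j = "k div Suc L"
    have j: "?j * Suc L \<le> k" "k \<le> Suc L * Suc ?j"
      using div_mult_mod_eq[of k "Suc L"] mod_less_divisor[of "Suc L" k] by (simp_all only: mult_Suc_right mult.commute) linarith+
    have "cprob F (\<lambda>_. p) (\<lambda>\<omega>. \<exists>y. reach \<omega> x y \<and> k \<le> d x y) \<le>
        cprob F (\<lambda>_. p) (\<lambda>\<omega>. \<exists>y. reach \<omega> x y \<and> ?j * Suc L \<le> d x y)"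
      using j(1) assms by (intro cprob_mono) (auto simp: weights_def intro: order_trans)
    also have "\<dots> \<le> \<phi> ^ ?j" using F assms \<phi> by (intro decay) auto
    also have "\<dots> = (1 / \<phi>) * \<phi> ^ Suc ?j" using \<phi> by simp
    also have "\<phi> ^ Suc ?j = \<beta> ^ (Suc L * Suc ?j)" using \<beta>(3) by (metis power_mult)
    also have "\<dots> \<le> \<beta> ^ k" using \<beta> j(2) by (intro power_decreasing) auto
    finally show ?thesis using \<phi> by (simp add: mult_left_mono divide_right_mono)
  qed
  then show ?thesis using \<beta> \<phi> by (intro exI[of _ \<beta>] exI[of _ "1 / \<phi>"]) auto
qed

end

subsection \<open>The zero-one law and barriers\<close>

context lfgraph
begin

lemma countable_V: "countable V"
proof (cases "V = {}")
  case False
  then obtain x where x: "x \<in> V" by blast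
  have "V = (\<Union>n. graph_ball V E x n)" by (auto simp: graph_ball_def)
  also have "countable \<dots>" using finite_ball[OF x] by (intro countable_UN) (auto intro: countable_finite)
  finally show ?thesis .
qed simp

text \<open>The measure may live on a smaller edge set \<open>E'\<close>, because the zero-one law
  needs the event in the product over \<open>E - J\<close>.\<close>

lemma sets_exits:
  assumes "E' \<subseteq> E" "F \<subseteq> E'" "weights E \<pi>" "x \<in> V"
  shows "{\<omega> \<in> space (bond_measure E' \<pi>). exits x (graph_ball V E x n) (open_edges F \<omega>)} \<in> sets (bond_measure E' \<pi>)"
proof -
  let ?B = "graph_ball V E x n"
  have eq: "open_edges F \<omega> \<inter> touching ?B = open_edges (F \<inter> touching ?B) \<omega>" for \<omega>
    by (auto simp: open_edges_def)
  have sub: "open_edges F \<omega> \<subseteq> E" for \<omega>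
    using subset_trans[OF open_edges_subset subset_trans[OF assms(2,1)]] .
  have "exits x ?B (open_edges F \<omega>) \<longleftrightarrow> exits x ?B (open_edges (F \<inter> touching ?B) \<omega>)" for \<omega>
    unfolding eq[symmetric] by (rule exits_touching[OF sub mem_ball[OF assms(4)], symmetric])
  moreover have "weights (F \<inter> touching ?B) \<pi>"
    using assms by (auto intro: weights_subset[OF assms(3)])
  ultimately show ?thesis
    using sets_cylinder[of "F \<inter> touching ?B" E' \<pi> "exits x ?B"] finite_ball[OF assms(4)] assms(2)
    by (simp add: finite_touching' le_infI1)
qed

lemma sets_infinite_cluster:
  assumes "E' \<subseteq> E" "F \<subseteq> E'" "weights E \<pi>"
  shows "{\<omega> \<in> space (bond_measure E' \<pi>). \<exists>x\<in>V. infinite {y. reach (open_edges F \<omega>) x y}} \<in> sets (bond_measure E' \<pi>)"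
proof -
  have sub: "open_edges F \<omega> \<subseteq> E" for \<omega>
    using subset_trans[OF open_edges_subset subset_trans[OF assms(2,1)]] .
  have "(\<exists>x\<in>V. infinite {y. reach (open_edges F \<omega>) x y}) \<longleftrightarrow>
      (\<exists>x\<in>V. \<forall>n. exits x (graph_ball V E x n) (open_edges F \<omega>))" for \<omega>
    by (rule bex_cong[OF refl]) (rule infinite_cluster_iff[OF sub])
  then have "{\<omega> \<in> space (bond_measure E' \<pi>). \<exists>x\<in>V. infinite {y. reach (open_edges F \<omega>) x y}} =
    {\<omega> \<in> space (bond_measure E' \<pi>). \<exists>x\<in>V. \<forall>n. exits x (graph_ball V E x n) (open_edges F \<omega>)}"
    by simp
  also have "\<dots> =
    (\<Union>x\<in>V. \<Inter>n. {\<omega> \<in> space (bond_measure E' \<pi>). exits x (graph_ball V E x n) (open_edges F \<omega>)})"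
    by blast
  also have "\<dots> \<in> sets (bond_measure E' \<pi>)"
    using assms by (intro sets.countable_UN'' countable_V sets.countable_INT image_subsetI sets_exits) auto
  finally show ?thesis .
qed

text \<open>An infinite cluster contains an injective ray. It visits the endpoints of each edge
  finitely often, so some tail of it avoids \<open>J\<close>; the starting vertex may
  change.\<close>

lemma infinite_cluster_remove_finite:
  assumes "\<omega> \<subseteq> E" "finite J" "x \<in> V" "infinite {y. reach \<omega> x y}"
  shows "\<exists>x\<in>V. infinite {y. reach (\<omega> - J) x y}"
proof -
  have "finite {w. {v, w} \<in> \<omega>}" for v
    by (rule finite_subset[OF _ finite_nbrs[of v]]) (use assms(1) in auto)
  from infinite_cluster_imp_ray[OF this assms(4)]
  obtain \<gamma> where \<gamma>: "\<gamma> 0 = x" "inj \<gamma>" "\<And>n. {\<gamma> n, \<gamma> (Suc n)} \<in> \<omega>" by blast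
  have "{n. {\<gamma> n, \<gamma> (Suc n)} \<in> J} \<subseteq> (\<Union>e\<in>J \<inter> E. \<gamma> -` e)"
    using \<gamma>(3) assms(1) by auto
  moreover have "finite (\<gamma> -` e)" if "e \<in> E" for e
  proof -
    have "finite e" using edges[OF that] by auto
    then show ?thesis by (rule finite_vimageI[OF _ \<gamma>(2)])
  qed
  ultimately have "finite {n. {\<gamma> n, \<gamma> (Suc n)} \<in> J}"
    using assms(2) by (meson finite_UN_I finite_Int finite_subset IntE)
  then obtain N where N: "\<And>n. {\<gamma> n, \<gamma> (Suc n)} \<in> J \<Longrightarrow> n < N"
    using finite_nat_set_iff_bounded by auto
  define \<gamma>' where "\<gamma>' n = \<gamma> (N + n)" for n
  have "{\<gamma>' n, \<gamma>' (Suc n)} \<in> \<omega> - J" for n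
    using N[of "N + n"] \<gamma>(3)[of "N + n"] by (auto simp: \<gamma>'_def)
  moreover have "inj \<gamma>'"
    using injD[OF \<gamma>(2)] by (intro injI) (fastforce simp: \<gamma>'_def)
  ultimately have "infinite {y. reach (\<omega> - J) (\<gamma>' 0) y}" by (intro ray_imp_infinite_cluster)
  moreover have "{\<gamma> N, \<gamma> (Suc N)} \<in> E" using \<gamma>(3) assms(1) by blast
  then have "\<gamma>' 0 \<in> V" using edge_V[of "\<gamma> N"] by (simp add: \<gamma>'_def)
  ultimately show ?thesis by blast
qed

text \<open>Existence of an infinite cluster somewhere is insensitive to finitely many edges,
  whereas an infinite cluster at a prescribed vertex is not.\<close>

lemma zero_one_infinite_cluster:
  assumes "weights E \<pi>"
  defines "X \<equiv> {\<omega> \<in> space (bond_measure E \<pi>). \<exists>x\<in>V. infinite {y. reach (open_edges E \<omega>) x y}}"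
  shows "measure (bond_measure E \<pi>) X = 0 \<or> measure (bond_measure E \<pi>) X = 1"
proof -
  interpret product_prob_space "\<lambda>e. measure_pmf (bernoulli_pmf (\<pi> e))" E
    by (rule product_prob_space_bond)
  have "prob X = 0 \<or> prob X = 1"
  proof (rule tail_zero_one)
    show "X \<in> events" unfolding X_def
      using sets_infinite_cluster[OF order_refl order_refl assms(1)] by (simp add: bond_measure_def)
    fix J assume J: "finite J" "J \<subseteq> E"
    let ?Y = "{\<omega> \<in> space (bond_measure (E - J) \<pi>). \<exists>x\<in>V. infinite {y. reach (open_edges (E - J) \<omega>) x y}}"
    have Y: "?Y \<in> sets (bond_measure (E - J) \<pi>)"
      using assms(1) by (intro sets_infinite_cluster) auto
    have oe: "open_edges (E - J) (restrict \<omega> (E - J)) = open_edges E \<omega> - J" for \<omega>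
      by (auto simp: open_edges_def)
    have "(\<exists>x\<in>V. infinite {y. reach (open_edges E \<omega>) x y}) \<longleftrightarrow> (\<exists>x\<in>V. infinite {y. reach (open_edges E \<omega> - J) x y})" for \<omega>
    proof
      assume "\<exists>x\<in>V. infinite {y. reach (open_edges E \<omega>) x y}"
      then show "\<exists>x\<in>V. infinite {y. reach (open_edges E \<omega> - J) x y}"
        using infinite_cluster_remove_finite[OF open_edges_subset J(1)] by blast
    next
      assume "\<exists>x\<in>V. infinite {y. reach (open_edges E \<omega> - J) x y}"
      then obtain x where "x \<in> V" "infinite {y. reach (open_edges E \<omega> - J) x y}" by blast
      moreover have "{y. reach (open_edges E \<omega> - J) x y} \<subseteq> {y. reach (open_edges E \<omega>) x y}"
        using reach_mono[of "open_edges E \<omega> - J" "open_edges E \<omega>"] by auto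
      ultimately show "\<exists>x\<in>V. infinite {y. reach (open_edges E \<omega>) x y}" using infinite_super by blast
    qed
    then have "X = {\<omega> \<in> space (bond_measure E \<pi>). restrict \<omega> (E - J) \<in> ?Y}"
      unfolding X_def by (auto simp: oe space_bond_measure)
    then show "\<exists>Y\<in>sets (Pi\<^sub>M (E - J) (\<lambda>e. measure_pmf (bernoulli_pmf (\<pi> e)))). X =
        {\<omega> \<in> space (Pi\<^sub>M E (\<lambda>e. measure_pmf (bernoulli_pmf (\<pi> e)))). restrict \<omega> (E - J) \<in> Y}"
      using Y unfolding bond_measure_def by blast
  qed
  then show ?thesis by (simp add: bond_measure_def)
qed

section \<open>Degree bounds and the probability of barriers\<close>

lemma bounded_degree:
  assumes "orbit_representatives V0"
  shows "\<exists>D. \<forall>v\<in>V. card {w. {v, w} \<in> E} \<le> D"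
proof (intro exI ballI)
  fix v assume "v \<in> V"
  then obtain x T where x: "x \<in> V0" "automorphism T" "T x = v"
    using assms unfolding orbit_representatives_def by blast
  have "{w. {v, w} \<in> E} = T ` {w. {x, w} \<in> E}"
  proof (intro equalityI subsetI)
    fix w assume w: "w \<in> {w. {v, w} \<in> E}"
    obtain w' where "w = T w'" using x(2) by (metis automorphism_def bij_pointE)
    then show "w \<in> T ` {w. {x, w} \<in> E}" using w x by (auto simp: automorphism_def)
  qed (use x in \<open>auto simp: automorphism_def\<close>)
  then have "card {w. {v, w} \<in> E} \<le> card {w. {x, w} \<in> E}"
    using finite_nbrs card_image_le by metis
  also have "\<dots> \<le> Max ((\<lambda>x. card {w. {x, w} \<in> E}) ` V0)"
    using assms x(1) by (auto simp: orbit_representatives_def)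
  finally show "card {w. {v, w} \<in> E} \<le> Max ((\<lambda>x. card {w. {x, w} \<in> E}) ` V0)" .
qed

lemma card_touching:
  assumes "finite B" "B \<subseteq> V" "\<And>v. v \<in> V \<Longrightarrow> card {w. {v, w} \<in> E} \<le> D"
  shows "card (touching B) \<le> card B * D"
proof -
  have "touching B \<subseteq> (\<Union>v\<in>B. (\<lambda>w. {v, w}) ` {w. {v, w} \<in> E})"
  proof
    fix e assume "e \<in> touching B"
    then obtain v where e: "e \<in> E" "v \<in> e" "v \<in> B" by (auto simp: touching_def)
    then obtain w where "e = {v, w}" using edges[OF e(1)] by auto
    then show "e \<in> (\<Union>v\<in>B. (\<lambda>w. {v, w}) ` {w. {v, w} \<in> E})" using e by blast
  qed
  then have "card (touching B) \<le> card (\<Union>v\<in>B. (\<lambda>w. {v, w}) ` {w. {v, w} \<in> E})"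
    using assms(1) finite_nbrs by (intro card_mono) auto
  also have "\<dots> \<le> (\<Sum>v\<in>B. card ((\<lambda>w. {v, w}) ` {w. {v, w} \<in> E}))"
    by (rule card_UN_le[OF assms(1)])
  also have "\<dots> \<le> (\<Sum>v\<in>B. D)"
    using assms finite_nbrs by (intro sum_mono order_trans[OF card_image_le]) auto
  finally show ?thesis by simp
qed

lemma exits_ball_iff:
  assumes "\<omega> \<subseteq> E" "x \<in> V"
  shows "exits x (graph_ball V E x n) \<omega> \<longleftrightarrow> (\<exists>y. reach \<omega> x y \<and> Suc n \<le> d x y)"
proof -
  have "y \<notin> graph_ball V E x n \<longleftrightarrow> Suc n \<le> d x y" if "reach \<omega> x y" for y
    using reach_V[OF that assms] by (auto simp: graph_ball_def)
  then show ?thesis by (auto simp: exits_def)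
qed

text \<open>Closing \<open>F\<close> only affects edges outside \<open>F\<close> through the \<open>Q\<close>-connections, so that both
  requirements below become independent up to a union bound; no correlation inequality is used.\<close>

lemma closed_no_exit_prob:
  fixes P :: "nat \<Rightarrow> 'b set" and D :: "nat \<Rightarrow> real"
  assumes w: "weights E \<pi>" and F: "finite F" "F \<subseteq> E" and Q: "Q \<subseteq> E" "\<And>e. e \<in> Q \<Longrightarrow> \<pi> e = p"
    and P: "\<And>j. finite (P j)" "\<And>j. P j \<subseteq> V"
    and decay: "\<And>x F n. x \<in> V \<Longrightarrow> finite F \<Longrightarrow> F \<subseteq> E \<Longrightarrow>
        cprob F (\<lambda>_. p) (\<lambda>\<omega>. \<exists>y. reach \<omega> x y \<and> n \<le> d x y) \<le> D n"
    and sum: "summable (\<lambda>j. card (P j) * D (Suc j))" "(\<Sum>j. card (P j) * D (Suc j)) \<le> 1 / 2"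
  defines "A \<equiv> {\<omega> \<in> space (bond_measure E \<pi>). (\<forall>e\<in>F. \<not> \<omega> e) \<and>
      (\<forall>j. \<forall>x\<in>P j. \<not> exits x (graph_ball V E x j) (open_edges Q \<omega>))}"
  shows "A \<in> sets (bond_measure E \<pi>)"
    and "(\<Prod>e\<in>F. 1 - \<pi> e) / 2 \<le> measure (bond_measure E \<pi>) A"
proof -
  let ?M = "bond_measure E \<pi>"
  let ?B = "\<lambda>x j. graph_ball V E x j"
  interpret prob_space ?M by (rule prob_space_bond_measure)
  define Cl where "Cl = {\<omega> \<in> space ?M. open_edges F \<omega> = {}}"
  have wF: "weights F' \<pi>" if "F' \<subseteq> E" for F' using weights_subset[OF w that] .
  have Cl: "Cl \<in> events" "prob Cl = (\<Prod>e\<in>F. 1 - \<pi> e)"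
    unfolding Cl_def using F wF
    by (auto simp: measure_cylinder[where A = "\<lambda>\<omega>. \<omega> = {}"] cprob_all_closed
        intro!: sets_cylinder[where A = "\<lambda>\<omega>. \<omega> = {}"])
  have sets: "{\<omega> \<in> space ?M. exits x (?B x j) (open_edges Q \<omega>)} \<in> events" if "x \<in> V" for x j
    using that Q(1) w by (intro sets_exits) auto
  have A: "A = Cl - (\<Union>j. \<Union>x\<in>P j. Cl \<inter> {\<omega> \<in> space ?M. exits x (?B x j) (open_edges Q \<omega>)})"
    by (auto simp: A_def Cl_def open_edges_def)
  let ?U = "\<lambda>j. \<Union>x\<in>P j. Cl \<inter> {\<omega> \<in> space ?M. exits x (?B x j) (open_edges Q \<omega>)}"
  have U: "?U j \<in> events" for j
    using P(1) Cl(1) sets[OF subsetD[OF P(2)]] by (intro sets.finite_UN sets.Int) auto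
  then show "A \<in> events" unfolding A using Cl(1) by (intro sets.Diff sets.countable_UN) auto
  have exit_prob: "prob (Cl \<inter> {\<omega> \<in> space ?M. exits x (?B x j) (open_edges Q \<omega>)}) \<le> prob Cl * D (Suc j)"
    if x: "x \<in> V" for x j
  proof -
    define F' where "F' = (Q - F) \<inter> touching (?B x j)"
    have F': "finite F'" "F' \<subseteq> E" "F' \<inter> F = {}" "F' \<subseteq> Q"
      using Q(1) finite_ball[OF x] by (auto simp: F'_def finite_touching')
    have oe: "open_edges Q \<omega> \<inter> touching (?B x j) = open_edges F' \<omega>" if "open_edges F \<omega> = {}" for \<omega>
      using that Q(1) by (auto simp: open_edges_def F'_def)
    have "exits x (?B x j) (open_edges Q \<omega>) \<longleftrightarrow> exits x (?B x j) (open_edges F' \<omega>)"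
      if "open_edges F \<omega> = {}" for \<omega>
      using exits_touching[OF subset_trans[OF open_edges_subset Q(1)] mem_ball[OF x]] oe[OF that] by metis
    moreover have "open_edges (F \<union> F') \<omega> \<inter> F = open_edges F \<omega>" "open_edges (F \<union> F') \<omega> \<inter> F' = open_edges F' \<omega>" for \<omega>
      by (auto simp: open_edges_def)
    ultimately have eq: "Cl \<inter> {\<omega> \<in> space ?M. exits x (?B x j) (open_edges Q \<omega>)} =
        {\<omega> \<in> space ?M. open_edges (F \<union> F') \<omega> \<inter> F = {} \<and> exits x (?B x j) (open_edges (F \<union> F') \<omega> \<inter> F')}"
      by (auto simp: Cl_def)
    have "prob (Cl \<inter> {\<omega> \<in> space ?M. exits x (?B x j) (open_edges Q \<omega>)}) =
        cprob (F \<union> F') \<pi> (\<lambda>\<omega>. \<omega> \<inter> F = {} \<and> exits x (?B x j) (\<omega> \<inter> F'))"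
      unfolding eq using F F' wF by (intro measure_cylinder[where A = "\<lambda>\<omega>. \<omega> \<inter> F = {} \<and> exits x (?B x j) (\<omega> \<inter> F')"]) auto
    also have "\<dots> = cprob F \<pi> (\<lambda>\<omega>. \<omega> = {}) * cprob F' \<pi> (exits x (?B x j))"
      using F F' by (intro cprob_Un) auto
    also have "cprob F' \<pi> (exits x (?B x j)) = cprob F' (\<lambda>_. p) (\<lambda>\<omega>. \<exists>y. reach \<omega> x y \<and> Suc j \<le> d x y)"
      using exits_ball_iff[OF subset_trans[OF _ F'(2)] x] F' Q(2) by (intro cprob_cong) auto
    also have "cprob F \<pi> (\<lambda>\<omega>. \<omega> = {}) = prob Cl" using Cl(2) F(1) by (simp add: cprob_all_closed)
    also have "prob Cl * cprob F' (\<lambda>_. p) (\<lambda>\<omega>. \<exists>y. reach \<omega> x y \<and> Suc j \<le> d x y) \<le> prob Cl * D (Suc j)"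
      using decay[OF x F'(1,2)] by (intro mult_left_mono) auto
    finally show ?thesis .
  qed
  have UD: "prob (?U j) \<le> prob Cl * (card (P j) * D (Suc j))" for j
  proof -
    have "prob (?U j) \<le> (\<Sum>x\<in>P j. prob (Cl \<inter> {\<omega> \<in> space ?M. exits x (?B x j) (open_edges Q \<omega>)}))"
      using P(1) Cl(1) sets[OF subsetD[OF P(2)]] by (intro finite_measure_subadditive_finite image_subsetI sets.Int) auto
    also have "\<dots> \<le> (\<Sum>x\<in>P j. prob Cl * D (Suc j))"
      using P(2) by (intro sum_mono exit_prob) auto
    finally show ?thesis by (simp add: mult_ac)
  qed
  have s: "summable (\<lambda>j. prob Cl * (card (P j) * D (Suc j)))" by (rule summable_mult[OF sum(1)])
  then have s': "summable (\<lambda>j. prob (?U j))"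
    by (rule summable_comparison_test'[where N = 0]) (use UD in simp)
  have "prob (\<Union>j. ?U j) \<le> (\<Sum>j. prob (?U j))"
    using U s' by (intro finite_measure_subadditive_countably) auto
  also have "\<dots> \<le> (\<Sum>j. prob Cl * (card (P j) * D (Suc j)))"
    using UD s s' by (intro suminf_le) auto
  also have "\<dots> = prob Cl * (\<Sum>j. card (P j) * D (Suc j))" by (rule suminf_mult[OF sum(1)])
  also have "\<dots> \<le> prob Cl * (1 / 2)" using sum(2) by (intro mult_left_mono) auto
  finally have "prob (\<Union>j. ?U j) \<le> prob Cl / 2" by simp
  moreover have "prob A = prob Cl - prob (\<Union>j. ?U j)"
    unfolding A
  proof (rule finite_measure_Diff)
    show "(\<Union>j. ?U j) \<in> events" using U by (intro sets.countable_UN) blast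
  qed (use Cl(1) in blast)+
  ultimately have "prob Cl / 2 \<le> prob A" by simp
  then show "(\<Prod>e\<in>F. 1 - \<pi> e) / 2 \<le> prob A" using Cl(2) by simp
qed

text \<open>An infinite \<open>Q\<close>-cluster leaves every ball, so its probability is at most
  \<open>D (Suc n)\<close> for every \<open>n\<close>. The application has
  \<open>Q = outer \<Lambda>\<close>.\<close>

lemma AE_no_infinite_cluster:
  assumes w: "weights E \<pi>" and Q: "Q \<subseteq> E" "\<And>e. e \<in> Q \<Longrightarrow> \<pi> e = p"
    and decay: "\<And>x F n. x \<in> V \<Longrightarrow> finite F \<Longrightarrow> F \<subseteq> E \<Longrightarrow>
        cprob F (\<lambda>_. p) (\<lambda>\<omega>. \<exists>y. reach \<omega> x y \<and> n \<le> d x y) \<le> D n"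
    and D: "D \<longlonglongrightarrow> 0"
  shows "AE \<omega> in bond_measure E \<pi>. \<forall>x\<in>V. finite {y. reach (open_edges Q \<omega>) x y}"
proof -
  let ?M = "bond_measure E \<pi>"
  let ?B = "\<lambda>x j. graph_ball V E x j"
  interpret prob_space ?M by (rule prob_space_bond_measure)
  have "AE \<omega> in ?M. finite {y. reach (open_edges Q \<omega>) x y}" if x: "x \<in> V" for x
  proof -
    let ?X = "{\<omega> \<in> space ?M. \<forall>n. exits x (?B x n) (open_edges Q \<omega>)}"
    have X: "?X = (\<Inter>n. {\<omega> \<in> space ?M. exits x (?B x n) (open_edges Q \<omega>)})" by auto
    have sets: "{\<omega> \<in> space ?M. exits x (?B x n) (open_edges Q \<omega>)} \<in> events" for n
      using x Q(1) w by (intro sets_exits) auto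
    then have "?X \<in> events" unfolding X by (intro sets.countable_INT) auto
    have "prob ?X \<le> D (Suc n)" for n
    proof -
      define F where "F = Q \<inter> touching (?B x n)"
      have F: "finite F" "F \<subseteq> E" "F \<subseteq> Q"
        using Q(1) finite_ball[OF x] by (auto simp: F_def finite_touching')
      have "open_edges Q \<omega> \<inter> touching (?B x n) = open_edges F \<omega>" for \<omega>
        by (auto simp: open_edges_def F_def)
      then have ex: "exits x (?B x n) (open_edges Q \<omega>) \<longleftrightarrow> exits x (?B x n) (open_edges F \<omega>)" for \<omega>
        using exits_touching[OF subset_trans[OF open_edges_subset Q(1)] mem_ball[OF x]] by metis
      have "prob ?X \<le> prob {\<omega> \<in> space ?M. exits x (?B x n) (open_edges F \<omega>)}"
        using sets[of n] unfolding ex[symmetric] by (intro finite_measure_mono) auto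
      also have "\<dots> = cprob F \<pi> (exits x (?B x n))"
        using F by (intro measure_cylinder weights_subset[OF w]) auto
      also have "\<dots> = cprob F (\<lambda>_. p) (\<lambda>\<omega>. \<exists>y. reach \<omega> x y \<and> Suc n \<le> d x y)"
        using exits_ball_iff[OF subset_trans[OF _ F(2)] x] F Q(2) by (intro cprob_cong) auto
      also have "\<dots> \<le> D (Suc n)" by (rule decay[OF x F(1,2)])
      finally show ?thesis .
    qed
    moreover have "(\<lambda>n. D (Suc n)) \<longlonglongrightarrow> 0" using D by (rule LIMSEQ_Suc)
    ultimately have "prob ?X \<le> 0" by (intro LIMSEQ_le_const) auto
    then have "prob ?X = 0" using measure_nonneg[of ?M ?X] by simp
    then have "AE \<omega> in ?M. \<omega> \<notin> ?X" using \<open>?X \<in> events\<close> by (simp add: prob_eq_0)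
    then show ?thesis
      using AE_space
    proof eventually_elim
      case (elim \<omega>)
      then show ?case
        using infinite_cluster_iff[OF subset_trans[OF open_edges_subset Q(1)] x, of \<omega>] by blast
    qed
  qed
  then show ?thesis using countable_V by (subst AE_ball_countable) auto
qed

end

subsection \<open>The product graph and the overlap region\<close>

lemma reach_segment:
  assumes "a \<le> b" "\<And>m. a \<le> m \<Longrightarrow> m < b \<Longrightarrow> {\<gamma> m, \<gamma> (Suc m)} \<in> \<omega>"
  shows "reach \<omega> (\<gamma> a) (\<gamma> b)"
  using assms
proof (induction b rule: dec_induct)
  case (step n)
  then have "reach \<omega> (\<gamma> a) (\<gamma> n)" "reach \<omega> (\<gamma> n) (\<gamma> (Suc n))" by (auto intro: reach_edge)
  then show ?case by (rule reach_trans)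
qed simp

lemma lfgraph_base:
  assumes "simple_graph V E" "connected_graph V E" "quasi_transitive V E"
  shows "lfgraph V E"
proof
  have sub: "E \<subseteq> nsets V 2" using assms(1) by (simp add: simple_graph_def)
  show *: "\<exists>x y. e = {x, y} \<and> x \<noteq> y \<and> x \<in> V \<and> y \<in> V" if "e \<in> E" for e
    using subsetD[OF sub that] by (auto simp: nsets_def card_2_iff)
  show "reach E x y" if "x \<in> V" "y \<in> V" for x y
    using assms(2) that by (auto simp: connected_graph_def reach_def)
  show "finite {w. {v, w} \<in> E}" for v
  proof (cases "v \<in> V")
    case True
    then show ?thesis using assms(3) by (auto simp: quasi_transitive_def locally_finite_graph_def)
  next
    case False
    then have "{w. {v, w} \<in> E} = {}" using * by (fastforce simp: doubleton_eq_iff)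
    then show ?thesis by (metis finite.emptyI)
  qed
qed

text \<open>Extend \<open>\<tau>\<close> by the identity off \<open>V\<close> and take the inverse,
  which reverses the direction of the map.\<close>

lemma (in lfgraph) automorphism_of_graph_automorphism:
  assumes "graph_automorphism V E \<tau>" "w \<in> V"
  shows "\<exists>T. automorphism T \<and> T (\<tau> w) = w"
proof -
  define \<sigma> where "\<sigma> v = (if v \<in> V then \<tau> v else v)" for v
  have "bij_betw \<tau> V V" using assms(1) by (simp add: graph_automorphism_def)
  then have 1: "bij_betw \<sigma> V V" by (subst bij_betw_cong[of V \<sigma> \<tau>]) (auto simp: \<sigma>_def)
  have 2: "bij_betw \<sigma> (- V) (- V)" by (subst bij_betw_cong[of _ \<sigma> id]) (auto simp: \<sigma>_def)
  have bij: "bij \<sigma>" using bij_betw_combine[OF 1 2] by simp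
  have E: "{\<sigma> u, \<sigma> v} \<in> E \<longleftrightarrow> {u, v} \<in> E" for u v
  proof (cases "u \<in> V \<and> v \<in> V")
    case True
    then show ?thesis using assms(1) by (auto simp: \<sigma>_def graph_automorphism_def)
  next
    case False
    moreover have "\<sigma> a \<in> V \<longleftrightarrow> a \<in> V" for a
      using 1 by (auto simp: \<sigma>_def bij_betw_def)
    ultimately show ?thesis using edge_V by blast
  qed
  have "automorphism (inv \<sigma>)"
    unfolding automorphism_def
  proof (intro conjI allI)
    show "bij (inv \<sigma>)" using bij by (rule bij_imp_bij_inv)
    show "inv \<sigma> ` V = V" using 1 bij by (metis bij_betw_def bij_is_inj image_inv_f_f)
    show "{inv \<sigma> u, inv \<sigma> v} \<in> E \<longleftrightarrow> {u, v} \<in> E" for u v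
      using E[of "inv \<sigma> u" "inv \<sigma> v"] bij by (simp add: surj_f_inv_f bij_is_surj)
  qed
  moreover have "inv \<sigma> (\<tau> w) = w"
    using bij assms(2) by (metis \<sigma>_def bij_is_inj inv_f_f)
  ultimately show ?thesis by blast
qed

lemma (in lfgraph) quasi_transitive_orbits:
  assumes "quasi_transitive V E"
  shows "\<exists>V0. orbit_representatives V0"
proof -
  obtain V0 where V0: "V0 \<subseteq> V" "finite V0" "\<forall>w\<in>V. \<exists>x\<in>V0. \<exists>\<tau>. graph_automorphism V E \<tau> \<and> \<tau> w = x"
    using assms by (auto simp: quasi_transitive_def)
  have "\<exists>x\<in>V0. \<exists>T. automorphism T \<and> T x = w" if w: "w \<in> V" for w
  proof -
    obtain x \<tau> where "x \<in> V0" "graph_automorphism V E \<tau>" "\<tau> w = x" using V0(3) w by blast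
    then show ?thesis
      using automorphism_of_graph_automorphism[OF _ w] by blast
  qed
  then show ?thesis using V0 unfolding orbit_representatives_def by blast
qed

context lfgraph
begin

lemma prod_edge_iff:
  "{(v, h), (w, k)} \<in> prod_int_edges V E \<longleftrightarrow>
     v \<in> V \<and> w \<in> V \<and> (v = w \<and> \<bar>h - k\<bar> = 1 \<or> {v, w} \<in> E \<and> h = k)"
  unfolding prod_int_edges_def by (fastforce simp: doubleton_eq_iff insert_commute)

lemma lfgraph_prod: "lfgraph (V \<times> UNIV) (prod_int_edges V E)"
proof
  let ?H = "prod_int_edges V E"
  show "\<exists>x y. e = {x, y} \<and> x \<noteq> y \<and> x \<in> V \<times> UNIV \<and> y \<in> V \<times> UNIV" if e: "e \<in> ?H" for e
  proof -
    obtain v h w k where e': "e = {(v, h), (w, k)}" using e unfolding prod_int_edges_def by blast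
    then have "v \<in> V \<and> w \<in> V \<and> (v = w \<and> \<bar>h - k\<bar> = 1 \<or> {v, w} \<in> E \<and> h = k)"
      using e prod_edge_iff by simp
    then have "(v, h) \<noteq> (w, k)" "v \<in> V" "w \<in> V" using edge_V by auto
    then show ?thesis using e' by blast
  qed
  show "finite {w. {v, w} \<in> ?H}" for v
  proof (rule finite_subset)
    show "{w. {v, w} \<in> ?H} \<subseteq> {fst v} \<times> {snd v - 1, snd v + 1} \<union> {w. {fst v, w} \<in> E} \<times> {snd v}"
      by (cases v) (auto simp: prod_edge_iff)
    show "finite ({fst v} \<times> {snd v - 1, snd v + 1} \<union> {w. {fst v, w} \<in> E} \<times> {snd v})"
      using finite_nbrs by simp
  qed
  have up: "reach ?H (v, h) (v, h + int n)" if "v \<in> V" for v h n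
  proof (induction n)
    case (Suc n)
    have "reach ?H (v, h + int n) (v, h + int (Suc n))"
      by (rule reach_edge) (use that in \<open>auto simp: prod_edge_iff\<close>)
    with Suc show ?case by (rule reach_trans)
  qed simp
  have vert: "reach ?H (v, h) (v, k)" if "v \<in> V" for v h k
  proof (cases "h \<le> k")
    case True
    then show ?thesis using up[OF that, of h "nat (k - h)"] by simp
  next
    case False
    then show ?thesis using up[OF that, of k "nat (h - k)"] by (simp add: reach_sym)
  qed
  have horiz: "reach E v w \<Longrightarrow> v \<in> V \<Longrightarrow> reach ?H (v, h) (w, h)" for v w h
    unfolding reach_def[of E]
  proof (induction rule: rtrancl_induct)
    case (step y z)
    then have "{y, z} \<in> E" by (simp add: adj_rel_def)
    then have "reach ?H (y, h) (z, h)" using edge_V by (intro reach_edge) (auto simp: prod_edge_iff)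
    with step show ?case using reach_trans by metis
  qed simp
  show "reach ?H x y" if "x \<in> V \<times> UNIV" "y \<in> V \<times> UNIV" for x y
  proof -
    obtain v h w k where xy: "x = (v, h)" "y = (w, k)" "v \<in> V" "w \<in> V"
      using \<open>x \<in> V \<times> UNIV\<close> \<open>y \<in> V \<times> UNIV\<close> by (cases x; cases y) auto
    show ?thesis
      unfolding xy(1,2) by (rule reach_trans[OF vert[OF xy(3)] horiz[OF connected[OF xy(3,4)] xy(3)]])
  qed
qed

end

locale cylinder_graph = lfgraph V E for V :: "'a set" and E :: "'a set set" +
  fixes z :: 'a
  assumes z_V: "z \<in> V"
begin

abbreviation VH :: "('a \<times> int) set" where "VH \<equiv> V \<times> UNIV"
abbreviation H :: "('a \<times> int) set set" where "H \<equiv> prod_int_edges V E"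

sublocale H: lfgraph VH H by (rule lfgraph_prod)

lemma H_automorphism:
  assumes "automorphism T"
  shows "H.automorphism (\<lambda>(v, h). (T v, h + c))"
  unfolding H.automorphism_def
proof (intro conjI allI)
  have T: "bij T" "T ` V = V" "\<And>u w. {T u, T w} \<in> E \<longleftrightarrow> {u, w} \<in> E"
    using assms by (auto simp: automorphism_def)
  have eq: "(\<lambda>(v, h). (T v, h + c)) = map_prod T (\<lambda>h. h + c)" by (auto simp: fun_eq_iff)
  show "bij (\<lambda>(v, h). (T v, h + c))"
    unfolding eq using T(1) by (intro bij_betw_map_prod[of _ UNIV UNIV _ UNIV UNIV, unfolded UNIV_Times_UNIV] bij_plus_right)
  show "(\<lambda>(v, h). (T v, h + c)) ` VH = VH"
    unfolding eq using T(2) by (subst map_prod_surj_on[of T V V "\<lambda>h. h + c" UNIV UNIV]) (auto simp: surj_plus_right)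
  have TV: "T v \<in> V \<longleftrightarrow> v \<in> V" for v
    using T(1,2) by (metis bij_is_inj inj_image_mem_iff)
  show "{(\<lambda>(v, h). (T v, h + c)) u, (\<lambda>(v, h). (T v, h + c)) w} \<in> H \<longleftrightarrow> {u, w} \<in> H" for u w
    using T(1) by (cases u; cases w) (simp add: prod_edge_iff T(3) TV bij_is_inj inj_eq)
qed

lemma H_orbits:
  assumes "quasi_transitive V E"
  shows "\<exists>V0. H.orbit_representatives V0"
proof -
  obtain V0 where V0: "finite V0" "V0 \<subseteq> V" "\<forall>w\<in>V. \<exists>x\<in>V0. \<exists>T. automorphism T \<and> T x = w"
    using quasi_transitive_orbits[OF assms] unfolding orbit_representatives_def by blast
  have "H.orbit_representatives (V0 \<times> {0})"
    unfolding H.orbit_representatives_def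
  proof (intro conjI ballI)
    fix w assume "w \<in> VH"
    then obtain v h where w: "w = (v, h)" "v \<in> V" by auto
    then obtain x T where x: "x \<in> V0" "automorphism T" "T x = v" using V0(3) by blast
    have "H.automorphism (\<lambda>(v, k). (T v, k + h))" by (rule H_automorphism[OF x(2)])
    then show "\<exists>x\<in>V0 \<times> {0}. \<exists>T. H.automorphism T \<and> T x = w"
      using x w by (intro bexI[of _ "(x, 0)"] exI[of _ "\<lambda>(v, k). (T v, k + h)"]) auto
  qed (use V0 in auto)
  then show ?thesis by blast
qed

section \<open>Heights and the cone at a good height\<close>

lemma height_le_d:
  assumes "x \<in> VH" "y \<in> VH"
  shows "\<bar>snd x - snd y\<bar> \<le> int (H.d x y)"
proof -
  have "(x, y) \<in> adj_rel H ^^ n \<Longrightarrow> \<bar>snd x - snd y\<bar> \<le> int n" for n y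
  proof (induction n arbitrary: y)
    case (Suc n)
    then obtain u where u: "(x, u) \<in> adj_rel H ^^ n" "{u, y} \<in> H" by (auto simp: adj_rel_def)
    then have "\<bar>snd u - snd y\<bar> \<le> 1" by (cases u; cases y) (auto simp: prod_edge_iff)
    with Suc.IH[OF u(1)] show ?case by simp
  qed simp
  then show ?thesis using H.relpow_d[OF assms] by blast
qed

text \<open>\<open>\<Lambda> (c + k) \<le> M + \<bar>k\<bar> / (2 * J)\<close>, so that \<open>1 / (2 * J)\<close> plays the role of \<open>\<epsilon>\<close>.\<close>

definition good :: "nat \<Rightarrow> nat \<Rightarrow> (int \<Rightarrow> nat) \<Rightarrow> int \<Rightarrow> bool" where
  "good J M \<Lambda> c \<longleftrightarrow> (\<forall>k. 2 * int J * int (\<Lambda> (c + k)) \<le> 2 * int J * int M + \<bar>k\<bar>)"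

abbreviation R :: "(int \<Rightarrow> nat) \<Rightarrow> ('a \<times> int) set" where
  "R \<equiv> overlap_region V E z"

text \<open>Around a good height \<open>c\<close> the region \<open>R \<Lambda>\<close> is confined to the double cone with the following
  horizontal sections.\<close>

definition slice :: "nat \<Rightarrow> nat \<Rightarrow> nat \<Rightarrow> 'a set" where
  "slice J M j = graph_ball V E z (2 * M + j div J)"

lemma R_slice:
  assumes "good J M \<Lambda> c" "0 < J" "(v, h) \<in> R \<Lambda>"
  shows "v \<in> slice J M (nat \<bar>h - c\<bar>)"
proof -
  obtain n where n: "v \<in> V" "d z v \<le> \<Lambda> n" "n - int (\<Lambda> n) \<le> h" "h \<le> n + int (\<Lambda> n)"
    using assms(3) by (auto simp: overlap_region_def overlap_box_def graph_ball_def)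
  define X where "X = int (\<Lambda> n)"
  \<comment> \<open>The centre \<open>n\<close> of the box may be farther from \<open>c\<close> than
    \<open>h\<close> is, by up to its own radius \<open>X\<close>. One of the two copies of
    \<open>J * X\<close> absorbs this extra \<open>X\<close>; the other gives the slope
    \<open>1 / J\<close> and the constant \<open>2 * M\<close> of \<open>slice\<close>.\<close>
  have "2 * (int J * X) \<le> 2 * (int J * int M) + \<bar>n - c\<bar>"
    using assms(1) unfolding good_def X_def by (metis add_diff_cancel_left' add.commute diff_add_cancel mult.assoc)
  moreover have "\<bar>n - c\<bar> \<le> \<bar>h - c\<bar> + X" using n by (simp add: X_def)
  moreover have "1 * X \<le> int J * X" using assms(2) by (intro mult_right_mono) (auto simp: X_def)
  moreover have "int J * int (d z v) \<le> int J * X" using n(2) by (intro mult_left_mono) (auto simp: X_def)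
  ultimately have "int J * int (d z v) \<le> int J * (2 * int M) + \<bar>h - c\<bar>" by linarith
  then have "int (J * d z v) \<le> int (J * (2 * M) + nat \<bar>h - c\<bar>)" by simp
  then have "J * d z v \<le> J * (2 * M) + nat \<bar>h - c\<bar>" by (simp only: of_nat_le_iff)
  then have "(J * d z v) div J \<le> (J * (2 * M) + nat \<bar>h - c\<bar>) div J" by (rule div_le_mono)
  then have "d z v \<le> 2 * M + nat \<bar>h - c\<bar> div J" using assms(2) by simp
  then show ?thesis using n(1) by (simp add: slice_def graph_ball_def)
qed

lemma finite_slice: "finite (slice J M j)"
  unfolding slice_def by (rule finite_ball[OF z_V])

lemma slice_subset: "slice J M j \<subseteq> V"
  by (auto simp: slice_def graph_ball_def)

lemma finite_R_between:
  assumes "good J M \<Lambda> c" "0 < J"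
  shows "finite {x \<in> R \<Lambda>. a \<le> snd x \<and> snd x \<le> b}"
proof (rule finite_subset)
  show "{x \<in> R \<Lambda>. a \<le> snd x \<and> snd x \<le> b} \<subseteq> (\<Union>h\<in>{a..b}. slice J M (nat \<bar>h - c\<bar>) \<times> {h})"
    using R_slice[OF assms] by auto
  show "finite (\<Union>h\<in>{a..b}. slice J M (nat \<bar>h - c\<bar>) \<times> {h})"
    using finite_slice by auto
qed

text \<open>The section of the cone at vertical distance \<open>j\<close> from the apex, on the side
  from which the crossing is to be prevented: below \<open>c\<close> for \<open>s = 1\<close>, above
  \<open>c\<close> for \<open>s = -1\<close>.\<close>

definition level :: "nat \<Rightarrow> nat \<Rightarrow> int \<Rightarrow> int \<Rightarrow> nat \<Rightarrow> ('a \<times> int) set" where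
  "level J M s c j = slice J M j \<times> {c - s * int j}"

text \<open>An edge needs only one endpoint outside the region to be in here. These are exactly the
  edges with parameter \<open>p\<close>.\<close>

definition outer :: "(int \<Rightarrow> nat) \<Rightarrow> ('a \<times> int) set set" where
  "outer \<Lambda> = {e \<in> H. \<not> e \<subseteq> R \<Lambda>}"

text \<open>Let \<open>b\<close> be the first time after \<open>i0\<close> at which the ray is in
  \<open>R \<Lambda>\<close> on the far side of \<open>c\<close>, and \<open>a\<close> the last
  visit to \<open>R \<Lambda>\<close> before \<open>b\<close>. Then \<open>\<gamma> a\<close> lies
  in some level \<open>j\<close> on the near side. If \<open>j < T\<close>, the edge following
  \<open>\<gamma> a\<close> is closed. Otherwise the ray runs from \<open>\<gamma> a\<close> to
  \<open>\<gamma> b\<close> along \<open>outer\<close> edges and changes its height by more than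
  \<open>j\<close>, so it leaves the ball of radius \<open>j\<close> around
  \<open>\<gamma> a\<close>.\<close>

lemma no_crossing:
  assumes good: "good J M \<Lambda> c" "0 < J" and s: "s = 1 \<or> s = -1" and T: "0 < T" and "\<omega> \<subseteq> H"
    and closed: "\<And>j. j < T \<Longrightarrow> \<omega> \<inter> H.touching (level J M s c j) = {}"
    and far: "\<And>j x. T \<le> j \<Longrightarrow> x \<in> level J M s c j \<Longrightarrow>
        \<not> H.exits x (graph_ball VH H x j) (\<omega> \<inter> outer \<Lambda>)"
    and ray: "\<And>n. {\<gamma> n, \<gamma> (Suc n)} \<in> \<omega>"
    and start: "\<gamma> i0 \<in> R \<Lambda>" "s * snd (\<gamma> i0) \<le> s * c"
    and i: "i0 \<le> i" "\<gamma> i \<in> R \<Lambda>"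
  shows "s * snd (\<gamma> i) \<le> s * c"
proof (rule ccontr)
  assume "\<not> s * snd (\<gamma> i) \<le> s * c"
  define Q where "Q j \<longleftrightarrow> i0 \<le> j \<and> \<gamma> j \<in> R \<Lambda> \<and> \<not> s * snd (\<gamma> j) \<le> s * c" for j
  have "Q i" using i \<open>\<not> s * snd (\<gamma> i) \<le> s * c\<close> by (simp add: Q_def)
  define b where "b = (LEAST j. Q j)"
  have b: "Q b" "\<And>j. j < b \<Longrightarrow> \<not> Q j"
    unfolding b_def using LeastI[of Q, OF \<open>Q i\<close>] not_less_Least by auto
  have "i0 < b" using b(1) start by (metis Q_def le_neq_implies_less)
  define W where "W = {a \<in> {i0..<b}. \<gamma> a \<in> R \<Lambda>}"
  have "finite W" "i0 \<in> W" using \<open>i0 < b\<close> start by (auto simp: W_def)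
  define a where "a = Max W"
  have aW: "a \<in> W" using Max_in \<open>finite W\<close> \<open>i0 \<in> W\<close> unfolding a_def by blast
  have a_max: "m \<le> a" if "m \<in> W" for m using \<open>finite W\<close> that by (simp add: a_def)
  have a: "i0 \<le> a" "a < b" "\<gamma> a \<in> R \<Lambda>" using aW by (auto simp: W_def)
  have a_low: "s * snd (\<gamma> a) \<le> s * c" using b(2)[OF a(2)] a by (simp add: Q_def)
  have between: "\<gamma> m \<notin> R \<Lambda>" if "a < m" "m < b" for m
    using a_max[of m] that a by (auto simp: W_def)
  define j where "j = nat (s * (c - snd (\<gamma> a)))"
  have j: "int j = s * (c - snd (\<gamma> a))" using a_low by (simp add: j_def right_diff_distrib)
  have "nat \<bar>snd (\<gamma> a) - c\<bar> = j" using s j by auto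
  moreover have "snd (\<gamma> a) = c - s * int j" using s j by auto
  ultimately have lev: "\<gamma> a \<in> level J M s c j"
    using R_slice[OF good, of "fst (\<gamma> a)" "snd (\<gamma> a)"] a(3)
    by (cases "\<gamma> a") (simp add: level_def)
  have ray_H: "{\<gamma> n, \<gamma> (Suc n)} \<in> H" for n using ray assms(5) by blast
  have V: "\<gamma> n \<in> VH" for n using H.edge_V[OF ray_H[of n]] by blast
  show False
  proof (cases "j < T")
    case True
    have "{\<gamma> a, \<gamma> (Suc a)} \<in> \<omega> \<inter> H.touching (level J M s c j)"
      using ray[of a] ray_H[of a] lev by (auto simp: H.touching_def)
    then show False using closed[OF True] by blast
  next
    case False
    have "s * snd (\<gamma> b) \<ge> s * c + 1" using b(1) by (simp add: Q_def)
    then have "int j + 1 \<le> s * snd (\<gamma> b) - s * snd (\<gamma> a)" using j by (simp add: right_diff_distrib)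
    also have "\<dots> \<le> \<bar>snd (\<gamma> a) - snd (\<gamma> b)\<bar>" using s by auto
    also have "\<dots> \<le> int (H.d (\<gamma> a) (\<gamma> b))" by (rule height_le_d[OF V V])
    finally have d: "Suc j \<le> H.d (\<gamma> a) (\<gamma> b)" by simp
    \<comment> \<open>This excludes a crossing by a single edge with both endpoints in
      \<open>R \<Lambda>\<close>. Such an edge would start in level 0, which is closed since
      \<open>0 < T\<close>; here \<open>j > 0\<close>, and one step cannot change the height by
      \<open>Suc j\<close>.\<close>
    have "b \<noteq> Suc a"
    proof
      assume "b = Suc a"
      then show False using H.d_edge[OF ray_H[of a]] d False T by simp
    qed
    then have ab: "Suc a < b" using a(2) by simp
    have "reach (\<omega> \<inter> outer \<Lambda>) (\<gamma> a) (\<gamma> b)"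
    proof (rule reach_segment)
      fix m assume m: "a \<le> m" "m < b"
      have "\<not> {\<gamma> m, \<gamma> (Suc m)} \<subseteq> R \<Lambda>"
        using between[of m] between[of "Suc m"] m ab by (cases "m = a") auto
      then show "{\<gamma> m, \<gamma> (Suc m)} \<in> \<omega> \<inter> outer \<Lambda>" using ray ray_H by (simp add: outer_def)
    qed (use a in simp)
    moreover have "\<gamma> b \<notin> graph_ball VH H (\<gamma> a) j" using d by (simp add: graph_ball_def)
    ultimately have "H.exits (\<gamma> a) (graph_ball VH H (\<gamma> a) j) (\<omega> \<inter> outer \<Lambda>)"
      unfolding H.exits_def by blast
    then show False using far[OF _ lev] False by simp
  qed
qed

end

subsection \<open>Quenched absence of percolation\<close>

lemma summable_tail_le:
  fixes f :: "nat \<Rightarrow> real"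
  assumes "summable f" "0 < r"
  obtains T where "0 < T" "summable (\<lambda>j. if j < T then 0 else f j)"
    "(\<Sum>j. if j < T then 0 else f j) \<le> r"
proof -
  obtain N where N: "\<And>n. N \<le> n \<Longrightarrow> norm (\<Sum>i. f (i + n)) < r"
    using suminf_exist_split[OF assms(2,1)] by blast
  let ?T = "Suc N" and ?g = "\<lambda>j. if j < Suc N then 0 else f j"
  have "summable (\<lambda>i. ?g (i + ?T))" using summable_ignore_initial_segment[OF assms(1), of ?T] by simp
  then have g: "summable ?g" using summable_iff_shift[of ?g ?T] by blast
  have "suminf ?g = (\<Sum>i. ?g (i + ?T)) + (\<Sum>i<?T. ?g i)"
    by (rule suminf_split_initial_segment[OF g])
  also have "\<dots> = (\<Sum>i. f (i + ?T))" by simp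
  also have "\<dots> \<le> r" using N[of ?T] by (simp add: abs_le_iff)
  finally show ?thesis using that[of ?T] g by simp
qed

text \<open>Continuity from above. It serves twice, for barriers at different heights and for good
  heights; in both cases the events are dependent.\<close>

lemma (in prob_space) prob_limsup_ge:
  fixes A :: "nat \<Rightarrow> 'a set"
  assumes "\<And>n. A n \<in> events" "\<And>n. c \<le> prob (A n)"
  shows "c \<le> prob (\<Inter>m. \<Union>n\<in>{m..}. A n)"
proof (rule LIMSEQ_le_const)
  show "(\<lambda>m. prob (\<Union>n\<in>{m..}. A n)) \<longlonglongrightarrow> prob (\<Inter>m. \<Union>n\<in>{m..}. A n)"
  proof (rule finite_Lim_measure_decseq)
    show "decseq (\<lambda>m. \<Union>n\<in>{m..}. A n)" by (fastforce simp: decseq_def)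
  qed (use assms(1) in auto)
  have "prob (A m) \<le> prob (\<Union>n\<in>{m..}. A n)" for m
    using assms(1) by (intro finite_measure_mono) auto
  then show "\<exists>N. \<forall>m\<ge>N. c \<le> prob (\<Union>n\<in>{m..}. A n)" using assms(2) order_trans by blast
qed

context cylinder_graph
begin

lemma card_level: "card (level J M s c j) = card (slice J M j)"
  by (simp add: level_def card_cartesian_product)

lemma level_subset: "level J M s c j \<subseteq> VH"
  using slice_subset by (auto simp: level_def)

lemma finite_level: "finite (level J M s c j)"
  by (simp add: level_def finite_slice)

definition barrier :: "nat \<Rightarrow> nat \<Rightarrow> int \<Rightarrow> int \<Rightarrow> nat \<Rightarrow> ('a \<times> int) set" where
  "barrier J M c c' j = level J M 1 c j \<union> level J M (-1) c' j"

text \<open>After \<open>i0\<close> the ray can meet \<open>R \<Lambda>\<close> only at heights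
  between \<open>c'\<close> and \<open>c\<close>, where the region is finite. Being injective, it
  stays outside \<open>R \<Lambda>\<close> from some time on and would give an infinite cluster of
  \<open>outer\<close> edges.\<close>

lemma no_infinite_cluster_between_barriers:
  assumes good: "good J M \<Lambda> c" "good J M \<Lambda> c'" "0 < J" and T: "0 < T" and "\<omega> \<subseteq> H"
    and closed: "\<omega> \<inter> H.touching (\<Union>j<T. barrier J M c c' j) = {}"
    and far: "\<And>j x. T \<le> j \<Longrightarrow> x \<in> barrier J M c c' j \<Longrightarrow>
        \<not> H.exits x (graph_ball VH H x j) (\<omega> \<inter> outer \<Lambda>)"
    and ray: "\<And>n. {\<gamma> n, \<gamma> (Suc n)} \<in> \<omega>" "inj \<gamma>"
    and fin: "\<And>x. x \<in> VH \<Longrightarrow> finite {y. reach (\<omega> \<inter> outer \<Lambda>) x y}"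
    and start: "\<gamma> i0 \<in> R \<Lambda>" "snd (\<gamma> i0) \<le> c" "c' \<le> snd (\<gamma> i0)"
  shows False
proof -
  have sub: "level J M 1 c j \<subseteq> barrier J M c c' j" "level J M (-1) c' j \<subseteq> barrier J M c c' j" for j
    by (auto simp: barrier_def)
  have cl: "\<omega> \<inter> H.touching B = {}" if "j < T" "B \<subseteq> barrier J M c c' j" for j B
    using closed that by (fastforce simp: H.touching_def)
  have "c' \<le> snd (\<gamma> i) \<and> snd (\<gamma> i) \<le> c" if "i0 \<le> i" "\<gamma> i \<in> R \<Lambda>" for i
  proof -
    have "1 * snd (\<gamma> i) \<le> 1 * c"
    proof (rule no_crossing[OF good(1,3) _ T assms(5) _ _ ray(1) start(1) _ that])
      show "\<omega> \<inter> H.touching (level J M 1 c j) = {}" if "j < T" for j using cl[OF that sub(1)] .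
      show "\<not> H.exits x (graph_ball VH H x j) (\<omega> \<inter> outer \<Lambda>)" if "T \<le> j" "x \<in> level J M 1 c j" for j x
        using far that sub by blast
    qed (use start in auto)
    moreover have "(-1) * snd (\<gamma> i) \<le> (-1) * c'"
    proof (rule no_crossing[OF good(2,3) _ T assms(5) _ _ ray(1) start(1) _ that])
      show "\<omega> \<inter> H.touching (level J M (-1) c' j) = {}" if "j < T" for j using cl[OF that sub(2)] .
      show "\<not> H.exits x (graph_ball VH H x j) (\<omega> \<inter> outer \<Lambda>)" if "T \<le> j" "x \<in> level J M (-1) c' j" for j x
        using far that sub by blast
    qed (use start in auto)
    ultimately show ?thesis by simp
  qed
  then have "\<gamma> ` {i. i0 \<le> i \<and> \<gamma> i \<in> R \<Lambda>} \<subseteq> {x \<in> R \<Lambda>. c' \<le> snd x \<and> snd x \<le> c}" by auto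
  then have "finite (\<gamma> ` {i. i0 \<le> i \<and> \<gamma> i \<in> R \<Lambda>})"
    using finite_R_between[OF good(1,3)] finite_subset by blast
  then have "finite {i. i0 \<le> i \<and> \<gamma> i \<in> R \<Lambda>}"
    using ray(2) by (simp add: finite_image_iff inj_on_subset)
  then obtain N where N: "\<And>i. i0 \<le> i \<Longrightarrow> \<gamma> i \<in> R \<Lambda> \<Longrightarrow> i < N"
    using finite_nat_set_iff_bounded by auto
  define \<gamma>' where "\<gamma>' n = \<gamma> (i0 + N + n)" for n
  have notR: "\<gamma>' n \<notin> R \<Lambda>" for n using N[of "i0 + N + n"] by (auto simp: \<gamma>'_def)
  have "{\<gamma>' n, \<gamma>' (Suc n)} \<in> \<omega>" for n using ray(1)[of "i0 + N + n"] by (simp add: \<gamma>'_def)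
  then have "{\<gamma>' n, \<gamma>' (Suc n)} \<in> \<omega> \<inter> outer \<Lambda>" for n
    using notR[of n] assms(5) unfolding outer_def by blast
  moreover have "inj \<gamma>'"
    using injD[OF ray(2)] by (intro injI) (fastforce simp: \<gamma>'_def)
  ultimately have "infinite {y. reach (\<omega> \<inter> outer \<Lambda>) (\<gamma>' 0) y}" by (intro ray_imp_infinite_cluster)
  moreover have "{\<gamma> (i0 + N), \<gamma> (Suc (i0 + N))} \<in> H" using ray(1) assms(5) by blast
  from H.edge_V[OF this] have "\<gamma>' 0 \<in> VH" unfolding \<gamma>'_def add_0_right by (rule conjunct1)
  from fin[OF this] have "finite {y. reach (\<omega> \<inter> outer \<Lambda>) (\<gamma>' 0) y}" .
  ultimately show False by (rule notE)
qed

lemma ray_meets_R: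
  assumes "\<omega> \<subseteq> H" and ray: "\<And>n. {\<gamma> n, \<gamma> (Suc n)} \<in> \<omega>" "inj \<gamma>"
    and fin: "\<And>x. x \<in> VH \<Longrightarrow> finite {y. reach (\<omega> \<inter> outer \<Lambda>) x y}"
  obtains i where "\<gamma> i \<in> R \<Lambda>"
proof (rule ccontr)
  assume "\<not> thesis"
  then have "\<gamma> n \<notin> R \<Lambda>" for n using that by blast
  then have "{\<gamma> n, \<gamma> (Suc n)} \<in> \<omega> \<inter> outer \<Lambda>" for n
    using ray(1)[of n] assms(1) unfolding outer_def by blast
  from ray_imp_infinite_cluster[OF ray(2) this] have "infinite {y. reach (\<omega> \<inter> outer \<Lambda>) (\<gamma> 0) y}" .
  moreover have "{\<gamma> 0, \<gamma> (Suc 0)} \<in> H" using ray(1) assms(1) by blast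
  from H.edge_V[OF this] have "\<gamma> 0 \<in> VH" by (rule conjunct1)
  from fin[OF this] have "finite {y. reach (\<omega> \<inter> outer \<Lambda>) (\<gamma> 0) y}" .
  ultimately show False by (rule notE)
qed

text \<open>Split \<open>\<beta> ^ j\<close> into two factors \<open>sqrt \<beta> ^ j\<close>. By
  the choice of \<open>J\<close>, one of them pays for the growth
  \<open>\<Delta> ^ (j div J)\<close> of the section; the other remains and is summable over
  \<open>j\<close>.\<close>

lemma slice_decay_bound:
  fixes \<beta> :: real
  assumes \<beta>: "0 < \<beta>" "\<beta> < 1" and \<Delta>: "real \<Delta> * sqrt \<beta> ^ J \<le> 1" "0 < J"
    and ball: "\<And>r. card (graph_ball V E z r) \<le> \<Delta> ^ r"
  shows "card (slice J M j) * \<beta> ^ Suc j \<le> real \<Delta> ^ (2 * M) * sqrt \<beta> ^ j"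
proof -
  let ?g = "sqrt \<beta>"
  have g: "0 < ?g" "?g \<le> 1" "\<beta> = ?g * ?g" using \<beta> by auto
  have "real (card (slice J M j)) \<le> real (\<Delta> ^ (2 * M + j div J))"
    unfolding slice_def using ball by (simp only: of_nat_le_iff)
  then have "card (slice J M j) * \<beta> ^ Suc j \<le> real \<Delta> ^ (2 * M + j div J) * \<beta> ^ Suc j"
    using \<beta> by (intro mult_right_mono) auto
  also have "\<dots> \<le> real \<Delta> ^ (2 * M + j div J) * \<beta> ^ j"
    using \<beta> by (intro mult_left_mono power_decreasing) auto
  also have "\<dots> = real \<Delta> ^ (2 * M) * (real \<Delta> ^ (j div J) * ?g ^ j) * ?g ^ j"
  proof -
    have "\<beta> ^ j = ?g ^ j * ?g ^ j" using g(3) power_mult_distrib by metis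
    then show ?thesis by (simp add: power_add)
  qed
  also have "\<dots> \<le> real \<Delta> ^ (2 * M) * 1 * ?g ^ j"
  proof (intro mult_right_mono mult_left_mono)
    have "real \<Delta> ^ (j div J) * ?g ^ j \<le> real \<Delta> ^ (j div J) * ?g ^ (J * (j div J))"
      using g by (intro mult_left_mono power_decreasing) auto
    also have "\<dots> = (real \<Delta> * ?g ^ J) ^ (j div J)" by (simp add: power_mult_distrib power_mult)
    also have "\<dots> \<le> 1" using \<Delta> g by (intro power_le_one) auto
    finally show "real \<Delta> ^ (j div J) * ?g ^ j \<le> 1" .
  qed (use g in auto)
  finally show ?thesis by simp
qed

text \<open>The statement for a fixed environment. \<open>M\<close> and \<open>J\<close> do not vary
  with the good height, so one constant \<open>r ^ N / 2\<close> bounds the probability of every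
  pair of barriers from below.\<close>

lemma quenched_zero:
  fixes p q C \<beta> :: real and D \<Delta> J M :: nat
  assumes pq: "0 \<le> p" "p < 1" "0 \<le> q" "q < 1"
    and \<beta>: "0 < \<beta>" "\<beta> < 1" and C: "0 \<le> C"
    and decay: "\<And>x F k. x \<in> VH \<Longrightarrow> finite F \<Longrightarrow> F \<subseteq> H \<Longrightarrow>
        cprob F (\<lambda>_. p) (\<lambda>\<omega>. \<exists>y. reach \<omega> x y \<and> k \<le> H.d x y) \<le> C * \<beta> ^ k"
    and D: "\<And>v. v \<in> VH \<Longrightarrow> card {w. {v, w} \<in> H} \<le> D"
    and \<Delta>: "1 \<le> \<Delta>" "real \<Delta> * sqrt \<beta> ^ J \<le> 1" "0 < J"
    and ball: "\<And>r. card (graph_ball V E z r) \<le> \<Delta> ^ r"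
    and good_up: "\<And>n::int. \<exists>c>n. good J M \<Lambda> c" and good_down: "\<And>n::int. \<exists>c<n. good J M \<Lambda> c"
  shows "theta_overlap V E z \<Lambda> p q = 0"
proof -
  define \<pi> where "\<pi> e = (if e \<subseteq> R \<Lambda> then q else p)" for e
  let ?M = "bond_measure H \<pi>"
  interpret prob_space ?M by (rule prob_space_bond_measure)
  have w: "weights H \<pi>" using pq by (auto simp: weights_def \<pi>_def)
  have outer: "outer \<Lambda> \<subseteq> H" "\<And>e. e \<in> outer \<Lambda> \<Longrightarrow> \<pi> e = p" by (auto simp: outer_def \<pi>_def)
  let ?K = "2 * C * real \<Delta> ^ (2 * M)"
  have bound: "card (barrier J M c c' j) * (C * \<beta> ^ Suc j) \<le> ?K * sqrt \<beta> ^ j" for c c' j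
  proof -
    have "card (barrier J M c c' j) \<le> card (level J M 1 c j) + card (level J M (-1) c' j)"
      unfolding barrier_def by (rule card_Un_le)
    also have "\<dots> = 2 * card (slice J M j)" by (simp add: card_level)
    finally have "real (card (barrier J M c c' j)) \<le> 2 * real (card (slice J M j))" by linarith
    then have "card (barrier J M c c' j) * (C * \<beta> ^ Suc j) \<le> 2 * real (card (slice J M j)) * (C * \<beta> ^ Suc j)"
      using C \<beta> by (intro mult_right_mono) auto
    also have "\<dots> = 2 * C * (card (slice J M j) * \<beta> ^ Suc j)" by simp
    also have "\<dots> \<le> 2 * C * (real \<Delta> ^ (2 * M) * sqrt \<beta> ^ j)"
      using C slice_decay_bound[OF \<beta> \<Delta>(2,3) ball] by (intro mult_left_mono) auto
    finally show ?thesis by simp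
  qed
  have "summable (\<lambda>j. ?K * sqrt \<beta> ^ j)"
    using \<beta> by (intro summable_mult summable_geometric) auto
  \<comment> \<open>Within distance \<open>T\<close> of the apex all edges at the sections are
    closed. From \<open>T\<close> on, the expected number of vertices with a long
    \<open>outer\<close> connection is at most 1/2, which leaves half of the probability of the
    closing event.\<close>
  then obtain T where T: "0 < T" "summable (\<lambda>j. if j < T then 0 else ?K * sqrt \<beta> ^ j)"
      "(\<Sum>j. if j < T then 0 else ?K * sqrt \<beta> ^ j) \<le> 1 / 2"
    by (rule summable_tail_le[of "\<lambda>j. ?K * sqrt \<beta> ^ j" "1/2"]) simp
  define r where "r = 1 - max p q"
  have r: "0 < r" "r \<le> 1" using pq by (simp_all add: r_def max_def)
  have r\<pi>: "r \<le> 1 - \<pi> e" for e by (simp add: r_def \<pi>_def)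
  \<comment> \<open>For each \<open>j\<close> there are two sections with at most
    \<open>\<Delta> ^ (2 * M + j div J)\<close> vertices each, and every vertex has degree at most
    \<open>D\<close>. The bound is independent of the two heights.\<close>
  define N where "N = (\<Sum>j<T. 2 * \<Delta> ^ (2 * M + j div J)) * D"
  define near where "near c c' = H.touching (\<Union>j<T. barrier J M c c' j)" for c c'
  have fin_barrier: "finite (barrier J M c c' j)" "barrier J M c c' j \<subseteq> VH" for c c' j
    using finite_level level_subset by (auto simp: barrier_def)
  have near: "finite (near c c')" "near c c' \<subseteq> H" "card (near c c') \<le> N" for c c'
  proof -
    show "finite (near c c')" using fin_barrier by (simp add: near_def H.finite_touching')
    show "near c c' \<subseteq> H" unfolding near_def by (rule H.touching_subset)
    have "card (near c c') \<le> card (\<Union>j<T. barrier J M c c' j) * D"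
      unfolding near_def by (intro H.card_touching D finite_UN_I fin_barrier UN_least) auto
    also have "card (\<Union>j<T. barrier J M c c' j) \<le> (\<Sum>j<T. card (barrier J M c c' j))"
      by (rule card_UN_le) simp
    also have "\<dots> \<le> (\<Sum>j<T. 2 * \<Delta> ^ (2 * M + j div J))"
    proof (rule sum_mono)
      fix j
      have "card (barrier J M c c' j) \<le> card (level J M 1 c j) + card (level J M (-1) c' j)"
        unfolding barrier_def by (rule card_Un_le)
      then show "card (barrier J M c c' j) \<le> 2 * \<Delta> ^ (2 * M + j div J)"
        using ball[of "2 * M + j div J"] by (simp add: card_level slice_def)
    qed
    finally show "card (near c c') \<le> N" by (simp add: N_def)
  qed
  define P where "P c c' j = (if j < T then {} else barrier J M c c' j)" for c c' j
  define A where "A c c' = {\<omega> \<in> space ?M. (\<forall>e\<in>near c c'. \<not> \<omega> e) \<and>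
      (\<forall>j. \<forall>x\<in>P c c' j. \<not> H.exits x (graph_ball VH H x j) (open_edges (outer \<Lambda>) \<omega>))}" for c c'
  have A: "A c c' \<in> events" "r ^ N / 2 \<le> prob (A c c')" for c c'
  proof -
    have le: "card (P c c' j) * (C * \<beta> ^ Suc j) \<le> (if j < T then 0 else ?K * sqrt \<beta> ^ j)" for j
      using bound[of c c' j] by (simp add: P_def)
    have s: "summable (\<lambda>j. card (P c c' j) * (C * \<beta> ^ Suc j))"
      by (rule summable_comparison_test'[OF T(2), of 0]) (use le C \<beta> in \<open>simp add: abs_mult\<close>)
    have "(\<Sum>j. card (P c c' j) * (C * \<beta> ^ Suc j)) \<le> (\<Sum>j. if j < T then 0 else ?K * sqrt \<beta> ^ j)"
      by (rule suminf_le[OF le s T(2)])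
    then have s2: "(\<Sum>j. card (P c c' j) * (C * \<beta> ^ Suc j)) \<le> 1 / 2" using T(3) by simp
    have Pf: "finite (P c c' j)" "P c c' j \<subseteq> VH" for j using fin_barrier by (auto simp: P_def)
    show "A c c' \<in> events"
      unfolding A_def by (rule H.closed_no_exit_prob(1)[OF w near(1,2) outer Pf decay s s2])
    have "r ^ N \<le> r ^ card (near c c')" using r near(3) by (intro power_decreasing) auto
    also have "\<dots> = (\<Prod>e\<in>near c c'. r)" by simp
    also have "\<dots> \<le> (\<Prod>e\<in>near c c'. 1 - \<pi> e)" using r r\<pi> by (intro prod_mono) auto
    finally have "r ^ N / 2 \<le> (\<Prod>e\<in>near c c'. 1 - \<pi> e) / 2" by simp
    also have "\<dots> \<le> prob (A c c')"
      unfolding A_def by (rule H.closed_no_exit_prob(2)[OF w near(1,2) outer Pf decay s s2])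
    finally show "r ^ N / 2 \<le> prob (A c c')" .
  qed
  obtain up where up: "\<And>n. n < up n \<and> good J M \<Lambda> (up n)" using good_up by metis
  obtain down where down: "\<And>n. down n < n \<and> good J M \<Lambda> (down n)" using good_down by metis
  \<comment> \<open>The upper barrier lies above \<open>n\<close>, the lower one below
    \<open>- n\<close>. Any given starting vertex is therefore enclosed for all large
    \<open>n\<close>, and infinitely many occurring pairs include an enclosing one.\<close>
  define An where "An n = A (up (int n)) (down (- int n))" for n
  define L where "L = (\<Inter>m. \<Union>n\<in>{m..}. An n)"
  have L: "L \<in> events" "r ^ N / 2 \<le> prob L"
  proof -
    have An: "An n \<in> events" for n unfolding An_def by (rule A)
    show "L \<in> events" unfolding L_def using An by (intro sets.countable_INT image_subsetI sets.countable_UN') auto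
    show "r ^ N / 2 \<le> prob L" unfolding L_def
      by (rule prob_limsup_ge[OF An]) (unfold An_def, rule A(2))
  qed
  define X where "X = {\<omega> \<in> space ?M. \<exists>x\<in>VH. infinite {y. reach (open_edges H \<omega>) x y}}"
  have X: "X \<in> events" unfolding X_def by (rule H.sets_infinite_cluster[OF order_refl order_refl w])
  have "AE \<omega> in ?M. \<forall>x\<in>VH. finite {y. reach (open_edges (outer \<Lambda>) \<omega>) x y}"
  proof (rule H.AE_no_infinite_cluster[OF w outer decay])
    have "(\<lambda>k. C * \<beta> ^ k) \<longlonglongrightarrow> C * 0" using \<beta> by (intro tendsto_mult_left LIMSEQ_realpow_zero) auto
    then show "(\<lambda>k. C * \<beta> ^ k) \<longlonglongrightarrow> 0" by simp
  qed auto
  then have "AE \<omega> in ?M. \<omega> \<notin> L \<inter> X"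
    using AE_space
  proof eventually_elim
    case (elim \<omega>)
    show ?case
    proof
      assume LX: "\<omega> \<in> L \<inter> X"
      let ?\<omega> = "open_edges H \<omega>"
      have sub: "?\<omega> \<subseteq> H" by (rule open_edges_subset)
      have out: "?\<omega> \<inter> outer \<Lambda> = open_edges (outer \<Lambda>) \<omega>" by (rule open_edges_Int[OF outer(1)])
      have fin: "finite {y. reach (?\<omega> \<inter> outer \<Lambda>) x y}" if "x \<in> VH" for x
        unfolding out using elim(1) that by blast
      obtain x where "infinite {y. reach ?\<omega> x y}" using LX by (auto simp: X_def)
      moreover have "finite {w. {v, w} \<in> ?\<omega>}" for v
        by (rule finite_subset[OF _ H.finite_nbrs[of v]]) (use sub in auto)
      ultimately obtain \<gamma> where \<gamma>: "inj \<gamma>" "\<And>n. {\<gamma> n, \<gamma> (Suc n)} \<in> ?\<omega>"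
        using infinite_cluster_imp_ray by metis
      obtain i0 where i0: "\<gamma> i0 \<in> R \<Lambda>" using ray_meets_R[OF sub \<gamma>(2,1) fin] by blast
      obtain n where n: "nat \<bar>snd (\<gamma> i0)\<bar> \<le> n" "\<omega> \<in> An n"
        using LX by (auto simp: L_def)
      let ?c = "up (int n)" and ?c' = "down (- int n)"
      have c: "snd (\<gamma> i0) \<le> ?c" "?c' \<le> snd (\<gamma> i0)" using n(1) up[of "int n"] down[of "- int n"] by auto
      show False
      proof (rule no_infinite_cluster_between_barriers[OF _ _ \<Delta>(3) T(1) sub _ _ \<gamma>(2,1) fin i0 c])
        show "good J M \<Lambda> ?c" "good J M \<Lambda> ?c'" using up down by auto
        show "?\<omega> \<inter> H.touching (\<Union>j<T. barrier J M ?c ?c' j) = {}"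
          using n(2) unfolding An_def A_def near_def[symmetric] by (auto simp: open_edges_def)
        show "\<not> H.exits x (graph_ball VH H x j) (?\<omega> \<inter> outer \<Lambda>)" if "T \<le> j" "x \<in> barrier J M ?c ?c' j" for j x
        proof -
          have "x \<in> P ?c ?c' j" using that by (simp add: P_def)
          then show ?thesis using n(2) unfolding An_def A_def out by blast
        qed
      qed
    qed
  qed
  then have "prob (L \<inter> X) = 0" using L(1) X by (simp add: prob_eq_0)
  moreover have "prob L \<le> prob (L \<inter> X) + prob (L - X)"
    using measure_Un_le[of "L \<inter> X" ?M "L - X"] L(1) X by (simp add: Int_Diff_Un)
  moreover have "prob (L - X) \<le> prob (space ?M - X)"
    using L(1) X sets.sets_into_space[OF L(1)] by (intro finite_measure_mono) auto
  moreover have "prob (space ?M - X) = 1 - prob X" using X by (rule prob_compl)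
  moreover have "0 < r ^ N / 2" using r by simp
  ultimately have "prob X \<noteq> 1" using L(2) by linarith
  then have "prob X = 0" using H.zero_one_infinite_cluster[OF w] by (auto simp: X_def)
  moreover have "{\<omega> \<in> space ?M. \<exists>\<gamma>. infinite_open_path H \<omega> (z, 0) \<gamma>} \<subseteq> X"
    unfolding H.infinite_open_path_iff X_def using z_V by auto
  then have "prob {\<omega> \<in> space ?M. \<exists>\<gamma>. infinite_open_path H \<omega> (z, 0) \<gamma>} \<le> prob X"
    using X by (intro finite_measure_mono) auto
  ultimately have "prob {\<omega> \<in> space ?M. \<exists>\<gamma>. infinite_open_path H \<omega> (z, 0) \<gamma>} = 0"
    by (simp only: measure_le_0_iff)
  then show ?thesis
    unfolding theta_overlap_def perc_prob_def \<pi>_def[abs_def] .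
qed

end

subsection \<open>The random environment\<close>

text \<open>The layer-cake formula. A general \<open>g\<close> is allowed because both
  \<open>X\<close> and the multiple \<open>2 * J * X\<close> are needed.\<close>

lemma nn_integral_nat_tails:
  "(\<integral>\<^sup>+ x. of_nat (g x) \<partial>measure_pmf D) = (\<Sum>k. ennreal (measure_pmf.prob D {x. k < g x}))"
proof -
  have "of_nat (g x) = (\<Sum>k. indicator {x. k < g x} x :: ennreal)" for x
  proof -
    have "(\<Sum>k. indicator {x. k < g x} x :: ennreal) = (\<Sum>k<g x. indicator {x. k < g x} x)"
      by (rule suminf_finite) auto
    also have "\<dots> = of_nat (g x)" by simp
    finally show ?thesis by simp
  qed
  then have "(\<integral>\<^sup>+ x. of_nat (g x) \<partial>measure_pmf D) = (\<integral>\<^sup>+ x. (\<Sum>k. indicator {x. k < g x} x) \<partial>measure_pmf D)"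
    by simp
  also have "\<dots> = (\<Sum>k. \<integral>\<^sup>+ x. indicator {x. k < g x} x \<partial>measure_pmf D)"
    by (rule nn_integral_suminf) simp
  also have "\<dots> = (\<Sum>k. ennreal (measure_pmf.prob D {x. k < g x}))"
    by (simp add: measure_pmf.emeasure_eq_measure)
  finally show ?thesis .
qed

lemma nn_integral_finite_iff_summable_tails:
  "(\<integral>\<^sup>+ x. of_nat (g x) \<partial>measure_pmf D) < \<infinity> \<longleftrightarrow> summable (\<lambda>k. measure_pmf.prob D {x. k < g x})"
proof
  assume "summable (\<lambda>k. measure_pmf.prob D {x. k < g x})"
  then show "(\<integral>\<^sup>+ x. of_nat (g x) \<partial>measure_pmf D) < \<infinity>"
    unfolding nn_integral_nat_tails by (subst suminf_ennreal2) auto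
next
  assume "(\<integral>\<^sup>+ x. of_nat (g x) \<partial>measure_pmf D) < \<infinity>"
  then show "summable (\<lambda>k. measure_pmf.prob D {x. k < g x})"
    unfolding nn_integral_nat_tails by (intro summable_suminf_not_top) auto
qed

lemma product_prob_space_env: "product_prob_space (\<lambda>_ :: int. measure_pmf D)"
  by (intro product_prob_spaceI measure_pmf.prob_space_axioms)

lemma prob_space_env: "prob_space (env_measure D)"
  unfolding env_measure_def by (intro prob_space_PiM measure_pmf.prob_space_axioms)

lemma space_env [simp]: "space (env_measure D) = UNIV"
  by (simp add: env_measure_def space_PiM PiE_UNIV_domain)

lemma env_single:
  shows sets_env_single: "{\<Lambda>. \<Lambda> n \<in> S} \<in> sets (env_measure D)"
    and prob_env_single: "measure (env_measure D) {\<Lambda>. \<Lambda> n \<in> S} = measure_pmf.prob D S"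
proof -
  interpret product_prob_space "\<lambda>_ :: int. measure_pmf D" UNIV by (rule product_prob_space_env)
  have "{\<Lambda> \<in> space (PiM UNIV (\<lambda>_ :: int. measure_pmf D)). \<Lambda> n \<in> S} \<in> sets (PiM UNIV (\<lambda>_ :: int. measure_pmf D))"
    by (rule sets_Collect_single') auto
  then show "{\<Lambda>. \<Lambda> n \<in> S} \<in> sets (env_measure D)"
    by (simp add: env_measure_def space_PiM PiE_UNIV_domain)
  have "emeasure (PiM UNIV (\<lambda>_ :: int. measure_pmf D)) {\<Lambda> \<in> space (PiM UNIV (\<lambda>_ :: int. measure_pmf D)). \<Lambda> n \<in> S} = emeasure (measure_pmf D) S"
    by (rule emeasure_PiM_Collect_single) auto
  then show "measure (env_measure D) {\<Lambda>. \<Lambda> n \<in> S} = measure_pmf.prob D S"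
    by (simp add: env_measure_def space_PiM PiE_UNIV_domain measure_def)
qed

context cylinder_graph
begin

text \<open>The constraint that \<open>good\<close> puts on a single radius, as a set of natural
  numbers; \<open>good\<close> becomes a countable intersection of one-coordinate events.\<close>

definition tame :: "nat \<Rightarrow> nat \<Rightarrow> int \<Rightarrow> nat set" where
  "tame J M k = {x. 2 * J * x \<le> 2 * J * M + nat \<bar>k\<bar>}"

lemma good_iff: "good J M \<Lambda> c \<longleftrightarrow> (\<forall>k. \<Lambda> (c + k) \<in> tame J M k)"
proof -
  have "2 * int J * int x \<le> 2 * int J * int M + \<bar>k\<bar> \<longleftrightarrow> x \<in> tame J M k" for x k
  proof -
    have "2 * int J * int x \<le> 2 * int J * int M + \<bar>k\<bar> \<longleftrightarrow> int (2 * J * x) \<le> int (2 * J * M + nat \<bar>k\<bar>)" by simp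
    then show ?thesis by (simp only: of_nat_le_iff tame_def mem_Collect_eq)
  qed
  then show ?thesis by (simp add: good_def)
qed

lemma sets_good: "{\<Lambda>. good J M \<Lambda> c} \<in> sets (env_measure D)"
proof -
  have "{\<Lambda>. good J M \<Lambda> c} = (\<Inter>k. {\<Lambda>. \<Lambda> (c + k) \<in> tame J M k})" by (auto simp: good_iff)
  also have "\<dots> \<in> sets (env_measure D)" by (intro sets.countable_INT image_subsetI sets_env_single) auto
  finally show ?thesis .
qed

text \<open>By the union bound over \<open>k\<close>, the probability of failure is at most a
  two-sided tail of the convergent series, and a larger \<open>M\<close> moves the tail further out.
  The law of the environment is stationary, so the same \<open>M\<close> serves all
  \<open>c\<close>.\<close>

lemma prob_good_ge:
  assumes "summable (\<lambda>k. measure_pmf.prob D {x. k < 2 * J * x})" "0 < J"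
  obtains M where "\<And>c. 1 / 2 \<le> measure (env_measure D) {\<Lambda>. good J M \<Lambda> c}"
proof -
  interpret prob_space "env_measure D" by (rule prob_space_env)
  let ?a = "\<lambda>k. measure_pmf.prob D {x. k < 2 * J * x}"
  \<comment> \<open>The tail is used twice, for the offsets \<open>int i\<close> and
    \<open>- int i\<close>, so 1/4 leads to a failure probability of at most 1/2.\<close>
  obtain M where M: "\<And>n. M \<le> n \<Longrightarrow> norm (\<Sum>i. ?a (i + n)) < 1 / 4"
    using suminf_exist_split[OF _ assms(1), of "1/4"] by auto
  let ?N = "2 * J * M"
  have a: "summable (\<lambda>i. ?a (i + ?N))" by (rule summable_ignore_initial_segment[OF assms(1)])
  have tame: "measure_pmf.prob D (- tame J M k) = ?a (nat \<bar>k\<bar> + ?N)" for k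
    by (rule arg_cong[where f = "measure_pmf.prob D"]) (auto simp: tame_def)
  have "1 / 2 \<le> prob {\<Lambda>. good J M \<Lambda> c}" for c
  proof -
    define B where "B i = {\<Lambda>. \<Lambda> (c + int i) \<in> - tame J M (int i)} \<union> {\<Lambda>. \<Lambda> (c + - int i) \<in> - tame J M (- int i)}" for i
    have B: "B i \<in> events" for i unfolding B_def by (intro sets.Un sets_env_single)
    have pB: "prob (B i) \<le> 2 * ?a (i + ?N)" for i
    proof -
      have "prob (B i) \<le> prob {\<Lambda>. \<Lambda> (c + int i) \<in> - tame J M (int i)} + prob {\<Lambda>. \<Lambda> (c + - int i) \<in> - tame J M (- int i)}"
        unfolding B_def by (intro measure_Un_le sets_env_single)
      also have "\<dots> = 2 * ?a (i + ?N)" unfolding prob_env_single tame by simp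
      finally show ?thesis .
    qed
    have s2: "summable (\<lambda>i. 2 * ?a (i + ?N))" by (rule summable_mult[OF a])
    have s: "summable (\<lambda>i. prob (B i))"
      by (rule summable_comparison_test'[OF s2, of 0]) (use pB in simp)
    have "space (env_measure D) - {\<Lambda>. good J M \<Lambda> c} \<subseteq> (\<Union>i. B i)"
    proof
      fix \<Lambda> assume "\<Lambda> \<in> space (env_measure D) - {\<Lambda>. good J M \<Lambda> c}"
      then obtain k where k: "\<Lambda> (c + k) \<notin> tame J M k" by (auto simp: good_iff)
      then have "\<Lambda> \<in> B (nat \<bar>k\<bar>)" by (cases "0 \<le> k") (auto simp: B_def)
      then show "\<Lambda> \<in> (\<Union>i. B i)" by blast
    qed
    then have "prob (space (env_measure D) - {\<Lambda>. good J M \<Lambda> c}) \<le> prob (\<Union>i. B i)"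
      using B by (intro finite_measure_mono) auto
    also have "\<dots> \<le> (\<Sum>i. prob (B i))" using B s by (intro finite_measure_subadditive_countably) auto
    also have "\<dots> \<le> (\<Sum>i. 2 * ?a (i + ?N))" by (rule suminf_le[OF pB s s2])
    also have "\<dots> = 2 * (\<Sum>i. ?a (i + ?N))" by (rule suminf_mult[OF a])
    also have "\<dots> \<le> 2 * (1 / 4)"
    proof -
      have "M \<le> ?N" using assms(2) by simp
      from M[OF this] show ?thesis by simp
    qed
    finally show ?thesis using prob_compl[OF sets_good, of J M c] by simp
  qed
  then show ?thesis using that by blast
qed

text \<open>The existence of good heights arbitrarily far out does not change when finitely many
  radii are altered, so it has probability 0 or 1; \<open>prob_limsup_ge\<close> rules out 0. The
  sign \<open>s\<close> selects the direction.\<close>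

lemma AE_good:
  assumes half: "\<And>c. 1 / 2 \<le> measure (env_measure D) {\<Lambda>. good J M \<Lambda> c}" and s: "s = 1 \<or> s = -1"
  shows "AE \<Lambda> in env_measure D. \<forall>n::nat. \<exists>c. int n < s * c \<and> good J M \<Lambda> c"
proof -
  interpret product_prob_space "\<lambda>_ :: int. measure_pmf D" UNIV by (rule product_prob_space_env)
  have env: "PiM UNIV (\<lambda>_ :: int. measure_pmf D) = env_measure D" by (simp add: env_measure_def)
  define Y where "Y K = {\<Lambda> \<in> space (PiM (UNIV - K) (\<lambda>_ :: int. measure_pmf D)).
      \<forall>n::nat. \<exists>c. int n < s * c \<and> (\<forall>k. c + k \<notin> K \<longrightarrow> \<Lambda> (c + k) \<in> tame J M k)}" for K :: "int set"
  have Y: "Y K \<in> sets (PiM (UNIV - K) (\<lambda>_ :: int. measure_pmf D))" for K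
  proof -
    have "{\<Lambda> \<in> space (PiM (UNIV - K) (\<lambda>_ :: int. measure_pmf D)). c + k \<notin> K \<longrightarrow> \<Lambda> (c + k) \<in> tame J M k}
        \<in> sets (PiM (UNIV - K) (\<lambda>_ :: int. measure_pmf D))" for c k
    proof (cases "c + k \<in> K")
      case False
      then have "{\<Lambda> \<in> space (PiM (UNIV - K) (\<lambda>_ :: int. measure_pmf D)). \<Lambda> (c + k) \<in> tame J M k}
        \<in> sets (PiM (UNIV - K) (\<lambda>_ :: int. measure_pmf D))"
        by (intro sets_Collect_single') auto
      then show ?thesis using False by simp
    qed simp
    then show ?thesis
      unfolding Y_def
      by (intro sets.sets_Collect_countable_All sets.sets_Collect_countable_Ex sets.sets_Collect_conj sets.sets_Collect_const)
  qed
  let ?X = "{\<Lambda>. \<forall>n::nat. \<exists>c. int n < s * c \<and> good J M \<Lambda> c}"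
  have X: "?X = {\<Lambda> \<in> space (PiM UNIV (\<lambda>_ :: int. measure_pmf D)). restrict \<Lambda> (UNIV - K) \<in> Y K}" if K: "finite K" for K
  proof -
    have "(\<forall>n::nat. \<exists>c. int n < s * c \<and> good J M \<Lambda> c) \<longleftrightarrow>
        (\<forall>n::nat. \<exists>c. int n < s * c \<and> (\<forall>k. c + k \<notin> K \<longrightarrow> \<Lambda> (c + k) \<in> tame J M k))" (is "?l \<longleftrightarrow> ?r") for \<Lambda>
    proof
      assume r: ?r
      \<comment> \<open>Once \<open>c\<close> is farther out than \<open>b\<close>, the allowance
        \<open>\<bar>k\<bar>\<close> at every site \<open>c + k\<close> of \<open>K\<close> exceeds
        \<open>2 * J\<close> times the radius there, so the constraints at the sites of
        \<open>K\<close> hold by themselves.\<close>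
      define b where "b = (\<Sum>j\<in>K. 2 * J * \<Lambda> j + nat \<bar>j\<bar>)"
      have b: "2 * J * \<Lambda> j + nat \<bar>j\<bar> \<le> b" if "j \<in> K" for j
        unfolding b_def using K that by (rule member_le_sum[rotated -1]) auto
      show ?l
      proof
        fix n :: nat
        obtain c where c: "int (n + b) < s * c" "\<And>k. c + k \<notin> K \<Longrightarrow> \<Lambda> (c + k) \<in> tame J M k" using r by blast
        have "\<Lambda> (c + k) \<in> tame J M k" for k
        proof (cases "c + k \<in> K")
          case True
          have "int b < \<bar>c\<bar>" using c(1) s by auto
          moreover have "\<bar>c\<bar> \<le> \<bar>c + k\<bar> + \<bar>k\<bar>" by simp
          moreover have "int (2 * J * \<Lambda> (c + k)) + \<bar>c + k\<bar> \<le> int b" using b[OF True] by linarith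
          ultimately have "int (2 * J * \<Lambda> (c + k)) \<le> \<bar>k\<bar>" by linarith
          then have "2 * J * \<Lambda> (c + k) \<le> nat \<bar>k\<bar>" by linarith
          then show ?thesis unfolding tame_def by (simp add: trans_le_add2)
        qed (use c in blast)
        then show "\<exists>c. int n < s * c \<and> good J M \<Lambda> c" using c(1) by (auto simp: good_iff intro!: exI[of _ c])
      qed
    qed (unfold good_iff, blast)
    then show ?thesis by (auto simp: Y_def space_PiM PiE_UNIV_domain)
  qed
  have Xe: "?X \<in> events"
    using Y[of "{}"] unfolding X[OF finite.emptyI] by (simp add: space_PiM PiE_UNIV_domain restrict_def)
  have "prob ?X = 0 \<or> prob ?X = 1"
  proof (rule tail_zero_one[OF Xe])
    fix K :: "int set" assume "finite K" "K \<subseteq> UNIV"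
    then show "\<exists>Y\<in>sets (PiM (UNIV - K) (\<lambda>_ :: int. measure_pmf D)).
        ?X = {\<omega> \<in> space (PiM UNIV (\<lambda>_ :: int. measure_pmf D)). restrict \<omega> (UNIV - K) \<in> Y}"
      by (intro bexI[OF _ Y] X)
  qed
  moreover have "1 / 2 \<le> prob ?X"
  proof -
    define A where "A m = {\<Lambda>. good J M \<Lambda> (s * int m)}" for m
    have "1 / 2 \<le> prob (\<Inter>n. \<Union>m\<in>{n..}. A m)"
      using half sets_good unfolding A_def env by (intro prob_space.prob_limsup_ge prob_space_env) auto
    also have "\<dots> \<le> prob ?X"
    proof (rule finite_measure_mono[OF _ Xe])
      show "(\<Inter>n. \<Union>m\<in>{n..}. A m) \<subseteq> ?X"
      proof (intro subsetI CollectI allI)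
        fix \<Lambda> n assume "\<Lambda> \<in> (\<Inter>n. \<Union>m\<in>{n..}. A m)"
        then obtain m where "Suc n \<le> m" "good J M \<Lambda> (s * int m)" unfolding A_def by blast
        then show "\<exists>c. int n < s * c \<and> good J M \<Lambda> c" using s by (intro exI[of _ "s * int m"]) auto
      qed
    qed
    finally show ?thesis .
  qed
  ultimately have "prob ?X = 1" by auto
  then have "AE \<Lambda> in PiM UNIV (\<lambda>_ :: int. measure_pmf D). \<Lambda> \<in> ?X"
    using Xe by (simp add: prob_eq_1)
  then show ?thesis unfolding env by simp
qed

text \<open>The second Borel-Cantelli argument in elementary form, by 1 - b \<le> exp (- b) and
  independence. A box at height \<open>n\<close> with radius above \<open>r + n\<close> contains
  every vertex whose distance from \<open>z\<close> and absolute height add up to at most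
  \<open>r\<close>; heights \<open>n \<ge> 0\<close> already provide such a box for each
  \<open>r\<close>.\<close>

lemma AE_R_everything:
  assumes "\<not> summable (\<lambda>k. measure_pmf.prob D {x. k < x})"
  shows "AE \<Lambda> in env_measure D. VH \<subseteq> R \<Lambda>"
proof -
  interpret product_prob_space "\<lambda>_ :: int. measure_pmf D" UNIV by (rule product_prob_space_env)
  have env: "PiM UNIV (\<lambda>_ :: int. measure_pmf D) = env_measure D" by (simp add: env_measure_def)
  have "AE \<Lambda> in env_measure D. \<exists>n::nat. r + n < \<Lambda> (int n)" for r :: nat
  proof -
    let ?Z = "{\<Lambda>. \<forall>n::nat. \<Lambda> (int n) \<in> - {x. r + n < x}}"
    let ?b = "\<lambda>n. measure_pmf.prob D {x. r + n < x}"
    have Zeq: "?Z = (\<Inter>n. {\<Lambda>. \<Lambda> (int n) \<in> - {x. r + n < x}})" by auto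
    have Z: "?Z \<in> events" unfolding Zeq env by (intro sets.countable_INT image_subsetI sets_env_single) auto
    have bound: "prob ?Z \<le> exp (- (\<Sum>n<N. ?b n))" for N
    proof -
      let ?S = "\<lambda>j. - {x. r + nat j < x}"
      let ?C = "{\<Lambda> \<in> space (PiM UNIV (\<lambda>_ :: int. measure_pmf D)). \<forall>j\<in>int ` {..<N}. \<Lambda> j \<in> ?S j}"
      have C: "?C \<in> events"
        by (intro sets.sets_Collect_finite_All sets_Collect_single') auto
      have "prob ?Z \<le> prob ?C"
        by (intro finite_measure_mono C) (auto simp: space_PiM PiE_UNIV_domain)
      also have "prob ?C = (\<Prod>j\<in>int ` {..<N}. measure_pmf.prob D (?S j))"
      proof -
        have "emeasure (PiM UNIV (\<lambda>_ :: int. measure_pmf D)) ?C = (\<Prod>j\<in>int ` {..<N}. emeasure (measure_pmf D) (?S j))"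
          by (intro emeasure_PiM_Collect) auto
        then show ?thesis
          by (simp add: measure_pmf.emeasure_eq_measure emeasure_eq_measure prod_ennreal prod_nonneg)
      qed
      also have "\<dots> = (\<Prod>n<N. measure_pmf.prob D (?S (int n)))" by (subst prod.reindex) auto
      also have "\<dots> = (\<Prod>n<N. 1 - ?b n)"
        by (intro prod.cong refl) (simp add: measure_pmf.prob_compl[of _ D, simplified] Compl_eq_Diff_UNIV)
      also have "\<dots> \<le> (\<Prod>n<N. exp (- ?b n))"
      proof (rule prod_mono)
        fix n
        show "0 \<le> 1 - ?b n \<and> 1 - ?b n \<le> exp (- ?b n)" using exp_ge_add_one_self[of "- ?b n"] by simp
      qed
      also have "\<dots> = exp (- (\<Sum>n<N. ?b n))" by (simp add: exp_sum sum_negf[symmetric])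
      finally show ?thesis .
    qed
    have "prob ?Z = 0"
    proof (rule ccontr)
      assume "prob ?Z \<noteq> 0"
      then have pos: "0 < prob ?Z" by (simp add: zero_less_measure_iff)
      \<comment> \<open>If all these boxes were missing with positive probability, the partial sums
        would be bounded and the shifted tail series, hence the original one, would
        converge.\<close>
      have "(\<Sum>n<N. ?b n) \<le> - ln (prob ?Z)" for N
        using ln_mono[OF bound[of N] pos] by simp
      then have "summable ?b" by (intro summableI_nonneg_bounded) auto
      then have "summable (\<lambda>k. measure_pmf.prob D {x. k < x})"
        using summable_iff_shift[of "\<lambda>k. measure_pmf.prob D {x. k < x}" r] by (simp add: add.commute)
      then show False using assms by simp
    qed
    then have "AE \<Lambda> in env_measure D. \<Lambda> \<notin> ?Z" using Z unfolding env[symmetric] by (simp add: prob_eq_0)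
    then show ?thesis by eventually_elim auto
  qed
  then have "AE \<Lambda> in env_measure D. \<forall>r. \<exists>n::nat. r + n < \<Lambda> (int n)" by (subst AE_all_countable) auto
  then show ?thesis
  proof eventually_elim
    case (elim \<Lambda>)
    show ?case
    proof
      fix x assume "x \<in> VH"
      then obtain v h where x: "x = (v, h)" "v \<in> V" by auto
      obtain n where n: "d z v + nat \<bar>h\<bar> + n < \<Lambda> (int n)" using elim by blast
      then have "x \<in> overlap_box V E z (int n) (\<Lambda> (int n))"
        using x by (auto simp: overlap_box_def graph_ball_def)
      then show "x \<in> R \<Lambda>" unfolding overlap_region_def by blast
    qed
  qed
qed

section \<open>Comparison with the homogeneous model and its critical point\<close>

lemma theta_overlap_everything:
  assumes "VH \<subseteq> R \<Lambda>"
  shows "theta_overlap V E z \<Lambda> p q = theta_hom V E z q"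
proof -
  have "e \<subseteq> R \<Lambda>" if "e \<in> H" for e using H.edges[OF that] assms by auto
  then have "bond_measure H (\<lambda>e. if e \<subseteq> R \<Lambda> then q else p) = bond_measure H (\<lambda>_. q)"
    unfolding bond_measure_def by (intro PiM_cong) auto
  then show ?thesis by (simp add: theta_overlap_def theta_hom_def perc_prob_def)
qed

text \<open>Puts 0 into the set whose supremum is \<open>p_crit\<close>. Without a member of this
  set, \<open>Sup\<close> on the reals would say nothing.\<close>

lemma theta_hom_0: "theta_hom V E z 0 = 0"
proof -
  let ?M = "bond_measure H (\<lambda>_. 0)" and ?F = "H.touching {(z, 0)}"
  interpret prob_space ?M by (rule prob_space_bond_measure)
  have F: "finite ?F" "?F \<subseteq> H" "weights ?F (\<lambda>_. 0)"
    using H.finite_touching' H.touching_subset by (auto simp: weights_def)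
  let ?X = "{\<omega> \<in> space ?M. \<not> open_edges ?F \<omega> = {}}"
  have "{\<omega> \<in> space ?M. \<exists>\<gamma>. infinite_open_path H \<omega> (z, 0) \<gamma>} \<subseteq> ?X"
  proof
    fix \<omega> assume "\<omega> \<in> {\<omega> \<in> space ?M. \<exists>\<gamma>. infinite_open_path H \<omega> (z, 0) \<gamma>}"
    then obtain \<gamma> where "\<omega> \<in> space ?M" "infinite_open_path H \<omega> (z, 0) \<gamma>" by blast
    then have "\<omega> \<in> space ?M" "\<gamma> 0 = (z, 0)" "{\<gamma> 0, \<gamma> (Suc 0)} \<in> H" "\<omega> {\<gamma> 0, \<gamma> (Suc 0)}"
      unfolding infinite_open_path_def by blast+
    then have "\<omega> \<in> space ?M" "{\<gamma> 0, \<gamma> (Suc 0)} \<in> open_edges ?F \<omega>" by (auto simp: open_edges_def H.touching_def)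
    then show "\<omega> \<in> ?X" by blast
  qed
  moreover have "?X \<in> events" by (rule sets_cylinder[OF F])
  ultimately have "theta_hom V E z 0 \<le> prob ?X"
    unfolding theta_hom_def perc_prob_def by (intro finite_measure_mono)
  also have "\<dots> = 0"
    using measure_cylinder[OF F, of "\<lambda>\<omega>. \<not> \<omega> = {}"] cprob_not[OF F(1), of _ "\<lambda>\<omega>. \<omega> = {}"]
      cprob_all_closed[OF F(1), of "\<lambda>_. 0"] by simp
  finally show ?thesis unfolding theta_hom_def perc_prob_def by (simp only: measure_le_0_iff)
qed

lemma theta_hom_above_p_crit: "p_crit V E z < q \<Longrightarrow> q \<le> 1 \<Longrightarrow> theta_hom V E z q \<noteq> 0"
proof
  assume q: "p_crit V E z < q" "q \<le> 1" and "theta_hom V E z q = 0"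
  have bdd: "bdd_above {p \<in> {0..1}. theta_hom V E z p = 0}" by (rule bdd_aboveI[of _ 1]) auto
  have "0 \<le> p_crit V E z"
    unfolding p_crit_def by (rule cSup_upper[OF _ bdd]) (simp add: theta_hom_0)
  then have "0 \<le> q" using q by simp
  then have "q \<le> p_crit V E z"
    unfolding p_crit_def using q(2) \<open>theta_hom V E z q = 0\<close> by (intro cSup_upper bdd) auto
  then show False using q by simp
qed

lemma theta_hom_below_p_crit:
  assumes "p < p_crit V E z"
  obtains p2 where "p < p2" "p2 \<le> 1" "theta_hom V E z p2 = 0"
proof -
  let ?S = "{p \<in> {0..1}. theta_hom V E z p = 0}"
  have "bdd_above ?S" by (rule bdd_aboveI[of _ 1]) auto
  moreover have "0 \<in> ?S" by (simp add: theta_hom_0)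
  then have "?S \<noteq> {}" by blast
  ultimately have "\<exists>p2\<in>?S. p < p2"
    using assms less_cSup_iff[of ?S p] unfolding p_crit_def by blast
  then show ?thesis using that by auto
qed

text \<open>The order of choices matters: \<open>p2\<close> above \<open>p\<close> with vanishing
  percolation probability, then the decay rate \<open>\<beta>\<close>, then \<open>J\<close> from
  \<open>\<beta>\<close> and the degree of the base graph, and finally \<open>M\<close>. A finite
  mean of \<open>X\<close> gives a finite mean of \<open>2 * J * X\<close> however large
  \<open>J\<close> is, so a small slope is always affordable.\<close>

lemma AE_theta_overlap_zero:
  assumes quasi: "quasi_transitive V E" and p: "0 < p" "p < p_crit V E z" and q: "0 \<le> q" "q < 1"
    and finite: "(\<integral>\<^sup>+ x. of_nat x \<partial>measure_pmf D) < \<infinity>"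
  shows "AE \<Lambda> in env_measure D. theta_overlap V E z \<Lambda> p q = 0"
proof -
  obtain p2 where p2: "p < p2" "p2 \<le> 1" "theta_hom V E z p2 = 0"
    using theta_hom_below_p_crit[OF p(2)] by blast
  obtain V0 where V0: "H.orbit_representatives V0"
    using H_orbits[OF quasi] by blast
  have z0: "(z, 0) \<in> VH" using z_V by simp
  have "perc_prob H (\<lambda>_. p2) (z, 0) = 0" using p2(3) by (simp add: theta_hom_def)
  from H.subcritical_exponential_decay[OF p(1) p2(1,2) z0 this V0]
  obtain \<beta> C where \<beta>: "0 < \<beta>" "\<beta> < 1" "0 \<le> C"
    and decay': "\<forall>x\<in>VH. \<forall>F k. finite F \<longrightarrow> F \<subseteq> H \<longrightarrow>
      cprob F (\<lambda>_. p) (\<lambda>\<omega>. \<exists>y. reach \<omega> x y \<and> k \<le> H.d x y) \<le> C * \<beta> ^ k" by (elim exE conjE)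
  have decay: "cprob F (\<lambda>_. p) (\<lambda>\<omega>. \<exists>y. reach \<omega> x y \<and> k \<le> H.d x y) \<le> C * \<beta> ^ k"
    if "x \<in> VH" "finite F" "F \<subseteq> H" for x F k
    by (rule decay'[rule_format, OF that])
  obtain DH where DH: "\<forall>v\<in>VH. card {w. {v, w} \<in> H} \<le> DH"
    using H.bounded_degree[OF V0] by (elim exE)
  obtain W0 where W0: "orbit_representatives W0"
    using quasi_transitive_orbits[OF quasi] by blast
  obtain DG where DG: "\<forall>v\<in>V. card {w. {v, w} \<in> E} \<le> DG"
    using bounded_degree[OF W0] by (elim exE)
  let ?\<Delta> = "Suc DG"
  obtain n where n: "sqrt \<beta> ^ n < 1 / real ?\<Delta>"
    using real_arch_pow_inv[of "1 / real ?\<Delta>" "sqrt \<beta>"] \<beta> by auto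
  \<comment> \<open>The successor makes \<open>J\<close> positive while keeping the inequality, as
    \<open>sqrt \<beta> < 1\<close>.\<close>
  define J where "J = Suc n"
  have "sqrt \<beta> ^ J \<le> sqrt \<beta> ^ n" using \<beta> by (intro power_decreasing) (auto simp: J_def)
  then have "sqrt \<beta> ^ J * real ?\<Delta> \<le> 1" using n by (simp add: pos_le_divide_eq[symmetric] del: of_nat_Suc)
  then have J: "real ?\<Delta> * sqrt \<beta> ^ J \<le> 1" "0 < J" by (simp_all add: J_def mult.commute del: of_nat_Suc)
  have "(\<integral>\<^sup>+ x. of_nat (2 * J * x) \<partial>measure_pmf D) = of_nat (2 * J) * (\<integral>\<^sup>+ x. of_nat x \<partial>measure_pmf D)"
    by (subst nn_integral_cmult[symmetric]) (auto simp: of_nat_mult)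
  also have "\<dots> < \<infinity>" using finite by (simp add: ennreal_mult_less_top ennreal_of_nat_eq_real_of_nat)
  finally have "summable (\<lambda>k. measure_pmf.prob D {x. k < 2 * J * x})"
    by (simp only: nn_integral_finite_iff_summable_tails)
  then obtain M where M: "\<And>c. 1 / 2 \<le> measure (env_measure D) {\<Lambda>. good J M \<Lambda> c}"
    using prob_good_ge[OF _ J(2)] by blast
  have "AE \<Lambda> in env_measure D. \<forall>n::nat. \<exists>c. int n < 1 * c \<and> good J M \<Lambda> c" by (rule AE_good[OF M]) simp
  moreover have "AE \<Lambda> in env_measure D. \<forall>n::nat. \<exists>c. int n < -1 * c \<and> good J M \<Lambda> c" by (rule AE_good[OF M]) simp
  ultimately show ?thesis
  proof eventually_elim
    case (elim \<Lambda>)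
    show ?case
    proof (rule quenched_zero[OF _ _ q \<beta> decay DH[rule_format] _ J])
      show "\<exists>c>n. good J M \<Lambda> c" for n
      proof -
        obtain c where "int (nat \<bar>n\<bar>) < 1 * c" "good J M \<Lambda> c" using elim(1) by blast
        then show ?thesis by (intro exI[of _ c]) auto
      qed
      show "\<exists>c<n. good J M \<Lambda> c" for n
      proof -
        obtain c where "int (nat \<bar>n\<bar>) < -1 * c" "good J M \<Lambda> c" using elim(2) by blast
        then show ?thesis by (intro exI[of _ c]) auto
      qed
      show "card (graph_ball V E z r) \<le> ?\<Delta> ^ r" for r using DG by (intro card_ball z_V) auto
    qed (use p p2 in auto)
  qed
qed

end

theorem theorem1:
  fixes V :: "'a set" and E :: "'a set set" and z :: 'a and D :: "nat pmf" and p q :: real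
  assumes "simple_graph V E"
    and "infinite V"
    and "connected_graph V E"
    and "quasi_transitive V E"
    and "z \<in> V"
    and "set_pmf D \<subseteq> {1..}"
    and "0 < p" and "p < p_crit V E z" and "p_crit V E z < q" and "q < 1"
  shows "(AE \<Lambda> in env_measure D. theta_overlap V E z \<Lambda> p q = 0) \<longleftrightarrow>
         (\<integral>\<^sup>+ x. of_nat x \<partial>measure_pmf D) < \<infinity>"
proof -
  interpret lfgraph V E by (rule lfgraph_base) fact+
  interpret cylinder_graph V E z by unfold_locales fact
  show ?thesis
  proof
    assume "(\<integral>\<^sup>+ x. of_nat x \<partial>measure_pmf D) < \<infinity>"
    then show "AE \<Lambda> in env_measure D. theta_overlap V E z \<Lambda> p q = 0"
      using assms by (intro AE_theta_overlap_zero) auto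
  next
    assume zero: "AE \<Lambda> in env_measure D. theta_overlap V E z \<Lambda> p q = 0"
    show "(\<integral>\<^sup>+ x. of_nat x \<partial>measure_pmf D) < \<infinity>"
    proof (rule ccontr)
      assume "\<not> (\<integral>\<^sup>+ x. of_nat x \<partial>measure_pmf D) < \<infinity>"
      then have "\<not> summable (\<lambda>k. measure_pmf.prob D {x. k < x})"
        by (simp only: nn_integral_finite_iff_summable_tails not_False_eq_True)
      \<comment> \<open>Where the region covers everything, the model is homogeneous with parameter
        \<open>q\<close> above the critical point, so the percolation probability cannot vanish. Two
        almost sure statements contradict each other.\<close>
      from AE_R_everything[OF this] zero have "AE \<Lambda> in env_measure D. False"
      proof eventually_elim
        case (elim \<Lambda>)
        then show ?case using theta_overlap_everything theta_hom_above_p_crit assms(9,10) by fastforce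
      qed
      then show False using prob_space.AE_False[OF prob_space_env] by blast
    qed
  qed
qed

end
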